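(* Let $\lambda\ge0$, $\alpha\in(0,1]$, $T>0$, $b\in(0,1]$, and $a_T=b\,e^{-\lambda T}T^{\alpha-1}/\Gamma(\alpha)$. Let $p(x,t)$, $t\in[0,T]$, and $p^*(x,t)$, $t\ge0$, be the (generalized) marginal probability density functions of the processes $X_t\sim\mathrm{EML}(\alpha,\lambda,b,T)$ and $X_t^*\sim\mathrm{EML}^*(\alpha,\lambda)$, respectively. (i) They solve the tempered fractional diffusion equations $$D_t^{\alpha,\lambda}p^*(x,t)=-\frac{\partial p^*(x,t)}{\partial x}+\delta(x)D_t^{\alpha,\lambda}(1),$$ $$D_t^{\alpha,\lambda}p(x,t)=-\frac{\partial p(x,t)}{\partial x}+\Big(\delta(x)D_t^{\alpha,\lambda}(1)+\delta'(x)-\delta'(x)\,a_T\,D_t^{\alpha,\lambda}(t)\Big),$$ where $\partial/\partial x$ is a weak derivative, $\delta$ is the Dirac delta and $\delta'$ its first distributional derivative. (ii) The pdf of $X_t^*$ is $$p^*(x,t)=e^{-\lambda t}h(x,t)+\lambda\int_0^te^{-\lambda y}h(x,y)\,dy,\qquad t,x\ge0,$$ where $h$ is the pdf of the inverse stable subordinator, $h(x,t)=\frac{t}{x\alpha}g(t,x)$, and $g$ is the pdf of the stable subordinator, with Laplace transform $\int_0^\infty e^{-st}g(t,x)\,dt=e^{-xs^\alpha}$. The pdf of $X_t$ is $$p(x,t)=-a_T\int_0^t\frac{\partial p^*(x,y)}{\partial x}\,dy+\delta(x),\qquad x\ge0,\ t\in[0,T].$$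
   Context: The exponential Mittag-Leffler processes $X_t\sim\mathrm{EML}(\alpha,\lambda,b,T)$ ($0\le t\le T$) and $X_t^*\sim\mathrm{EML}^*(\alpha,\lambda)$ ($t\ge0$) are nonnegative processes; only their marginal laws matter here, and these are determined by the moment generating functions $$\mathrm E(e^{sX_t})=1+ta_Ts+a_T\sum_{k=1}^\infty s^{k+1}\int_0^t\int_0^x\frac{e^{-\lambda y}y^{k\alpha-1}}{\Gamma(k\alpha)}\,dy\,dx,\qquad \mathrm E(e^{sX_t^*})=1+\sum_{k=1}^\infty s^k\int_0^t\frac{e^{-\lambda y}y^{k\alpha-1}}{\Gamma(k\alpha)}\,dy .$$ Densities are understood in the generalized sense (they may contain Dirac masses), as distributions in $x\in\mathbb R$ supported in $[0,\infty)$. The Riemann–Liouville tempered fractional derivative is $$D_t^{\alpha,\lambda}f(t)=\frac{e^{-\lambda t}}{\Gamma(n-\alpha)}\frac{d^n}{dt^n}\int_0^t(t-s)^{-\alpha+n-1}e^{\lambda s}f(s)\,ds,\qquad n-1\le\alpha<n,\ n\in\mathbb N;$$ for $\alpha=1$, $D_t^{1,\lambda}f(t)=e^{-\lambda t}\frac{d}{dt}(e^{\lambda t}f(t))$. $D_t^{\alpha,\lambda}(1)$ and $D_t^{\alpha,\lambda}(t)$ denote its action on the functions $t\mapsto1$ and $t\mapsto t$. *)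

theory Defs
  imports "HOL-Probability.Probability"
begin

text \<open>
  A distribution on the real line is represented by its pairing with test functions; only its
  values on test functions (smooth, compactly supported) are meaningful, and equality of
  distributions is \<^term>\<open>dist_eq\<close> below.
\<close>

type_synonym distribution = "(real \<Rightarrow> real) \<Rightarrow> real"

definition test_fun :: "(real \<Rightarrow> real) \<Rightarrow> bool" where
  "test_fun \<phi> \<longleftrightarrow>
     (\<forall>n x. (deriv ^^ n) \<phi> differentiable (at x)) \<and> (\<exists>R. \<forall>x. R < \<bar>x\<bar> \<longrightarrow> \<phi> x = 0)"

definition dist_eq :: "distribution \<Rightarrow> distribution \<Rightarrow> bool" where
  "dist_eq u v \<longleftrightarrow> (\<forall>\<phi>. test_fun \<phi> \<longrightarrow> u \<phi> = v \<phi>)"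

definition dirac :: distribution where
  "dirac = (\<lambda>\<phi>. \<phi> 0)"

definition weak_deriv :: "distribution \<Rightarrow> distribution" where
  "weak_deriv u = (\<lambda>\<phi>. - u (deriv \<phi>))"

text \<open>The generalized density of the law of \<open>X t\<close>, i.e. that law regarded as a distribution.\<close>

definition gpdf :: "'a measure \<Rightarrow> (real \<Rightarrow> 'a \<Rightarrow> real) \<Rightarrow> real \<Rightarrow> distribution" where
  "gpdf M X t = (\<lambda>\<phi>. \<integral>\<omega>. \<phi> (X t \<omega>) \<partial>M)"

text \<open>Time integrals over \<open>[0, t]\<close> of a family of distributions, taken weakly.\<close>

definition dist_integrable :: "(real \<Rightarrow> distribution) \<Rightarrow> real \<Rightarrow> bool" where
  "dist_integrable P t \<longleftrightarrow>
     (\<forall>\<phi>. test_fun \<phi> \<longrightarrow> set_integrable lborel {0..t} (\<lambda>y. P y \<phi>))"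

definition dist_integral :: "(real \<Rightarrow> distribution) \<Rightarrow> real \<Rightarrow> distribution" where
  "dist_integral P t = (\<lambda>\<phi>. LINT y:{0..t}|lborel. P y \<phi>)"

text \<open>
  Iterated derivatives relative to a set \<open>S\<close> of times. Derivatives are taken within \<open>S\<close> so that
  they are left derivatives at the right end point of \<open>S = {0<..T}\<close>; at interior points
  they are the ordinary ones.
\<close>

primrec nderiv_within :: "real set \<Rightarrow> nat \<Rightarrow> (real \<Rightarrow> real) \<Rightarrow> real \<Rightarrow> real" where
  "nderiv_within S 0 f = f"
| "nderiv_within S (Suc k) f = (\<lambda>t. vector_derivative (nderiv_within S k f) (at t within S))"

text \<open>The integer \<open>n\<close> with \<open>n - 1 \<le> \<alpha> < n\<close>; in particular \<open>n = 2\<close> when \<open>\<alpha> = 1\<close>.\<close>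

definition frac_order :: "real \<Rightarrow> nat" where
  "frac_order \<alpha> = nat \<lfloor>\<alpha>\<rfloor> + 1"

definition tempered_kernel :: "real \<Rightarrow> real \<Rightarrow> (real \<Rightarrow> real) \<Rightarrow> real \<Rightarrow> real \<Rightarrow> real" where
  "tempered_kernel \<alpha> lam f t s =
     (t - s) powr (- \<alpha> + real (frac_order \<alpha>) - 1) * exp (lam * s) * f s"

definition tempered_integral :: "real \<Rightarrow> real \<Rightarrow> (real \<Rightarrow> real) \<Rightarrow> real \<Rightarrow> real" where
  "tempered_integral \<alpha> lam f t = (LINT s:{0..t}|lborel. tempered_kernel \<alpha> lam f t s)"

text \<open>Existence of the Riemann--Liouville tempered fractional derivative throughout \<open>S\<close>.\<close>

definition tempered_differentiable ::
  "real set \<Rightarrow> real \<Rightarrow> real \<Rightarrow> (real \<Rightarrow> real) \<Rightarrow> bool" where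
  "tempered_differentiable S \<alpha> lam f \<longleftrightarrow>
     (\<forall>t\<in>S. set_integrable lborel {0..t} (tempered_kernel \<alpha> lam f t)) \<and>
     (\<forall>k<frac_order \<alpha>. nderiv_within S k (tempered_integral \<alpha> lam f) differentiable_on S)"

definition tempered_deriv ::
  "real set \<Rightarrow> real \<Rightarrow> real \<Rightarrow> (real \<Rightarrow> real) \<Rightarrow> real \<Rightarrow> real" where
  "tempered_deriv S \<alpha> lam f t =
     exp (- lam * t) / Gamma (real (frac_order \<alpha>) - \<alpha>) *
     nderiv_within S (frac_order \<alpha>) (tempered_integral \<alpha> lam f) t"

text \<open>The time derivative of a family of distributions acts after pairing with a test function.\<close>

definition dist_tempered_differentiable ::
  "real set \<Rightarrow> real \<Rightarrow> real \<Rightarrow> (real \<Rightarrow> distribution) \<Rightarrow> bool" where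
  "dist_tempered_differentiable S \<alpha> lam P \<longleftrightarrow>
     (\<forall>\<phi>. test_fun \<phi> \<longrightarrow> tempered_differentiable S \<alpha> lam (\<lambda>t. P t \<phi>))"

definition dist_tempered_deriv ::
  "real set \<Rightarrow> real \<Rightarrow> real \<Rightarrow> (real \<Rightarrow> distribution) \<Rightarrow> real \<Rightarrow> distribution" where
  "dist_tempered_deriv S \<alpha> lam P t = (\<lambda>\<phi>. tempered_deriv S \<alpha> lam (\<lambda>y. P y \<phi>) t)"

definition a_coeff :: "real \<Rightarrow> real \<Rightarrow> real \<Rightarrow> real \<Rightarrow> real" where
  "a_coeff \<alpha> lam b T = b * exp (- lam * T) * T powr (\<alpha> - 1) / Gamma \<alpha>"

definition eml_coeff :: "real \<Rightarrow> real \<Rightarrow> nat \<Rightarrow> real \<Rightarrow> real" where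
  "eml_coeff \<alpha> lam k t =
     (LINT y:{0..t}|lborel. exp (- lam * y) * y powr (real k * \<alpha> - 1) / Gamma (real k * \<alpha>))"

text \<open>
  The processes enter only through their marginal laws, which are characterized by the moment
  generating functions. The series start at index 1, hence the occurrences of \<^const>\<open>Suc\<close>.
\<close>

definition EML :: "real \<Rightarrow> real \<Rightarrow> real \<Rightarrow> real \<Rightarrow> 'a measure \<Rightarrow> (real \<Rightarrow> 'a \<Rightarrow> real) \<Rightarrow> bool" where
  "EML \<alpha> lam b T M X \<longleftrightarrow> prob_space M \<and>
     (\<forall>t\<in>{0..T}. X t \<in> borel_measurable M \<and> (AE \<omega> in M. 0 \<le> X t \<omega>) \<and>
        (\<forall>s. integrable M (\<lambda>\<omega>. exp (s * X t \<omega>)) \<and>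
             (\<integral>\<omega>. exp (s * X t \<omega>) \<partial>M) =
               1 + t * a_coeff \<alpha> lam b T * s +
               a_coeff \<alpha> lam b T *
                 (\<Sum>k. s ^ (Suc k + 1) * (LINT x:{0..t}|lborel. eml_coeff \<alpha> lam (Suc k) x))))"

definition EML_star :: "real \<Rightarrow> real \<Rightarrow> 'a measure \<Rightarrow> (real \<Rightarrow> 'a \<Rightarrow> real) \<Rightarrow> bool" where
  "EML_star \<alpha> lam M X \<longleftrightarrow> prob_space M \<and>
     (\<forall>t\<ge>0. X t \<in> borel_measurable M \<and> (AE \<omega> in M. 0 \<le> X t \<omega>) \<and>
        (\<forall>s. integrable M (\<lambda>\<omega>. exp (s * X t \<omega>)) \<and>
             (\<integral>\<omega>. exp (s * X t \<omega>) \<partial>M) =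
               1 + (\<Sum>k. s ^ Suc k * eml_coeff \<alpha> lam (Suc k) t)))"

text \<open>For \<open>\<alpha> = 1\<close> the stable subordinator is the deterministic drift \<open>D x = x\<close>.\<close>

definition stable_subordinator ::
  "real \<Rightarrow> 'a measure \<Rightarrow> (real \<Rightarrow> 'a \<Rightarrow> real) \<Rightarrow> bool" where
  "stable_subordinator \<alpha> N D \<longleftrightarrow> prob_space N \<and>
     (\<forall>x\<ge>0. D x \<in> borel_measurable N) \<and>
     (\<forall>\<omega>\<in>space N. D 0 \<omega> = 0 \<and> mono_on {0..} (\<lambda>x. D x \<omega>) \<and>
        (\<forall>x\<ge>0. continuous (at_right x) (\<lambda>y. D y \<omega>))) \<and>
     (\<forall>x\<ge>0. \<forall>d\<ge>0. distr N borel (\<lambda>\<omega>. D (x + d) \<omega> - D x \<omega>) = distr N borel (D d)) \<and>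
     (\<forall>(n::nat) \<tau>. 0 \<le> \<tau> 0 \<and> mono \<tau> \<longrightarrow>
        prob_space.indep_vars N (\<lambda>_. borel) (\<lambda>i \<omega>. D (\<tau> (Suc i)) \<omega> - D (\<tau> i) \<omega>) {..<n}) \<and>
     (\<forall>x\<ge>0. \<forall>s\<ge>0. (\<integral>\<omega>. exp (- s * D x \<omega>) \<partial>N) = exp (- x * s powr \<alpha>))"

definition inverse_subordinator :: "(real \<Rightarrow> 'a \<Rightarrow> real) \<Rightarrow> real \<Rightarrow> 'a \<Rightarrow> real" where
  "inverse_subordinator D t \<omega> = Inf {x. 0 \<le> x \<and> t < D x \<omega>}"

text \<open>
  The identity \<open>h(x,t) = w(x,t) g(t,x)\<close> between generalized densities, where \<open>g(\<cdot>,x)\<close> is the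
  density of \<open>G x\<close> and \<open>h(\<cdot>,t)\<close> the density of \<open>H t\<close>: the measures \<open>h(x,t) dx dt\<close> and
  \<open>w(x,t) g(t,x) dt dx\<close> over positive parameters agree. Unlike the pointwise identity, this
  also makes sense when the laws have no density.
\<close>

definition transposed_density ::
  "(real \<Rightarrow> real \<Rightarrow> real) \<Rightarrow> (real \<Rightarrow> real measure) \<Rightarrow> (real \<Rightarrow> real measure) \<Rightarrow> bool" where
  "transposed_density w G H \<longleftrightarrow>
     (\<forall>\<psi> \<in> borel_measurable (borel :: (real \<times> real) measure).
        (\<integral>\<^sup>+t\<in>{0<..}. (\<integral>\<^sup>+x. \<psi> (x, t) \<partial>H t) \<partial>lborel) =
        (\<integral>\<^sup>+x\<in>{0<..}. (\<integral>\<^sup>+t. ennreal (w x t) * \<psi> (x, t) \<partial>G x) \<partial>lborel))"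

text \<open>
  An honest density \<open>g t x\<close> of \<open>D x\<close> at \<open>t\<close>. Continuity in \<open>t > 0\<close> selects a version that may be
  evaluated at a fixed \<open>t\<close> while \<open>x\<close> varies. No such \<open>g\<close> exists when \<open>\<alpha> = 1\<close>.
\<close>

definition stable_density ::
  "'a measure \<Rightarrow> (real \<Rightarrow> 'a \<Rightarrow> real) \<Rightarrow> (real \<Rightarrow> real \<Rightarrow> real) \<Rightarrow> bool" where
  "stable_density N D g \<longleftrightarrow>
     (\<forall>x>0. distributed N lborel (D x) (\<lambda>t. ennreal (g t x)) \<and>
            continuous_on {0<..} (\<lambda>t. g t x) \<and> (\<forall>t>0. 0 \<le> g t x))"

definition inverse_density ::
  "real \<Rightarrow> (real \<Rightarrow> real \<Rightarrow> real) \<Rightarrow> real \<Rightarrow> real \<Rightarrow> real" where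
  "inverse_density \<alpha> g x t = (if 0 < x then t / (x * \<alpha>) * g t x else 0)"

end

theory Submission
  imports Defs
begin

text \<open>
  The \<open>C\<^sup>1\<close> closure on \<open>[0, \<infinity>)\<close> of the span of the exponentials \<open>x \<mapsto> e\<^sup>-\<^sup>i\<^sup>x\<close>, \<open>i \<in> \<nat>\<close>,
  contains the test functions. Every identity in question has the form \<open>L \<phi> + L' \<phi>' = 0\<close> with functionals
  \<open>L\<close>, \<open>L'\<close> that are bounded in the supremum norm, so it suffices to check it on exponentials, where
  it becomes an identity between the power series of the moment generating functions.

  For the fractional equations, \<open>e\<^sup>\<lambda>\<^sup>t\<close> times the \<open>k\<close>-th coefficient of the series of \<open>X\<^sup>*\<close> is the
  convolution of \<open>e\<^sup>\<lambda>\<^sup>t\<close> with the power kernel \<open>u\<^sub>a(t) = t\<^sup>a\<^sup>-\<^sup>1 / \<Gamma>(a)\<close> at \<open>a = k \<alpha>\<close>. As \<open>u\<^sub>a * u\<^sub>c = u\<^sub>a\<^sub>+\<^sub>c\<close>, a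
  Riemann--Liouville integral of order \<open>n - \<alpha>\<close> of the coefficient \<open>k + 1\<close> is the \<open>n\<close>-fold integral of
  the coefficient \<open>k\<close>; taking \<open>n\<close> derivatives leaves the series with its index shifted, that is, the
  pairing with \<open>\<phi>'\<close>. The coefficients for \<open>X\<close> are time integrals of those for \<open>X\<^sup>*\<close>.

  For the inverse subordinator, \<open>D x\<close> is distributed as \<open>x\<^sup>1\<^sup>/\<^sup>\<alpha> Z\<close> with \<open>Z = D 1\<close>, whence the hitting time of
  level \<open>t\<close> is distributed as \<open>(t / Z)\<^sup>\<alpha>\<close>. Its density is obtained by a power substitution, and its
  moment generating function from the negative moments of \<open>Z\<close>. Integration by parts matches it with
  the series of \<open>X\<^sup>*\<close>.
\<close>

section \<open>Power substitution and convolution\<close>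

text \<open>Approximating phi alone cannot prove an identity between a pairing with phi and one with
  phi', because phi' is not controlled by the supremum norm of phi. Hence the derivative is
  approximated first and integrated back from infinity, where phi vanishes. On e^(-ix),
  differentiation is multiplication by s = -i, which is an index shift in a power series in s. The
  kernels may be singular at an end point, and the series alternate at negative s. Since all
  coefficients are nonnegative, kernel identities are proved in \<open>ennreal\<close>, where
  Tonelli permits every exchange. Signs enter only through s^k, under a majorant uniform in time and
  summable for every s. At \<alpha> = 1 the order is n = 2 and n - \<alpha> = 1: the weight is
  regular, but two derivatives are taken; for \<alpha> < 1 there is one. Both cases pass through the
  same integrated equation, with the derivatives of 1 and t kept symbolic. At \<alpha> = 1 moreover
  Z is almost surely constant and has no density, so laws are identified before densities.\<close>

lemma nn_integral_exp_substitution: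
  fixes f :: "real \<Rightarrow> ennreal"
  assumes [measurable]: "f \<in> borel_measurable borel"
  shows "(\<integral>\<^sup>+t\<in>{0<..}. f t \<partial>lborel) = (\<integral>\<^sup>+u. f (exp u) * ennreal (exp u) \<partial>lborel)"
proof -
  \<comment> \<open>The substitution is made on compact intervals and passed to the limit by
    continuity from below of the two density measures. \<open>Suc n\<close> keeps the intervals
    nondegenerate.\<close>
  define A where "A n = {exp (- real (Suc n)) .. exp (real (Suc n))}" for n
  define B where "B n = {- real (Suc n) .. real (Suc n)}" for n
  have A: "(\<Union>n. A n) = {0<..}"
  proof (intro equalityI subsetI)
    fix x :: real assume "x \<in> {0<..}"
    then have x: "x > 0" by simp
    obtain n where "\<bar>ln x\<bar> \<le> real n" using real_arch_simple by blast
    then have "- real (Suc n) \<le> ln x" "ln x \<le> real (Suc n)" by auto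
    then have "x \<in> A n" unfolding A_def using x
      by (metis atLeastAtMost_iff exp_le_cancel_iff exp_ln)
    then show "x \<in> (\<Union>n. A n)" by auto
  next
    fix x assume "x \<in> (\<Union>n. A n)"
    then obtain n where "exp (- real (Suc n)) \<le> x" by (auto simp: A_def)
    then show "x \<in> {0<..}" using exp_gt_zero[of "- real (Suc n)"] by (simp del: exp_gt_zero)
  qed
  have B: "(\<Union>n. B n) = UNIV"
  proof -
    have "x \<in> (\<Union>n. B n)" for x
    proof -
      obtain n where "\<bar>x\<bar> \<le> real n" using real_arch_simple by blast
      then have "x \<in> B n" by (auto simp: B_def)
      then show ?thesis by auto
    qed
    then show ?thesis by auto
  qed
  have iA: "incseq A" unfolding A_def incseq_def
    by (intro allI impI iffD2[OF atLeastatMost_subset_iff] disjI2) simp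
  have iB: "incseq B" unfolding B_def incseq_def
    by (intro allI impI iffD2[OF atLeastatMost_subset_iff] disjI2) simp
  have "(\<integral>\<^sup>+t\<in>{0<..}. f t \<partial>lborel) = emeasure (density lborel f) (\<Union>n. A n)"
    unfolding A by (subst emeasure_density) auto
  also have "\<dots> = (SUP n. emeasure (density lborel f) (A n))"
    by (rule SUP_emeasure_incseq[OF _ iA, symmetric]) (auto simp: A_def)
  also have "\<dots> = (SUP n. emeasure (density lborel (\<lambda>u. f (exp u) * ennreal (exp u))) (B n))"
  proof (rule SUP_cong[OF refl])
    fix n
    have "(\<integral>\<^sup>+x. f x * indicator {exp (- real (Suc n))..exp (real (Suc n))} x \<partial>lborel) =
          (\<integral>\<^sup>+x. f (exp x) * ennreal (exp x) * indicator {- real (Suc n)..real (Suc n)} x \<partial>lborel)"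
      by (rule nn_integral_substitution_aux) (auto intro!: continuous_intros DERIV_exp)
    then show "emeasure (density lborel f) (A n) =
        emeasure (density lborel (\<lambda>u. f (exp u) * ennreal (exp u))) (B n)"
      unfolding A_def B_def by (subst (1 2) emeasure_density) auto
  qed
  also have "\<dots> = emeasure (density lborel (\<lambda>u. f (exp u) * ennreal (exp u))) (\<Union>n. B n)"
    by (rule SUP_emeasure_incseq[OF _ iB]) (auto simp: B_def)
  also have "\<dots> = (\<integral>\<^sup>+u. f (exp u) * ennreal (exp u) \<partial>lborel)"
    unfolding B by (subst emeasure_density) auto
  finally show ?thesis .
qed

text \<open>In the logarithmic variable the map x -> c x^p becomes u -> ln c + p u, so an affine
  substitution does the work and covers both signs of the exponent; both occur below.\<close>

lemma nn_integral_powr_substitution: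
  fixes f :: "real \<Rightarrow> ennreal" and c p :: real
  assumes [measurable]: "f \<in> borel_measurable borel" and c: "0 < c" and p: "p \<noteq> 0"
  shows "(\<integral>\<^sup>+t\<in>{0<..}. f t \<partial>lborel) =
    (\<integral>\<^sup>+x\<in>{0<..}. ennreal (c * \<bar>p\<bar> * x powr (p - 1)) * f (c * x powr p) \<partial>lborel)"
proof -
  have "(\<integral>\<^sup>+t\<in>{0<..}. f t \<partial>lborel) = (\<integral>\<^sup>+u. f (exp u) * ennreal (exp u) \<partial>lborel)"
    by (rule nn_integral_exp_substitution) simp
  also have "\<dots> = ennreal \<bar>p\<bar> * (\<integral>\<^sup>+u. f (exp (ln c + p * u)) * ennreal (exp (ln c + p * u)) \<partial>lborel)"
    by (rule nn_integral_real_affine) (use p in auto)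
  also have "\<dots> = (\<integral>\<^sup>+u. ennreal \<bar>p\<bar> * (f (exp (ln c + p * u)) * ennreal (exp (ln c + p * u))) \<partial>lborel)"
    by (rule nn_integral_cmult[symmetric]) auto
  also have "\<dots> = (\<integral>\<^sup>+u. (ennreal (c * \<bar>p\<bar> * exp u powr (p - 1)) * f (c * exp u powr p)) * ennreal (exp u) \<partial>lborel)"
  proof (rule nn_integral_cong)
    fix u :: real
    have 1: "exp (ln c + p * u) = c * exp u powr p"
      using c by (simp add: exp_add powr_def mult.commute)
    have 2: "\<bar>p\<bar> * exp (ln c + p * u) = c * \<bar>p\<bar> * exp u powr (p - 1) * exp u"
      using c by (simp add: exp_add powr_def exp_diff algebra_simps)
    have "ennreal \<bar>p\<bar> * (f (exp (ln c + p * u)) * ennreal (exp (ln c + p * u)))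
       = ennreal (\<bar>p\<bar> * exp (ln c + p * u)) * f (exp (ln c + p * u))"
      by (simp add: ennreal_mult mult_ac)
    also have "\<dots> = ennreal (c * \<bar>p\<bar> * exp u powr (p - 1)) * ennreal (exp u) * f (c * exp u powr p)"
      unfolding 2 unfolding 1 using c by (subst ennreal_mult) auto
    finally show "ennreal \<bar>p\<bar> * (f (exp (ln c + p * u)) * ennreal (exp (ln c + p * u))) =
      (ennreal (c * \<bar>p\<bar> * exp u powr (p - 1)) * f (c * exp u powr p)) * ennreal (exp u)"
      by (simp add: mult_ac)
  qed
  also have "\<dots> = (\<integral>\<^sup>+x\<in>{0<..}. ennreal (c * \<bar>p\<bar> * x powr (p - 1)) * f (c * x powr p) \<partial>lborel)"
    by (rule nn_integral_exp_substitution[symmetric]) measurable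
  finally show ?thesis .
qed

text \<open>Values in \<open>ennreal\<close> let Tonelli's theorem give commutativity and
  associativity with no integrability side conditions; \<open>conv_eq_LINT\<close> leads back to
  real integrals.\<close>

definition conv :: "(real \<Rightarrow> ennreal) \<Rightarrow> (real \<Rightarrow> ennreal) \<Rightarrow> real \<Rightarrow> ennreal" where
  "conv f g t = (\<integral>\<^sup>+y\<in>{0..t}. f (t - y) * g y \<partial>lborel)"

lemma measurable_conv [measurable]:
  assumes [measurable]: "f \<in> borel_measurable borel" "g \<in> borel_measurable borel"
  shows "conv f g \<in> borel_measurable borel"
proof -
  have "conv f g = (\<lambda>t. \<integral>\<^sup>+y. f (t - y) * g y * (if 0 \<le> y \<and> y \<le> t then 1 else 0) \<partial>lborel)"
    unfolding conv_def by (intro ext nn_integral_cong) (auto simp: indicator_def)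
  also have "\<dots> \<in> borel_measurable borel" by measurable
  finally show ?thesis .
qed

lemma conv_cong:
  assumes "\<And>y. 0 \<le> y \<Longrightarrow> y \<le> t \<Longrightarrow> f y = f' y" "\<And>y. 0 \<le> y \<Longrightarrow> y \<le> t \<Longrightarrow> g y = g' y"
  shows "conv f g t = conv f' g' t"
  unfolding conv_def by (intro nn_integral_cong) (auto simp: indicator_def assms)

lemma conv_commute:
  assumes [measurable]: "f \<in> borel_measurable borel" "g \<in> borel_measurable borel"
  shows "conv f g t = conv g f t"
proof -
  have "conv f g t = \<bar>-1 :: real\<bar> * (\<integral>\<^sup>+y. f (t - (t + (-1) * y)) * g (t + (-1) * y) *
      indicator {0..t} (t + (-1) * y) \<partial>lborel)"
    unfolding conv_def by (rule nn_integral_real_affine) auto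
  also have "\<dots> = conv g f t"
    unfolding conv_def by (auto intro!: nn_integral_cong simp: indicator_def mult_ac)
  finally show ?thesis .
qed

text \<open>Both sides integrate over the triangle 0 <= z <= y <= t. Tonelli exchanges the order,
  and the shift y = z + v turns the inner integral into the convolution of \<open>f\<close> and
  \<open>g\<close> at t - z.\<close>

lemma conv_assoc:
  assumes [measurable]: "f \<in> borel_measurable borel" "g \<in> borel_measurable borel"
    "h \<in> borel_measurable borel"
  shows "conv f (conv g h) t = conv (conv f g) h t"
proof -
  let ?i = "\<lambda>P. if P then 1 else 0 :: ennreal"
  have "conv f (conv g h) t =
      (\<integral>\<^sup>+y. \<integral>\<^sup>+z. f (t - y) * g (y - z) * h z * ?i (0 \<le> z \<and> z \<le> y \<and> y \<le> t) \<partial>lborel \<partial>lborel)"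
    unfolding conv_def
  proof (intro nn_integral_cong)
    fix y
    have "f (t - y) * (\<integral>\<^sup>+z. g (y - z) * h z * indicator {0..y} z \<partial>lborel) * indicator {0..t} y
      = (f (t - y) * indicator {0..t} y) * (\<integral>\<^sup>+z. g (y - z) * h z * indicator {0..y} z \<partial>lborel)"
      by (simp add: mult_ac)
    also have "\<dots> = (\<integral>\<^sup>+z. (f (t - y) * indicator {0..t} y) * (g (y - z) * h z * indicator {0..y} z) \<partial>lborel)"
      by (rule nn_integral_cmult[symmetric]) measurable
    also have "\<dots> = (\<integral>\<^sup>+z. f (t - y) * g (y - z) * h z * ?i (0 \<le> z \<and> z \<le> y \<and> y \<le> t) \<partial>lborel)"
      by (intro nn_integral_cong) (auto simp: indicator_def mult_ac)
    finally show "f (t - y) * (\<integral>\<^sup>+z. g (y - z) * h z * indicator {0..y} z \<partial>lborel) * indicator {0..t} y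
      = (\<integral>\<^sup>+z. f (t - y) * g (y - z) * h z * ?i (0 \<le> z \<and> z \<le> y \<and> y \<le> t) \<partial>lborel)" .
  qed
  also have "\<dots> = (\<integral>\<^sup>+z. \<integral>\<^sup>+y. f (t - y) * g (y - z) * h z * ?i (0 \<le> z \<and> z \<le> y \<and> y \<le> t) \<partial>lborel \<partial>lborel)"
    by (rule lborel_pair.Fubini') measurable
  also have "\<dots> = (\<integral>\<^sup>+z. \<integral>\<^sup>+v. f (t - z - v) * g v * h z * ?i (0 \<le> z \<and> 0 \<le> v \<and> v \<le> t - z) \<partial>lborel \<partial>lborel)"
  proof (rule nn_integral_cong)
    fix z :: real
    have "(\<integral>\<^sup>+y. f (t - y) * g (y - z) * h z * ?i (0 \<le> z \<and> z \<le> y \<and> y \<le> t) \<partial>lborel) = \<bar>1::real\<bar> *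
        (\<integral>\<^sup>+v. f (t - (z + 1 * v)) * g ((z + 1 * v) - z) * h z * ?i (0 \<le> z \<and> z \<le> z + 1 * v \<and> z + 1 * v \<le> t) \<partial>lborel)"
      by (rule nn_integral_real_affine) auto
    also have "\<dots> = (\<integral>\<^sup>+v. f (t - z - v) * g v * h z * ?i (0 \<le> z \<and> 0 \<le> v \<and> v \<le> t - z) \<partial>lborel)"
      by (auto intro!: nn_integral_cong simp: diff_diff_eq)
    finally show "(\<integral>\<^sup>+y. f (t - y) * g (y - z) * h z * ?i (0 \<le> z \<and> z \<le> y \<and> y \<le> t) \<partial>lborel) =
      (\<integral>\<^sup>+v. f (t - z - v) * g v * h z * ?i (0 \<le> z \<and> 0 \<le> v \<and> v \<le> t - z) \<partial>lborel)" .
  qed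
  also have "\<dots> = conv (conv f g) h t"
    unfolding conv_def
  proof (intro nn_integral_cong)
    fix z
    have "(\<integral>\<^sup>+v. f (t - z - v) * g v * indicator {0..t - z} v \<partial>lborel) * h z * indicator {0..t} z
      = (h z * indicator {0..t} z) * (\<integral>\<^sup>+v. f (t - z - v) * g v * indicator {0..t - z} v \<partial>lborel)"
      by (simp add: mult_ac)
    also have "\<dots> = (\<integral>\<^sup>+v. (h z * indicator {0..t} z) * (f (t - z - v) * g v * indicator {0..t - z} v) \<partial>lborel)"
      by (rule nn_integral_cmult[symmetric]) measurable
    also have "\<dots> = (\<integral>\<^sup>+v. f (t - z - v) * g v * h z * ?i (0 \<le> z \<and> 0 \<le> v \<and> v \<le> t - z) \<partial>lborel)"
      by (intro nn_integral_cong) (auto simp: indicator_def mult_ac)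
    finally show "(\<integral>\<^sup>+v. f (t - z - v) * g v * h z * ?i (0 \<le> z \<and> 0 \<le> v \<and> v \<le> t - z) \<partial>lborel) =
      (\<integral>\<^sup>+v. f (t - z - v) * g v * indicator {0..t - z} v \<partial>lborel) * h z * indicator {0..t} z" by simp
  qed
  finally show ?thesis .
qed

text \<open>The Riemann-Liouville kernel of order \<open>a\<close>. The convention
  \<open>0 powr x = 0\<close> makes it vanish at t = 0 also for a <= 1, where the limit is 1 or
  infinite.\<close>

definition pow_kernel :: "real \<Rightarrow> real \<Rightarrow> real" where
  "pow_kernel a t = t powr (a - 1) / Gamma a"

lemma measurable_pow_kernel [measurable]: "pow_kernel a \<in> borel_measurable borel"
  unfolding pow_kernel_def by measurable

lemma pow_kernel_nonneg: "0 < a \<Longrightarrow> 0 \<le> pow_kernel a t"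
  unfolding pow_kernel_def by (simp add: Gamma_real_nonneg)

text \<open>Scaling the interval to [0, 1] leaves the Beta integral, and Beta(c, a) = Gamma(a)
  Gamma(c) / Gamma(a + c) restores the normalization.\<close>

lemma conv_pow_kernel:
  fixes a c t :: real
  assumes a: "0 < a" and c: "0 < c"
  shows "conv (\<lambda>x. ennreal (pow_kernel a x)) (\<lambda>x. ennreal (pow_kernel c x)) t =
    (if 0 \<le> t then ennreal (pow_kernel (a + c) t) else 0)"
proof (cases "0 < t")
  case t: True
  have pos: "Gamma a > 0" "Gamma c > 0" "Gamma (a + c) > 0" using a c by (auto intro: Gamma_real_pos)
  define k where "k = t powr (a + c - 2) / (Gamma a * Gamma c)"
  have k: "k \<ge> 0" unfolding k_def using pos by simp
  have "conv (\<lambda>x. ennreal (pow_kernel a x)) (\<lambda>x. ennreal (pow_kernel c x)) t =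
    (\<integral>\<^sup>+y. ennreal (pow_kernel a (t - y)) * ennreal (pow_kernel c y) * indicator {0..t} y \<partial>lborel)"
    by (simp add: conv_def)
  also have "\<dots> = \<bar>t\<bar> * (\<integral>\<^sup>+y. ennreal (pow_kernel a (t - (0 + t * y))) * ennreal (pow_kernel c (0 + t * y)) * indicator {0..t} (0 + t * y) \<partial>lborel)"
    by (rule nn_integral_real_affine) (use t in auto)
  also have "(\<integral>\<^sup>+y. ennreal (pow_kernel a (t - (0 + t * y))) * ennreal (pow_kernel c (0 + t * y)) * indicator {0..t} (0 + t * y) \<partial>lborel)
    = (\<integral>\<^sup>+y. ennreal k * ennreal (y powr (c - 1) * (1 - y) powr (a - 1) * indicator {0..1} y) \<partial>lborel)"
  proof (rule nn_integral_cong)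
    fix y :: real
    have ind: "indicator {0..t} (0 + t * y) = (indicator {0..1} y :: ennreal)"
      using t by (auto simp: indicator_def zero_le_mult_iff mult_le_cancel_left1)
    show "ennreal (pow_kernel a (t - (0 + t * y))) * ennreal (pow_kernel c (0 + t * y)) * indicator {0..t} (0 + t * y)
      = ennreal k * ennreal (y powr (c - 1) * (1 - y) powr (a - 1) * indicator {0..1} y)"
    proof (cases "y \<in> {0..1}")
      case True
      have "t - (0 + t * y) = t * (1 - y)" by (simp add: algebra_simps)
      moreover have "(t * (1 - y)) powr (a - 1) = t powr (a - 1) * (1 - y) powr (a - 1)"
        "(t * y) powr (c - 1) = t powr (c - 1) * y powr (c - 1)"
        using t True by (auto intro!: powr_mult)
      moreover have "t powr (a + c - 2) = t powr (a - 1) * t powr (c - 1)"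
        using t by (simp flip: powr_add)
      ultimately have "pow_kernel a (t - (0 + t * y)) * pow_kernel c (0 + t * y) =
        k * (y powr (c - 1) * (1 - y) powr (a - 1))"
        unfolding pow_kernel_def k_def by simp
      then show ?thesis unfolding ind using True k a c
        by (simp flip: ennreal_mult add: pow_kernel_nonneg)
    qed (unfold ind, simp)
  qed
  also have "\<dots> = ennreal k * (\<integral>\<^sup>+y. ennreal (y powr (c - 1) * (1 - y) powr (a - 1) * indicator {0..1} y) \<partial>lborel)"
    by (rule nn_integral_cmult) measurable
  also have "(\<integral>\<^sup>+y. ennreal (y powr (c - 1) * (1 - y) powr (a - 1) * indicator {0..1} y) \<partial>lborel) = ennreal (Beta c a)"
    using nn_integral_has_integral_lebesgue[OF _ has_integral_Beta_real[OF c a]]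
    by (simp add: mult.commute nn_integral_completion)
  also have "ennreal \<bar>t\<bar> * (ennreal k * ennreal (Beta c a)) = ennreal (pow_kernel (a + c) t)"
  proof -
    have "t * (k * Beta c a) = pow_kernel (a + c) t"
      unfolding k_def pow_kernel_def Beta_def using t pos
      by (simp add: powr_diff field_simps add.commute power2_eq_square)
    moreover have "Beta c a \<ge> 0" unfolding Beta_def using pos by (simp add: add.commute)
    ultimately show ?thesis using t k by (simp flip: ennreal_mult)
  qed
  finally show ?thesis using t by simp
next
  case False
  \<comment> \<open>For t <= 0 the interval of integration is empty or the single point 0. At t = 0
    the right side vanishes by the convention for \<open>powr\<close>.\<close>
  have *: "AE y in lborel. (y::real) \<noteq> 0" by (rule AE_lborel_singleton)
  have "AE y in lborel. ennreal (pow_kernel a (t - y)) * ennreal (pow_kernel c y) * indicator {0..t} y = 0"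
    using * by eventually_elim (use False in \<open>auto simp: indicator_def\<close>)
  then have "conv (\<lambda>x. ennreal (pow_kernel a x)) (\<lambda>x. ennreal (pow_kernel c x)) t = 0"
    unfolding conv_def by (subst nn_integral_0_iff_AE) auto
  then show ?thesis using False by (auto simp: pow_kernel_def)
qed

section \<open>Functionals determined by exponentials\<close>

text \<open>In the variable u = e^(-x) these functions become continuous on [0, 1], the limit at
  infinity being the value at u = 0. Continuity on the whole line keeps compositions measurable with
  random variables that are nonnegative only almost surely.\<close>

definition cont_lim :: "(real \<Rightarrow> real) set" where
  "cont_lim = {f. continuous_on UNIV f \<and> (\<exists>l. (f \<longlongrightarrow> l) at_top)}"

definition expo :: "nat \<Rightarrow> real \<Rightarrow> real" where
  "expo i x = exp (- real i * x)"

lemma expo_cont_lim: "expo i \<in> cont_lim"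
proof -
  have "continuous_on UNIV (expo i)" unfolding expo_def by (intro continuous_intros)
  moreover have "\<exists>l. (expo i \<longlongrightarrow> l) at_top"
  proof (cases "i = 0")
    case True
    then have "expo i = (\<lambda>_. 1)" by (simp add: expo_def fun_eq_iff)
    then show ?thesis by (auto intro!: exI[of _ 1])
  next
    case False
    then have "filterlim (\<lambda>x. - real i * x) at_bot at_top"
      by (intro filterlim_tendsto_neg_mult_at_bot[OF tendsto_const _ filterlim_ident]) auto
    then show ?thesis unfolding expo_def
      by (intro exI[of _ 0] filterlim_compose[OF exp_at_bot])
  qed
  ultimately show ?thesis by (simp add: cont_lim_def)
qed

lemma cont_lim_const: "(\<lambda>_. c) \<in> cont_lim"
  unfolding cont_lim_def by (auto intro!: exI[of _ c])

lemma cont_lim_add_scaled: "f \<in> cont_lim \<Longrightarrow> g \<in> cont_lim \<Longrightarrow> (\<lambda>x. f x + c * g x) \<in> cont_lim"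
  unfolding cont_lim_def by (auto intro!: continuous_intros) (metis tendsto_add tendsto_mult_left)

lemma cont_lim_expo_sum: "(\<lambda>x. \<Sum>i<n. c i * expo i x) \<in> cont_lim"
  by (induction n) (auto simp: cont_lim_const intro!: cont_lim_add_scaled expo_cont_lim)

text \<open>In the variable u = e^(-x) exponential sums are polynomials, and the claim is the
  Weierstrass theorem on [0, 1].\<close>

lemma cont_lim_approx:
  assumes f: "f \<in> cont_lim" and e: "0 < e"
  shows "\<exists>n c. \<forall>x\<ge>0. \<bar>f x - (\<Sum>i<n. c i * expo i x)\<bar> \<le> e"
proof -
  obtain l where l: "(f \<longlongrightarrow> l) at_top" and cf: "continuous_on UNIV f" using f by (auto simp: cont_lim_def)
  define F where "F u = (if u \<le> 0 then l else f (- ln u))" for u :: real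
  have "continuous_on {0..1} F"
    unfolding continuous_on_eq_continuous_within
  proof
    fix u :: real assume u: "u \<in> {0..1}"
    show "continuous (at u within {0..1}) F"
    proof (cases "u = 0")
      case True
      have "filterlim (\<lambda>u::real. - ln u) at_top (at_right 0)"
        using ln_at_0 by (simp add: filterlim_uminus_at_bot)
      then have "((\<lambda>u. f (- ln u)) \<longlongrightarrow> l) (at_right 0)" by (rule filterlim_compose[OF l])
      then have "(F \<longlongrightarrow> l) (at_right 0)"
        by (rule Lim_transform_eventually)
          (auto simp: F_def eventually_at_right_less intro: eventually_mono[OF eventually_at_right_less])
      then show ?thesis using True by (simp add: continuous_within F_def at_within_Icc_at_right)
    next
      case False
      then have u0: "u > 0" using u by simp
      have "isCont f (- ln u)" using cf by (simp add: continuous_on_eq_continuous_at)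
      then have c1: "isCont (\<lambda>u. f (- ln u)) u"
        using u0 by (intro isCont_o2[of u "\<lambda>u. - ln u" f]) (auto intro!: continuous_intros)
      have ev: "\<forall>\<^sub>F x in nhds u. f (- ln x) = F x"
        using eventually_nhds_in_open[of "{0<..}" u] u0
        by (auto simp: F_def elim!: eventually_mono)
      have "isCont F u" using c1 isCont_cong[OF ev] by simp
      then show ?thesis by (rule continuous_at_imp_continuous_at_within)
    qed
  qed
  then obtain g where g: "real_polynomial_function g" "\<And>u. u \<in> {0..1} \<Longrightarrow> \<bar>F u - g u\<bar> < e"
    using Stone_Weierstrass_real_polynomial_function[of "{0..1}" F e] e by auto
  then obtain a n where a: "g = (\<lambda>x. \<Sum>i\<le>n. a i * x ^ i)"
    by (auto simp: real_polynomial_function_iff_sum)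
  have "\<bar>f x - (\<Sum>i<Suc n. a i * expo i x)\<bar> \<le> e" if "x \<ge> 0" for x
  proof -
    have "\<bar>F (exp (- x)) - g (exp (- x))\<bar> < e" using that by (intro g) auto
    moreover have "F (exp (- x)) = f x" by (simp add: F_def)
    moreover have "g (exp (- x)) = (\<Sum>i<Suc n. a i * expo i x)"
      unfolding a lessThan_Suc_atMost by (simp add: expo_def flip: exp_of_nat_mult)
    ultimately show ?thesis by simp
  qed
  then show ?thesis by blast
qed

section \<open>Test functions and their approximation together with the first derivative\<close>

lemma test_fun_deriv: "test_fun \<phi> \<Longrightarrow> test_fun (deriv \<phi>)"
  unfolding test_fun_def
proof (intro conjI allI)
  assume *: "(\<forall>n x. (deriv ^^ n) \<phi> differentiable at x) \<and> (\<exists>R. \<forall>x. R < \<bar>x\<bar> \<longrightarrow> \<phi> x = 0)"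
  show "(deriv ^^ n) (deriv \<phi>) differentiable at x" for n x
    using * by (metis funpow_Suc_right comp_apply)
  from * obtain R where R: "\<And>x. R < \<bar>x\<bar> \<Longrightarrow> \<phi> x = 0" by auto
  have "deriv \<phi> x = 0" if "R < \<bar>x\<bar>" for x
  proof -
    have "open {y. R < \<bar>y\<bar>}" by (intro open_Collect_less continuous_intros)
    then have "\<forall>\<^sub>F y in nhds x. \<phi> y = 0"
      using eventually_nhds_in_open[of "{y. R < \<bar>y\<bar>}" x] that
      by (auto intro: R elim!: eventually_mono)
    then have "deriv \<phi> x = deriv (\<lambda>_. 0) x" by (intro deriv_cong_ev) auto
    then show ?thesis by simp
  qed
  then show "\<exists>R. \<forall>x. R < \<bar>x\<bar> \<longrightarrow> deriv \<phi> x = 0" by blast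
qed

lemma test_fun_has_deriv:
  assumes "test_fun \<phi>" shows "(\<phi> has_real_derivative deriv \<phi> x) (at x)"
proof -
  have "(deriv ^^ 0) \<phi> differentiable at x" using assms unfolding test_fun_def by blast
  then show ?thesis
    by (simp add: DERIV_deriv_iff_real_differentiable)
qed

lemma test_fun_continuous: "test_fun \<phi> \<Longrightarrow> continuous_on UNIV \<phi>"
  using test_fun_has_deriv DERIV_isCont by (metis continuous_at_imp_continuous_on)

lemma test_fun_eventually_0: "test_fun \<phi> \<Longrightarrow> \<forall>\<^sub>F x in at_top. \<phi> x = 0"
proof -
  assume "test_fun \<phi>"
  then obtain R where R: "\<And>x. R < \<bar>x\<bar> \<Longrightarrow> \<phi> x = 0" by (auto simp: test_fun_def)
  show ?thesis
    using eventually_gt_at_top[of R] by eventually_elim (rule R, auto)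
qed

lemma test_fun_mult_cont_lim:
  assumes "test_fun \<phi>" "continuous_on UNIV g"
  shows "(\<lambda>x. g x * \<phi> x) \<in> cont_lim"
proof -
  have "((\<lambda>x. g x * \<phi> x) \<longlongrightarrow> 0) at_top"
    by (rule tendsto_eventually, use test_fun_eventually_0[OF assms(1)] in eventually_elim) simp
  then show ?thesis unfolding cont_lim_def
    using assms test_fun_continuous by (auto intro!: continuous_intros)
qed

lemma test_fun_cont_lim: "test_fun \<phi> \<Longrightarrow> \<phi> \<in> cont_lim"
  using test_fun_mult_cont_lim[of \<phi> "\<lambda>_. 1"] by simp

text \<open>Monotone decrease keeps every value above the limit. This serves to integrate a
  one-sided derivative bound back from infinity.\<close>

lemma le_of_deriv_le:
  fixes f g f' g' :: "real \<Rightarrow> real"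
  assumes f: "\<And>x. (f has_real_derivative f' x) (at x)" and le: "\<And>x. x \<ge> 0 \<Longrightarrow> 0 \<ge> f' x"
    and lim: "(f \<longlongrightarrow> 0) at_top" and x: "x \<ge> 0"
  shows "0 \<le> f x"
proof -
  have "f y \<le> f x" if "x \<le> y" for y
    by (rule DERIV_nonpos_imp_nonincreasing[OF that]) (use f le x in \<open>meson order_trans\<close>)
  then have "\<forall>\<^sub>F y in at_top. f y \<le> f x" by (auto simp: eventually_at_top_linorder)
  then show ?thesis by (intro tendsto_upperbound[OF lim]) auto
qed

text \<open>
  The exponential sum approximates \<open>e\<^sup>x \<phi>'(x)\<close> uniformly; after division by \<open>e\<^sup>x\<close> the error is
  integrable, so the antiderivative approximates \<open>\<phi>\<close>.
\<close>

lemma test_fun_approx: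
  assumes t: "test_fun \<phi>" and e: "0 < e"
  shows "\<exists>n c. \<forall>x\<ge>0. \<bar>\<phi> x - (\<Sum>i<n. c i * expo i x)\<bar> \<le> e \<and>
    \<bar>deriv \<phi> x - (\<Sum>i<n. - real i * c i * expo i x)\<bar> \<le> e"
proof -
  have "(\<lambda>x. exp x * deriv \<phi> x) \<in> cont_lim"
    by (intro test_fun_mult_cont_lim test_fun_deriv t continuous_intros)
  from cont_lim_approx[OF this e] obtain n a where
    a: "\<And>x. x \<ge> 0 \<Longrightarrow> \<bar>exp x * deriv \<phi> x - (\<Sum>i<n. a i * expo i x)\<bar> \<le> e" by auto
  \<comment> \<open>Coefficients of the antiderivative of e^(-x) times the exponential sum: the
    factor e^(-x) raises the index by one, and integration divides by minus the new index. The
    constant term is 0 because \<psi>, like \<phi>, must vanish at infinity.\<close>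
  define c where "c i = (if i = 0 then 0 else - a (i - 1) / real i)" for i
  define \<psi> where "\<psi> x = (\<Sum>i<Suc n. c i * expo i x)" for x
  define \<psi>' where "\<psi>' x = (\<Sum>i<Suc n. - real i * c i * expo i x)" for x
  have d: "(\<psi> has_real_derivative \<psi>' x) (at x)" for x
    unfolding \<psi>_def \<psi>'_def expo_def by (auto intro!: derivative_eq_intros sum.cong)
  have \<psi>': "\<psi>' x = exp (- x) * (\<Sum>i<n. a i * expo i x)" for x
  proof -
    have "expo (Suc i) x = exp (- x) * expo i x" for i
      by (simp add: expo_def algebra_simps flip: exp_add)
    moreover have "- real (Suc i) * c (Suc i) = a i" for i by (simp add: c_def del: of_nat_Suc)
    ultimately have "- real (Suc i) * c (Suc i) * expo (Suc i) x = exp (- x) * (a i * expo i x)" for i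
      by simp
    then show ?thesis unfolding \<psi>'_def sum.lessThan_Suc_shift sum_distrib_left by (simp add: c_def)
  qed
  have b: "\<bar>deriv \<phi> x - \<psi>' x\<bar> \<le> e * exp (- x)" if "x \<ge> 0" for x
  proof -
    have "deriv \<phi> x - \<psi>' x = exp (- x) * (exp x * deriv \<phi> x - (\<Sum>i<n. a i * expo i x))"
      unfolding \<psi>' by (simp add: right_diff_distrib exp_minus)
    then have "\<bar>deriv \<phi> x - \<psi>' x\<bar> = exp (- x) * \<bar>exp x * deriv \<phi> x - (\<Sum>i<n. a i * expo i x)\<bar>"
      by (simp add: abs_mult)
    also have "\<dots> \<le> exp (- x) * e" using a[OF that] by (intro mult_left_mono) auto
    finally show ?thesis by (simp add: mult.commute)
  qed
  have lim1: "(\<phi> \<longlongrightarrow> 0) at_top" by (rule tendsto_eventually[OF test_fun_eventually_0[OF t]])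
  have lim2: "((\<lambda>x::real. exp (- x)) \<longlongrightarrow> 0) at_top"
    using filterlim_compose[OF exp_at_bot filterlim_uminus_at_bot_at_top] .
  have limp: "((\<lambda>x. expo i x) \<longlongrightarrow> 0) at_top" if "i > 0" for i
  proof -
    have "filterlim (\<lambda>x. - real i * x) at_bot at_top"
      using that by (intro filterlim_tendsto_neg_mult_at_bot[OF tendsto_const _ filterlim_ident]) auto
    then show ?thesis unfolding expo_def by (intro filterlim_compose[OF exp_at_bot])
  qed
  have lim3: "(\<psi> \<longlongrightarrow> 0) at_top"
  proof -
    have "((\<lambda>x. c i * expo i x) \<longlongrightarrow> 0) at_top" for i
      using tendsto_mult_right_zero[OF limp[of i], of "c i"] by (cases "i = 0") (auto simp: c_def[of 0])
    then show ?thesis unfolding \<psi>_def by (intro tendsto_null_sum) auto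
  qed
  \<comment> \<open>The bound e^(-x) times e is minus its own derivative, so the error of the
    derivative carries over to the function with the same constant.\<close>
  have B: "\<bar>\<phi> x - \<psi> x\<bar> \<le> e * exp (- x)" if x: "x \<ge> 0" for x
  proof -
    have "0 \<le> e * exp (- x) + (\<phi> x - \<psi> x)"
    proof (rule le_of_deriv_le[where f = "\<lambda>x. e * exp (- x) + (\<phi> x - \<psi> x)" and f' = "\<lambda>x. - e * exp (- x) + (deriv \<phi> x - \<psi>' x)"])
      show "((\<lambda>x. e * exp (- x) + (\<phi> x - \<psi> x)) has_real_derivative - e * exp (- x) + (deriv \<phi> x - \<psi>' x)) (at x)" for x
        by (auto intro!: derivative_eq_intros d test_fun_has_deriv[OF t])
      show "((\<lambda>x. e * exp (- x) + (\<phi> x - \<psi> x)) \<longlongrightarrow> 0) at_top"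
        using tendsto_add[OF tendsto_mult_right_zero[OF lim2, of e] tendsto_diff[OF lim1 lim3]] by simp
      show "0 \<ge> - e * exp (- x) + (deriv \<phi> x - \<psi>' x)" if "x \<ge> 0" for x
        using b[OF that] by (auto simp: abs_le_iff)
    qed (use x in auto)
    moreover have "0 \<le> e * exp (- x) - (\<phi> x - \<psi> x)"
    proof (rule le_of_deriv_le[where f = "\<lambda>x. e * exp (- x) - (\<phi> x - \<psi> x)" and f' = "\<lambda>x. - e * exp (- x) - (deriv \<phi> x - \<psi>' x)"])
      show "((\<lambda>x. e * exp (- x) - (\<phi> x - \<psi> x)) has_real_derivative - e * exp (- x) - (deriv \<phi> x - \<psi>' x)) (at x)" for x
        by (auto intro!: derivative_eq_intros d test_fun_has_deriv[OF t])
      show "((\<lambda>x. e * exp (- x) - (\<phi> x - \<psi> x)) \<longlongrightarrow> 0) at_top"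
        using tendsto_diff[OF tendsto_mult_right_zero[OF lim2, of e] tendsto_diff[OF lim1 lim3]] by simp
      show "0 \<ge> - e * exp (- x) - (deriv \<phi> x - \<psi>' x)" if "x \<ge> 0" for x
        using b[OF that] by (auto simp: abs_le_iff)
    qed (use x in auto)
    ultimately show ?thesis by (auto simp: abs_le_iff)
  qed
  have "e * exp (- x) \<le> e" if "x \<ge> 0" for x using that e by simp
  then have "\<forall>x\<ge>0. \<bar>\<phi> x - \<psi> x\<bar> \<le> e \<and> \<bar>deriv \<phi> x - \<psi>' x\<bar> \<le> e"
    using b B by (meson order_trans)
  then show ?thesis unfolding \<psi>_def \<psi>'_def by blast
qed

text \<open>A bounded linear functional on \<open>cont_lim\<close>, with the supremum taken over [0,
  oo), where the laws live. Linearity is demanded inside \<open>cont_lim\<close> only, since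
  integrals are linear only on integrable functions; one clause joins additivity and
  homogeneity.\<close>

definition bdd_functional :: "real \<Rightarrow> ((real \<Rightarrow> real) \<Rightarrow> real) \<Rightarrow> bool" where
  "bdd_functional C L \<longleftrightarrow> 0 \<le> C \<and>
     (\<forall>f\<in>cont_lim. \<forall>g\<in>cont_lim. \<forall>c. L (\<lambda>x. f x + c * g x) = L f + c * L g) \<and>
     (\<forall>f\<in>cont_lim. \<forall>B. (\<forall>x\<ge>0. \<bar>f x\<bar> \<le> B) \<longrightarrow> \<bar>L f\<bar> \<le> C * B)"

lemma bdd_functionalD:
  assumes "bdd_functional C L" "f \<in> cont_lim"
  shows "g \<in> cont_lim \<Longrightarrow> L (\<lambda>x. f x + c * g x) = L f + c * L g"
    "(\<And>x. x \<ge> 0 \<Longrightarrow> \<bar>f x\<bar> \<le> B) \<Longrightarrow> \<bar>L f\<bar> \<le> C * B"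
  using assms unfolding bdd_functional_def by auto

lemma bdd_functional_expo_sum:
  assumes L: "bdd_functional C L"
  shows "L (\<lambda>x. \<Sum>i<n. c i * expo i x) = (\<Sum>i<n. c i * L (expo i))"
proof (induction n)
  case 0
  \<comment> \<open>The bound with B = 0 forces the value 0 on the zero function.\<close>
  show ?case using bdd_functionalD(2)[OF L cont_lim_const, of 0 0] by simp
next
  case (Suc n)
  then show ?case using bdd_functionalD(1)[OF L cont_lim_expo_sum[of c n] expo_cont_lim[of n], of "c n"] by simp
qed

lemma bdd_functional_diff_le:
  assumes L: "bdd_functional C L" and f: "f \<in> cont_lim" "g \<in> cont_lim" and le: "\<And>x. x \<ge> 0 \<Longrightarrow> \<bar>f x - g x\<bar> \<le> B"
  shows "\<bar>L f - L g\<bar> \<le> C * B"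
proof -
  have "L (\<lambda>x. f x + (-1) * g x) = L f + (-1) * L g" by (rule bdd_functionalD(1)[OF L f])
  moreover have "\<bar>L (\<lambda>x. f x + (-1) * g x)\<bar> \<le> C * B"
    by (rule bdd_functionalD(2)[OF L cont_lim_add_scaled[OF f]]) (use le in auto)
  ultimately show ?thesis by simp
qed

text \<open>The derivative of \<open>expo i\<close> is -i times \<open>expo i\<close>, so the
  hypothesis is the claim on exponentials. It extends because \<open>test_fun_approx\<close>
  approximates \<phi> and its derivative by one exponential sum and the derivative of that same
  sum.\<close>

lemma bdd_functional_test_zero:
  assumes L: "bdd_functional C L" and L': "bdd_functional C' L'"
    and z: "\<And>i. L (expo i) - real i * L' (expo i) = 0" and t: "test_fun \<phi>"
  shows "L \<phi> + L' (deriv \<phi>) = 0"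
proof -
  have C: "C \<ge> 0" "C' \<ge> 0" using L L' by (auto simp: bdd_functional_def)
  have "\<bar>L \<phi> + L' (deriv \<phi>)\<bar> \<le> 0 + e" if e: "e > 0" for e
  proof -
    \<comment> \<open>The added 1 keeps the denominator positive when both constants are 0.\<close>
    define d where "d = e / (C + C' + 1)"
    have d: "d > 0" "(C + C') * d \<le> e" using e C unfolding d_def by (auto simp: field_simps)
    from test_fun_approx[OF t d(1)] obtain n c where
      *: "\<And>x. x \<ge> 0 \<Longrightarrow> \<bar>\<phi> x - (\<Sum>i<n. c i * expo i x)\<bar> \<le> d"
      "\<And>x. x \<ge> 0 \<Longrightarrow> \<bar>deriv \<phi> x - (\<Sum>i<n. - real i * c i * expo i x)\<bar> \<le> d" by auto
    have 1: "\<bar>L \<phi> - (\<Sum>i<n. c i * L (expo i))\<bar> \<le> C * d"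
      using bdd_functional_diff_le[OF L test_fun_cont_lim[OF t] cont_lim_expo_sum *(1)] bdd_functional_expo_sum[OF L] by metis
    have 2: "\<bar>L' (deriv \<phi>) - (\<Sum>i<n. - real i * c i * L' (expo i))\<bar> \<le> C' * d"
      using bdd_functional_diff_le[OF L' test_fun_cont_lim[OF test_fun_deriv[OF t]] cont_lim_expo_sum *(2)]
      unfolding bdd_functional_expo_sum[OF L', of "\<lambda>i. - real i * c i" n] .
    have "(\<Sum>i<n. c i * L (expo i)) + (\<Sum>i<n. - real i * c i * L' (expo i)) =
        (\<Sum>i<n. c i * (L (expo i) - real i * L' (expo i)))"
      by (simp add: algebra_simps flip: sum.distrib)
    then have "(\<Sum>i<n. c i * L (expo i)) + (\<Sum>i<n. - real i * c i * L' (expo i)) = 0"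
      using z by simp
    then have "\<bar>L \<phi> + L' (deriv \<phi>)\<bar> \<le> C * d + C' * d" using 1 2 by linarith
    then show ?thesis using d by (simp add: algebra_simps)
  qed
  then have "\<bar>L \<phi> + L' (deriv \<phi>)\<bar> \<le> 0" by (rule field_le_epsilon)
  then show ?thesis by simp
qed

text \<open>With no derivative involved, uniform approximation suffices. The equality then reaches
  functions such as cos (t e^(-x)), which are not test functions.\<close>

lemma bdd_functional_cont_lim_eq:
  assumes L: "bdd_functional C L" and L': "bdd_functional C' L'"
    and z: "\<And>i. L (expo i) = L' (expo i)" and f: "f \<in> cont_lim"
  shows "L f = L' f"
proof -
  have C: "C \<ge> 0" "C' \<ge> 0" using L L' by (auto simp: bdd_functional_def)
  have "\<bar>L f - L' f\<bar> \<le> 0 + e" if e: "e > 0" for e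
  proof -
    define d where "d = e / (C + C' + 1)"
    have d: "d > 0" "(C + C') * d \<le> e" using e C unfolding d_def by (auto simp: field_simps)
    from cont_lim_approx[OF f d(1)] obtain n c where
      *: "\<And>x. x \<ge> 0 \<Longrightarrow> \<bar>f x - (\<Sum>i<n. c i * expo i x)\<bar> \<le> d" by auto
    have 1: "\<bar>L f - (\<Sum>i<n. c i * L (expo i))\<bar> \<le> C * d"
      using bdd_functional_diff_le[OF L f cont_lim_expo_sum *] bdd_functional_expo_sum[OF L] by metis
    have 2: "\<bar>L' f - (\<Sum>i<n. c i * L (expo i))\<bar> \<le> C' * d"
      using bdd_functional_diff_le[OF L' f cont_lim_expo_sum *] bdd_functional_expo_sum[OF L'] z by simp
    have "\<bar>L f - L' f\<bar> \<le> C * d + C' * d" using 1 2 by linarith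
    then show ?thesis using d by (simp add: algebra_simps)
  qed
  then have "\<bar>L f - L' f\<bar> \<le> 0" by (rule field_le_epsilon)
  then show ?thesis by simp
qed

text \<open>The common bound \<open>C\<close> turns uniform approximation of \<open>f\<close> into
  uniform convergence in y. The result makes time integrals of pairings meaningful.\<close>

lemma bdd_functional_continuous_on:
  assumes L: "\<And>y. y \<in> A \<Longrightarrow> bdd_functional C (L y)" and c: "\<And>i. continuous_on A (\<lambda>y. L y (expo i))"
    and f: "f \<in> cont_lim"
  shows "continuous_on A (\<lambda>y. L y f)"
proof (cases "A = {}")
  case False
  then have C: "C \<ge> 0" using L by (auto simp: bdd_functional_def)
  have "\<exists>n c. \<forall>x\<ge>0. \<bar>f x - (\<Sum>i<n. c i * expo i x)\<bar> \<le> inverse (real (Suc m))" for m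
    by (rule cont_lim_approx[OF f]) simp
  then obtain N a where
    Na: "\<And>m x. x \<ge> 0 \<Longrightarrow> \<bar>f x - (\<Sum>i<N m. a m i * expo i x)\<bar> \<le> inverse (real (Suc m))"
    by metis
  have "uniform_limit A (\<lambda>m y. \<Sum>i<N m. a m i * L y (expo i)) (\<lambda>y. L y f) sequentially"
  proof (rule uniform_limitI)
    fix e :: real assume e: "e > 0"
    have "(\<lambda>m. C * inverse (real (Suc m))) \<longlonglongrightarrow> C * 0"
      by (intro tendsto_intros LIMSEQ_inverse_real_of_nat)
    then have "\<forall>\<^sub>F m in sequentially. C * inverse (real (Suc m)) < e"
      using e order_tendstoD(2)[of _ "C * 0" _ e] by simp
    then show "\<forall>\<^sub>F m in sequentially. \<forall>y\<in>A. dist (\<Sum>i<N m. a m i * L y (expo i)) (L y f) < e"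
    proof eventually_elim
      case (elim m)
      show ?case
      proof
        fix y assume y: "y \<in> A"
        have "\<bar>L y f - (\<Sum>i<N m. a m i * L y (expo i))\<bar> \<le> C * inverse (real (Suc m))"
          using bdd_functional_diff_le[OF L[OF y] f cont_lim_expo_sum Na] bdd_functional_expo_sum[OF L[OF y]] by metis
        then show "dist (\<Sum>i<N m. a m i * L y (expo i)) (L y f) < e"
          using elim by (simp add: dist_real_def)
      qed
    qed
  qed
  then show ?thesis
    by (rule uniform_limit_theorem[rotated]) (auto intro!: always_eventually continuous_intros c)
qed simp

lemma bdd_functional_eval0: "bdd_functional 1 (\<lambda>f. f 0)"
  unfolding bdd_functional_def by auto

text \<open>An approximating exponential sum is bounded on [0, oo), hence so is \<open>f\<close>
  there, and \<open>X\<close> takes its values there almost surely.\<close>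

lemma (in prob_space) integrable_cont_lim:
  assumes [measurable]: "X \<in> borel_measurable M" and X: "AE \<omega> in M. 0 \<le> X \<omega>" and f: "f \<in> cont_lim"
  shows "integrable M (\<lambda>\<omega>. f (X \<omega>))"
proof -
  have [measurable]: "f \<in> borel_measurable borel"
    using f by (auto simp: cont_lim_def intro: borel_measurable_continuous_onI)
  obtain n c where "\<forall>x\<ge>0. \<bar>f x - (\<Sum>i<n. c i * expo i x)\<bar> \<le> 1" using cont_lim_approx[OF f, of 1] by auto
  then have bd: "\<bar>f x\<bar> \<le> (\<Sum>i<n. \<bar>c i\<bar>) + 1" if "x \<ge> 0" for x
  proof -
    have "\<bar>\<Sum>i<n. c i * expo i x\<bar> \<le> (\<Sum>i<n. \<bar>c i * expo i x\<bar>)" by (rule sum_abs)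
    also have "\<dots> \<le> (\<Sum>i<n. \<bar>c i\<bar>)"
      using that by (intro sum_mono) (auto simp: abs_mult expo_def mult_left_le)
    finally have "\<bar>\<Sum>i<n. c i * expo i x\<bar> \<le> (\<Sum>i<n. \<bar>c i\<bar>)" .
    moreover have "\<bar>f x - (\<Sum>i<n. c i * expo i x)\<bar> \<le> 1" using \<open>\<forall>x\<ge>0. _\<close> that by blast
    ultimately show ?thesis by linarith
  qed
  have "AE \<omega> in M. norm (f (X \<omega>)) \<le> (\<Sum>i<n. \<bar>c i\<bar>) + 1"
    using X by eventually_elim (simp add: bd)
  then show ?thesis by (rule integrable_const_bound) measurable
qed

lemma (in prob_space) bdd_functional_expectation:
  assumes [measurable]: "X \<in> borel_measurable M" and X: "AE \<omega> in M. 0 \<le> X \<omega>"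
  shows "bdd_functional 1 (\<lambda>f. expectation (\<lambda>\<omega>. f (X \<omega>)))"
  unfolding bdd_functional_def
proof (intro conjI ballI allI impI)
  fix f g :: "real \<Rightarrow> real" and c assume fg: "f \<in> cont_lim" "g \<in> cont_lim"
  show "expectation (\<lambda>\<omega>. f (X \<omega>) + c * g (X \<omega>)) = expectation (\<lambda>\<omega>. f (X \<omega>)) + c * expectation (\<lambda>\<omega>. g (X \<omega>))"
    using integrable_cont_lim[OF assms fg(1)] integrable_cont_lim[OF assms fg(2)] by simp
next
  fix f :: "real \<Rightarrow> real" and B assume f: "f \<in> cont_lim" and B: "\<forall>x\<ge>0. \<bar>f x\<bar> \<le> B"
  have "\<bar>expectation (\<lambda>\<omega>. f (X \<omega>))\<bar> \<le> expectation (\<lambda>\<omega>. \<bar>f (X \<omega>)\<bar>)" by (rule integral_abs_bound)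
  also have "\<dots> \<le> expectation (\<lambda>\<omega>. B)"
  proof (rule integral_mono_AE)
    show "AE \<omega> in M. \<bar>f (X \<omega>)\<bar> \<le> B" using X by eventually_elim (simp add: B)
  qed (use integrable_cont_lim[OF assms f] in auto)
  finally show "\<bar>expectation (\<lambda>\<omega>. f (X \<omega>))\<bar> \<le> 1 * B" by (simp add: prob_space)
qed simp

lemma bdd_functional_add_scaled:
  assumes "bdd_functional C L" "bdd_functional C' L'"
  shows "bdd_functional (C + \<bar>r\<bar> * C') (\<lambda>f. L f + r * L' f)"
  unfolding bdd_functional_def
proof (intro conjI ballI allI impI)
  show "0 \<le> C + \<bar>r\<bar> * C'" using assms by (auto simp: bdd_functional_def)
next
  fix f B assume f: "f \<in> cont_lim" and B: "\<forall>x\<ge>0. \<bar>f x\<bar> \<le> B"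
  have "\<bar>L f\<bar> \<le> C * B" "\<bar>L' f\<bar> \<le> C' * B" using assms f B by (auto simp: bdd_functional_def)
  then have "\<bar>L f\<bar> + \<bar>r\<bar> * \<bar>L' f\<bar> \<le> C * B + \<bar>r\<bar> * (C' * B)"
    by (intro add_mono mult_left_mono) auto
  moreover have "\<bar>L f + r * L' f\<bar> \<le> \<bar>L f\<bar> + \<bar>r\<bar> * \<bar>L' f\<bar>"
    using abs_triangle_ineq[of "L f" "r * L' f"] by (simp add: abs_mult)
  ultimately show "\<bar>L f + r * L' f\<bar> \<le> (C + \<bar>r\<bar> * C') * B"
    by (simp add: distrib_right mult.assoc)
next
  fix f g c assume "f \<in> cont_lim" "g \<in> cont_lim"
  then show "L (\<lambda>x. f x + c * g x) + r * L' (\<lambda>x. f x + c * g x) = L f + r * L' f + c * (L g + r * L' g)"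
    using bdd_functionalD(1)[OF assms(1), of f g c] bdd_functionalD(1)[OF assms(2), of f g c] by (simp add: algebra_simps)
qed

lemma set_integrable_mult_continuous:
  fixes k h :: "real \<Rightarrow> real"
  assumes k: "set_integrable lborel {a..b} k" and h: "continuous_on {a..b} h"
  shows "set_integrable lborel {a..b} (\<lambda>y. k y * h y)"
proof -
  have "bounded (h ` {a..b})" using h by (intro compact_imp_bounded compact_continuous_image) auto
  then obtain B where B': "\<forall>y\<in>{a..b}. \<bar>h y\<bar> \<le> B" by (auto simp: bounded_iff)
  then have B: "\<bar>h y\<bar> \<le> B" if "y \<in> {a..b}" for y using that by blast
  have km: "integrable lborel (\<lambda>y. indicator {a..b} y * k y)" using k by (simp add: set_integrable_def)
  have "(\<lambda>y. indicator {a..b} y *\<^sub>R h y) \<in> borel_measurable borel"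
    by (rule borel_measurable_continuous_on_indicator[OF _ h]) simp
  then have hm: "(\<lambda>y. indicator {a..b} y * h y) \<in> borel_measurable borel" by simp
  have "integrable lborel (\<lambda>y. (indicator {a..b} y * k y) * (indicator {a..b} y * h y))"
  proof (rule Bochner_Integration.integrable_bound[OF integrable_mult_right[OF km, of B]])
    show "(\<lambda>y. (indicator {a..b} y * k y) * (indicator {a..b} y * h y)) \<in> borel_measurable lborel"
      using borel_measurable_times[OF borel_measurable_integrable[OF km]] hm by simp
    show "AE y in lborel. norm (indicator {a..b} y * k y * (indicator {a..b} y * h y))
        \<le> norm (B * (indicator {a..b} y * k y))"
      by (rule AE_I2) (auto simp: indicator_def abs_mult mult.commute[of B] intro!: mult_left_mono order_trans[OF B])
  qed
  also have "(\<lambda>y. (indicator {a..b} y * k y) * (indicator {a..b} y * h y)) =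
      (\<lambda>y. indicator {a..b} y *\<^sub>R (k y * h y))" by (auto simp: indicator_def fun_eq_iff)
  finally show ?thesis by (simp add: set_integrable_def)
qed

text \<open>The functional is bounded by the L1 norm of \<open>k\<close>, so \<open>k\<close> may be
  a kernel that is singular at an end point.\<close>

lemma bdd_functional_time_integral:
  fixes k :: "real \<Rightarrow> real"
  assumes L: "\<And>y. y \<in> {0..t} \<Longrightarrow> bdd_functional 1 (L y)"
    and c: "\<And>i. continuous_on {0..t} (\<lambda>y. L y (expo i))"
    and k: "set_integrable lborel {0..t} k"
  shows "bdd_functional (LBINT y:{0..t}. \<bar>k y\<bar>) (\<lambda>f. LBINT y:{0..t}. k y * L y f)"
proof -
  have int: "set_integrable lborel {0..t} (\<lambda>y. k y * L y f)" if "f \<in> cont_lim" for f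
    by (rule set_integrable_mult_continuous[OF k bdd_functional_continuous_on[OF L c that]])
  have ka: "set_integrable lborel {0..t} (\<lambda>y. \<bar>k y\<bar>)" using k by (rule set_integrable_abs)
  show ?thesis
    unfolding bdd_functional_def
  proof (intro conjI ballI allI impI)
    show "0 \<le> (LBINT y:{0..t}. \<bar>k y\<bar>)"
      unfolding set_lebesgue_integral_def by (rule integral_nonneg_AE) auto
  next
    fix f g c assume fg: "f \<in> cont_lim" "g \<in> cont_lim"
    have "(LBINT y:{0..t}. k y * L y (\<lambda>x. f x + c * g x)) =
      (LBINT y:{0..t}. k y * L y f + c * (k y * L y g))"
      by (rule set_lebesgue_integral_cong) (auto simp: bdd_functionalD(1)[OF L fg] algebra_simps)
    also have "\<dots> = (LBINT y:{0..t}. k y * L y f) + c * (LBINT y:{0..t}. k y * L y g)"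
      using int[OF fg(1)] int[OF fg(2)] by (subst set_integral_add(2)) auto
    finally show "(LBINT y:{0..t}. k y * L y (\<lambda>x. f x + c * g x)) =
      (LBINT y:{0..t}. k y * L y f) + c * (LBINT y:{0..t}. k y * L y g)" .
  next
    fix f B assume f: "f \<in> cont_lim" and B: "\<forall>x\<ge>0. \<bar>f x\<bar> \<le> B"
    have Lf: "\<bar>L y f\<bar> \<le> B" if "y \<in> {0..t}" for y
      using bdd_functionalD(2)[OF L[OF that] f, of B] B by simp
    have "\<bar>LBINT y:{0..t}. k y * L y f\<bar> \<le> (LBINT y:{0..t}. \<bar>k y * L y f\<bar>)"
      using set_integral_norm_bound[OF int[OF f]] by simp
    also have "\<dots> \<le> (LBINT y:{0..t}. \<bar>k y\<bar> * B)"
      using set_integrable_abs[OF int[OF f]] ka Lf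
      by (intro set_integral_mono) (auto simp: abs_mult intro!: mult_left_mono)
    also have "\<dots> = (LBINT y:{0..t}. \<bar>k y\<bar>) * B" by simp
    finally show "\<bar>LBINT y:{0..t}. k y * L y f\<bar> \<le> (LBINT y:{0..t}. \<bar>k y\<bar>) * B" .
  qed
qed

text \<open>Laplace transforms at integers are moments of e^(-x), which is bounded on [0, oo). They
  determine the integrals of cos (t e^(-x)) and sin (t e^(-x)), which lie in
  \<open>cont_lim\<close>, and thus the characteristic function of the image law under x ->
  e^(-x).\<close>

lemma laplace_uniqueness:
  assumes "real_distribution \<mu>" "real_distribution \<nu>"
    and "AE x in \<mu>. 0 \<le> x" "AE x in \<nu>. 0 \<le> x"
    and eq: "\<And>i::nat. (\<integral>x. exp (- real i * x) \<partial>\<mu>) = (\<integral>x. exp (- real i * x) \<partial>\<nu>)"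
  shows "\<mu> = \<nu>"
proof -
  interpret m: real_distribution \<mu> by fact
  interpret n: real_distribution \<nu> by fact
  have CCeq: "(\<integral>x. f x \<partial>\<mu>) = (\<integral>x. f x \<partial>\<nu>)" if "f \<in> cont_lim" for f
    by (rule bdd_functional_cont_lim_eq[OF m.bdd_functional_expectation n.bdd_functional_expectation _ that, of "\<lambda>x. x" "\<lambda>x. x"])
       (use assms in \<open>auto simp: expo_def\<close>)
  let ?e = "\<lambda>x::real. exp (- x)"
  have m: "real_distribution (distr \<mu> borel ?e)"
    by (intro real_distribution.intro m.prob_space_distr) (auto simp: real_distribution_axioms_def)
  have n: "real_distribution (distr \<nu> borel ?e)"
    by (intro real_distribution.intro n.prob_space_distr) (auto simp: real_distribution_axioms_def)
  have "char (distr \<mu> borel ?e) = char (distr \<nu> borel ?e)"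
  proof
    fix t :: real
    have lim: "(?e \<longlongrightarrow> 0) at_top"
      using filterlim_compose[OF exp_at_bot filterlim_uminus_at_bot_at_top] .
    have cs: "(\<lambda>x. cos (t * exp (- x))) \<in> cont_lim" "(\<lambda>x. sin (t * exp (- x))) \<in> cont_lim"
      unfolding cont_lim_def using tendsto_cos[OF tendsto_mult_left[OF lim, of t]]
        tendsto_sin[OF tendsto_mult_left[OF lim, of t]]
      by (auto intro!: continuous_intros exI)
    have "char (distr P borel ?e) t = Complex (\<integral>x. cos (t * exp (- x)) \<partial>P) (\<integral>x. sin (t * exp (- x)) \<partial>P)"
      if "real_distribution P" "AE x in P. 0 \<le> x" for P
    proof -
      interpret P: real_distribution P by fact
      have i: "integrable P (\<lambda>x. iexp (t * exp (- x)))"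
        by (rule P.integrable_const_bound[of _ 1]) auto
      have "char (distr P borel ?e) t = (CLINT x|P. iexp (t * exp (- x)))"
        unfolding char_def by (subst integral_distr) auto
      also have "\<dots> = Complex (\<integral>x. cos (t * exp (- x)) \<partial>P) (\<integral>x. sin (t * exp (- x)) \<partial>P)"
      proof (rule complex_eqI)
        have "Re (CLINT x|P. iexp (t * exp (- x))) = (\<integral>x. Re (iexp (t * exp (- x))) \<partial>P)"
          using integral_Re[OF i] by simp
        then show "Re (CLINT x|P. iexp (t * exp (- x))) = Re (Complex (\<integral>x. cos (t * exp (- x)) \<partial>P) (\<integral>x. sin (t * exp (- x)) \<partial>P))"
          by (simp add: Re_exp)
        have "Im (CLINT x|P. iexp (t * exp (- x))) = (\<integral>x. Im (iexp (t * exp (- x))) \<partial>P)"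
          using integral_Im[OF i] by simp
        then show "Im (CLINT x|P. iexp (t * exp (- x))) = Im (Complex (\<integral>x. cos (t * exp (- x)) \<partial>P) (\<integral>x. sin (t * exp (- x)) \<partial>P))"
          by (simp add: Im_exp)
      qed
      finally show ?thesis .
    qed
    then show "char (distr \<mu> borel ?e) t = char (distr \<nu> borel ?e) t"
      using assms CCeq[OF cs(1)] CCeq[OF cs(2)] by simp
  qed
  then have "distr \<mu> borel ?e = distr \<nu> borel ?e" by (rule Levy_uniqueness[OF m n])
  \<comment> \<open>Pushing forward along -ln undoes the map x -> e^(-x).\<close>
  then have "distr (distr \<mu> borel ?e) borel (\<lambda>x. - ln x) = distr (distr \<nu> borel ?e) borel (\<lambda>x. - ln x)" by simp
  then have "distr \<mu> borel (\<lambda>x. x) = distr \<nu> borel (\<lambda>x. x)"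
    by (subst (asm) (1 2) distr_distr) (auto simp: comp_def)
  then show ?thesis
    by (metis distr_id2 m.events_eq_borel n.events_eq_borel)
qed

section \<open>The series of the moment generating functions\<close>

text \<open>With \<open>R\<close> large this makes the Mittag-Leffler series converge faster than any geometric one.\<close>

lemma Gamma_lower_bound:
  fixes x R :: real
  assumes x: "0 \<le> x" and R: "0 \<le> R"
  shows "R powr x * exp (- R) \<le> Gamma (x + 1)"
proof -
  \<comment> \<open>Only the part of the Gamma integral over [R, oo) is kept, where t^x is at least
    R^x.\<close>
  have "((\<lambda>t::real. exp (- 1 * t)) has_integral exp (- 1 * R) / 1) {R..}"
    by (rule has_integral_exp_minus_to_infinity) simp
  then have "((\<lambda>t. R powr x * exp (- t)) has_integral R powr x * exp (- R)) {R..}"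
    using has_integral_mult_right[of _ "exp (- R)" "{R..}" "R powr x"] by simp
  then have 1: "((\<lambda>t. if t \<in> {R..} then R powr x * exp (- t) else 0) has_integral R powr x * exp (- R)) {0..}"
    using R by (subst has_integral_restrict) auto
  have 2: "((\<lambda>t. t powr (x + 1 - 1) / exp t) has_integral Gamma (x + 1)) {0..}"
    using x by (intro Gamma_integral_real) auto
  show ?thesis
  proof (rule has_integral_le[OF 1 2])
    fix t :: real assume "t \<in> {0..}"
    show "(if t \<in> {R..} then R powr x * exp (- t) else 0) \<le> t powr (x + 1 - 1) / exp t"
    proof (cases "R \<le> t")
      case True
      then have "R powr x * exp (- t) \<le> t powr x * exp (- t)"
        using x R by (intro mult_right_mono powr_mono2) auto
      then show ?thesis using True by (simp add: exp_minus field_simps)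
    qed auto
  qed
qed

lemma summable_mittag_leffler:
  fixes \<alpha> r :: real
  assumes \<alpha>: "0 < \<alpha>" and r: "0 \<le> r"
  shows "summable (\<lambda>k. r ^ k / Gamma (real k * \<alpha> + 1))"
proof -
  \<comment> \<open>Chosen so that R^\<alpha> = 2r + 1: the general term is then at most e^R (r /
    (2r + 1))^k, and r / (2r + 1) <= 1/2.\<close>
  define R where "R = (2 * r + 1) powr (1 / \<alpha>)"
  have R: "R \<ge> 0" by (simp add: R_def)
  have "R powr (real k * \<alpha>) = (2 * r + 1) ^ k" for k
    using \<alpha> r by (simp add: R_def powr_powr powr_realpow)
  then have G: "(2 * r + 1) ^ k * exp (- R) \<le> Gamma (real k * \<alpha> + 1)" for k
    using Gamma_lower_bound[of "real k * \<alpha>" R] R \<alpha> by simp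
  have le: "r ^ k / Gamma (real k * \<alpha> + 1) \<le> exp R * (1/2) ^ k" for k
  proof -
    have p: "(2 * r + 1) ^ k * exp (- R) > 0" using r by simp
    have "r ^ k / Gamma (real k * \<alpha> + 1) \<le> r ^ k / ((2 * r + 1) ^ k * exp (- R))"
      using G[of k] p less_le_trans[OF p G] r by (intro divide_left_mono mult_pos_pos) auto
    also have "\<dots> = exp R * (r / (2 * r + 1)) ^ k"
      by (simp add: exp_minus power_divide field_simps)
    also have "\<dots> \<le> exp R * (1/2) ^ k"
      using r by (intro mult_left_mono power_mono) (auto simp: field_simps)
    finally show ?thesis .
  qed
  have "Gamma (real k * \<alpha> + 1) \<ge> 0" for k
    using \<alpha> by (intro Gamma_real_nonneg) (simp add: add_nonneg_pos)
  then have "norm (r ^ k / Gamma (real k * \<alpha> + 1)) \<le> exp R * (1/2) ^ k" for k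
    using le[of k] r by (simp add: abs_mult)
  moreover have "summable (\<lambda>k. exp R * (1/2 :: real) ^ k)"
    by (intro summable_mult summable_geometric) auto
  ultimately show ?thesis by (rule summable_comparison_test'[rotated])
qed

lemma pow_kernel_integral:
  fixes a t :: real
  assumes a: "0 < a" and t: "0 \<le> t"
  shows "set_integrable lborel {0..t} (pow_kernel a)"
    and "(LBINT y:{0..t}. pow_kernel a y) = pow_kernel (a + 1) t"
proof -
  have 1: "((\<lambda>x. x powr (a - 1)) has_integral t powr (a - 1 + 1) / (a - 1 + 1)) {0..t}"
    using a t by (intro has_integral_powr_from_0) auto
  have "((\<lambda>x. x powr (a - 1) * inverse (Gamma a)) has_integral (t powr a / a) * inverse (Gamma a)) {0..t}"
    using has_integral_mult_left[OF 1, of "inverse (Gamma a)"] by simp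
  moreover have "(t powr a / a) * inverse (Gamma a) = pow_kernel (a + 1) t"
  proof -
    have "Gamma (a + 1) = a * Gamma a" using a by (intro Gamma_plus1) (auto elim!: nonpos_Ints_cases)
    then show ?thesis using a Gamma_real_pos[OF a] by (simp add: pow_kernel_def field_simps)
  qed
  moreover have "pow_kernel a = (\<lambda>x. x powr (a - 1) * inverse (Gamma a))"
    by (simp add: pow_kernel_def fun_eq_iff divide_inverse)
  ultimately have *: "(pow_kernel a has_integral pow_kernel (a + 1) t) {0..t}" by simp
  have nn: "(\<integral>\<^sup>+x. ennreal (indicator {0..t} x * pow_kernel a x) \<partial>lborel) = ennreal (pow_kernel (a + 1) t)"
    by (rule nn_integral_has_integral_lebesgue[OF _ *]) (simp add: pow_kernel_nonneg a)
  show i: "set_integrable lborel {0..t} (pow_kernel a)"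
    unfolding set_integrable_def real_scaleR_def
    by (rule integrableI_nonneg) (auto simp: nn pow_kernel_nonneg a)
  show "(LBINT y:{0..t}. pow_kernel a y) = pow_kernel (a + 1) t"
    using set_borel_integral_eq_integral(2)[OF i] * by (simp add: integral_unique)
qed

lemma set_integrable_reflect:
  fixes f :: "real \<Rightarrow> real"
  assumes "set_integrable lborel {0..t} f"
  shows "set_integrable lborel {0..t} (\<lambda>y. f (t - y))"
proof -
  have "integrable lborel (\<lambda>y. indicator {0..t} (t + (-1) * y) *\<^sub>R f (t + (-1) * y))"
    by (rule lborel_integrable_real_affine) (use assms in \<open>auto simp: set_integrable_def\<close>)
  also have "(\<lambda>y. indicator {0..t} (t + (-1) * y) *\<^sub>R f (t + (-1) * y)) =
      (\<lambda>y. indicator {0..t} y *\<^sub>R f (t - y))" by (auto simp: indicator_def fun_eq_iff)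
  finally show ?thesis by (simp add: set_integrable_def)
qed

lemma conv_eq_LINT:
  fixes f g :: "real \<Rightarrow> real"
  assumes i: "set_integrable lborel {0..t} (\<lambda>y. f (t - y) * g y)"
    and nn: "\<And>y. 0 \<le> y \<Longrightarrow> y \<le> t \<Longrightarrow> 0 \<le> f y" "\<And>y. 0 \<le> y \<Longrightarrow> y \<le> t \<Longrightarrow> 0 \<le> g y"
  shows "conv (\<lambda>y. ennreal (f y)) (\<lambda>y. ennreal (g y)) t =
    ennreal (LBINT y:{0..t}. f (t - y) * g y)"
proof -
  have "conv (\<lambda>y. ennreal (f y)) (\<lambda>y. ennreal (g y)) t =
      (\<integral>\<^sup>+y. ennreal (indicator {0..t} y *\<^sub>R (f (t - y) * g y)) \<partial>lborel)"
    unfolding conv_def by (intro nn_integral_cong) (auto simp: indicator_def ennreal_mult nn)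
  also have "\<dots> = ennreal (LBINT y:{0..t}. f (t - y) * g y)"
    unfolding set_lebesgue_integral_def
    by (rule nn_integral_eq_integral)
      (use i nn in \<open>auto simp: set_integrable_def indicator_def\<close>)
  finally show ?thesis .
qed

lemma continuous_on_LINT:
  fixes f :: "real \<Rightarrow> real"
  assumes f: "set_integrable lborel {0..b} f"
  shows "continuous_on {0..b} (\<lambda>y. LBINT z:{0..y}. f z)"
proof -
  have "continuous_on {0..b} (\<lambda>y. integral {0..y} f)"
    using set_borel_integral_eq_integral(1)[OF f] by (rule indefinite_integral_continuous_1)
  moreover have "(LBINT z:{0..y}. f z) = integral {0..y} f" if "y \<in> {0..b}" for y
    by (rule set_borel_integral_eq_integral(2)[OF set_integrable_subset[OF f]]) (use that in auto)
  ultimately show ?thesis by (metis (no_types, lifting) continuous_on_cong)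
qed

lemma measurable_LINT_Icc [measurable]:
  fixes f :: "real \<Rightarrow> real"
  assumes [measurable]: "f \<in> borel_measurable borel"
  shows "(\<lambda>y. LBINT z:{0..y}. f z) \<in> borel_measurable borel"
proof -
  have "(\<lambda>y. LBINT z:{0..y}. f z) = (\<lambda>y. \<integral>z. (if 0 \<le> z \<and> z \<le> y then f z else 0) \<partial>lborel)"
    unfolding set_lebesgue_integral_def
    by (intro ext Bochner_Integration.integral_cong) (auto simp: indicator_def)
  also have "\<dots> \<in> borel_measurable borel" by measurable
  finally show ?thesis .
qed

text \<open>
  The coefficients of \<open>s\<^sup>k\<close>, with the constant term included as index \<open>0\<close>: the moment generating
  functions of \<open>X\<^sup>*\<close> and \<open>X\<close> are \<open>\<Sum> s\<^sup>k eml_term k t\<close> and \<open>1 + a\<^sub>T s \<Sum> s\<^sup>k eml_iterm k t\<close>.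
\<close>

definition eml_term :: "real \<Rightarrow> real \<Rightarrow> nat \<Rightarrow> real \<Rightarrow> real" where
  "eml_term \<alpha> lam k y = (if k = 0 then 1 else eml_coeff \<alpha> lam k y)"

definition eml_iterm :: "real \<Rightarrow> real \<Rightarrow> nat \<Rightarrow> real \<Rightarrow> real" where
  "eml_iterm \<alpha> lam k y = (LBINT x:{0..y}. eml_term \<alpha> lam k x)"

lemma eml_coeff_altdef:
  "eml_coeff \<alpha> lam k = (\<lambda>t. LBINT y:{0..t}. pow_kernel (real k * \<alpha>) y * exp (- lam * y))"
  unfolding eml_coeff_def pow_kernel_def by (simp add: mult_ac)

text \<open>A majorant on [0, t] of the coefficient of index k. The base 1 + t is positive, so that
  its real power is 1 at k = 0 even when t = 0, despite \<open>0 powr 0 = 0\<close>.\<close>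

definition eml_bound :: "real \<Rightarrow> real \<Rightarrow> nat \<Rightarrow> real" where
  "eml_bound \<alpha> t k = ((1 + t) powr \<alpha>) ^ k / Gamma (real k * \<alpha> + 1)"

text \<open>For c = n - \<alpha> this is the kernel of the tempered derivative divided by Gamma(n -
  \<alpha>); for c = n it belongs to the n-fold integral. The free order lets the shift by \<alpha>
  be stated as an equality of two integrals of the same shape.\<close>

definition rl_weight :: "real \<Rightarrow> real \<Rightarrow> real \<Rightarrow> real \<Rightarrow> real" where
  "rl_weight lam c t y = pow_kernel c (t - y) * exp (lam * y)"

lemma rl_weight_integrable:
  assumes "0 < c" "0 \<le> t"
  shows "set_integrable lborel {0..t} (rl_weight lam c t)"
  unfolding rl_weight_def
  by (intro set_integrable_mult_continuous set_integrable_reflect pow_kernel_integral assms continuous_intros)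

context
  fixes \<alpha> lam :: real
  assumes \<alpha>: "0 < \<alpha>" and lam: "0 \<le> lam"
begin

lemma measurable_eml_term [measurable]: "eml_term \<alpha> lam k \<in> borel_measurable borel"
  by (cases "k = 0") (simp_all add: eml_term_def[abs_def] eml_coeff_altdef)

lemma measurable_eml_iterm [measurable]: "eml_iterm \<alpha> lam k \<in> borel_measurable borel"
  unfolding eml_iterm_def[abs_def] by measurable

lemma eml_coeff_integrable:
  assumes "k \<noteq> 0" "0 \<le> t"
  shows "set_integrable lborel {0..t} (\<lambda>y. pow_kernel (real k * \<alpha>) y * exp (- lam * y))"
  using assms \<alpha> by (intro set_integrable_mult_continuous pow_kernel_integral continuous_intros) auto

lemma eml_term_continuous: "continuous_on {0..t} (eml_term \<alpha> lam k)"
proof (cases "k = 0 \<or> t < 0")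
  case False
  then have "continuous_on {0..t} (eml_coeff \<alpha> lam k)"
    unfolding eml_coeff_altdef by (intro continuous_on_LINT eml_coeff_integrable) auto
  then show ?thesis using False by (simp add: eml_term_def[abs_def])
qed (auto simp: eml_term_def[abs_def])

lemma eml_term_integrable: "set_integrable lborel {0..t} (eml_term \<alpha> lam k)"
  by (rule borel_integrable_atLeastAtMost') (rule eml_term_continuous)

lemma eml_iterm_continuous: "continuous_on {0..t} (eml_iterm \<alpha> lam k)"
  unfolding eml_iterm_def[abs_def] by (intro continuous_on_LINT eml_term_integrable)

lemma eml_term_nonneg: "0 \<le> eml_term \<alpha> lam k y"
proof (cases "k = 0")
  case False
  then show ?thesis using \<alpha>
    by (auto simp: eml_term_def eml_coeff_altdef set_lebesgue_integral_def pow_kernel_nonneg intro!: integral_nonneg_AE AE_I2)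
qed (simp add: eml_term_def)

lemma eml_iterm_nonneg: "0 \<le> eml_iterm \<alpha> lam k y"
  using eml_term_nonneg by (auto simp: eml_iterm_def set_lebesgue_integral_def intro!: integral_nonneg_AE)

lemma eml_bound_powr: "0 \<le> t \<Longrightarrow> eml_bound \<alpha> t k = (1 + t) powr (real k * \<alpha>) / Gamma (real k * \<alpha> + 1)"
  unfolding eml_bound_def by (simp add: powr_powr mult.commute flip: powr_realpow)

lemma eml_bound_summable: "0 \<le> t \<Longrightarrow> summable (\<lambda>k. \<bar>s\<bar> ^ k * eml_bound \<alpha> t k)"
  using summable_mittag_leffler[OF \<alpha>, of "\<bar>s\<bar> * (1 + t) powr \<alpha>"]
  by (simp add: eml_bound_def power_mult_distrib)

lemma pow_kernel_le_eml_bound: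
  assumes "0 \<le> y" "y \<le> t"
  shows "pow_kernel (real k * \<alpha> + 1) y \<le> eml_bound \<alpha> t k"
proof -
  have "Gamma (real k * \<alpha> + 1) > 0" using \<alpha> by (intro Gamma_real_pos) (simp add: add_nonneg_pos)
  moreover have "y powr (real k * \<alpha>) \<le> (1 + t) powr (real k * \<alpha>)"
    using assms \<alpha> by (intro powr_mono2) auto
  ultimately show ?thesis using assms
    by (simp add: eml_bound_powr pow_kernel_def divide_right_mono)
qed

text \<open>Dropping the factor e^(-lam z) <= 1 leaves the integral of a power kernel, which is the
  kernel of order one higher.\<close>

lemma eml_term_le:
  assumes "0 \<le> y" "y \<le> t"
  shows "eml_term \<alpha> lam k y \<le> eml_bound \<alpha> t k"
proof (cases "k = 0")
  case True
  then show ?thesis by (simp add: eml_term_def eml_bound_def)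
next
  case False
  then have "eml_term \<alpha> lam k y \<le> (LBINT z:{0..y}. pow_kernel (real k * \<alpha>) z)"
    unfolding eml_term_def eml_coeff_altdef using False \<alpha> assms lam
    by (auto intro!: set_integral_mono eml_coeff_integrable[simplified] pow_kernel_integral mult_left_le pow_kernel_nonneg)
  also have "\<dots> = pow_kernel (real k * \<alpha> + 1) y" using False \<alpha> assms by (intro pow_kernel_integral) auto
  also have "\<dots> \<le> eml_bound \<alpha> t k" by (rule pow_kernel_le_eml_bound[OF assms])
  finally show ?thesis .
qed

lemma eml_iterm_le:
  assumes "0 \<le> y" "y \<le> t"
  shows "eml_iterm \<alpha> lam k y \<le> t * eml_bound \<alpha> t k"
proof -
  have "eml_iterm \<alpha> lam k y \<le> (LBINT z:{0..y}. eml_bound \<alpha> t k)"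
    unfolding eml_iterm_def using assms
    by (intro set_integral_mono eml_term_integrable borel_integrable_atLeastAtMost' continuous_intros) (auto intro: eml_term_le)
  also have "\<dots> = y * eml_bound \<alpha> t k" using assms by (simp add: set_lebesgue_integral_def)
  also have "\<dots> \<le> t * eml_bound \<alpha> t k"
    using assms eml_term_le[OF assms, of k] eml_term_nonneg[of k y] by (intro mult_right_mono) auto
  finally show ?thesis .
qed

text \<open>Multiplication by e^(lam y) turns e^(-lam z) into e^(lam (y - z)), so the tempering
  becomes a convolution factor. Index 0 is set apart because the kernel of order 0 would be a Dirac
  mass.\<close>

lemma eml_term_conv:
  assumes k: "k \<noteq> 0" and y: "0 \<le> y"
  shows "ennreal (exp (lam * y) * eml_term \<alpha> lam k y) =
    conv (\<lambda>v. ennreal (exp (lam * v))) (\<lambda>v. ennreal (pow_kernel (real k * \<alpha>) v)) y"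
proof -
  have a: "0 < real k * \<alpha>" using k \<alpha> by simp
  have i: "set_integrable lborel {0..y} (\<lambda>z. exp (lam * (y - z)) * pow_kernel (real k * \<alpha>) z)"
    by (subst mult.commute)
      (intro set_integrable_mult_continuous pow_kernel_integral a y continuous_intros)
  have "conv (\<lambda>v. ennreal (exp (lam * v))) (\<lambda>v. ennreal (pow_kernel (real k * \<alpha>) v)) y =
      ennreal (LBINT z:{0..y}. exp (lam * (y - z)) * pow_kernel (real k * \<alpha>) z)"
    by (rule conv_eq_LINT[OF i]) (use a in \<open>auto simp: pow_kernel_nonneg\<close>)
  also have "(LBINT z:{0..y}. exp (lam * (y - z)) * pow_kernel (real k * \<alpha>) z) =
      (LBINT z:{0..y}. exp (lam * y) * (pow_kernel (real k * \<alpha>) z * exp (- lam * z)))"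
    by (intro set_lebesgue_integral_cong) (auto simp: right_diff_distrib exp_diff exp_minus field_simps)
  also have "\<dots> = exp (lam * y) * eml_term \<alpha> lam k y"
    using k by (simp add: eml_term_def eml_coeff_altdef)
  finally show ?thesis ..
qed

text \<open>A plain time integral is likewise a convolution after multiplication by e^(lam y), since
  e^(lam (y - z)) e^(lam z) = e^(lam y).\<close>

lemma eml_iterm_conv:
  assumes y: "0 \<le> y"
  shows "ennreal (exp (lam * y) * eml_iterm \<alpha> lam k y) =
    conv (\<lambda>v. ennreal (exp (lam * v))) (\<lambda>v. ennreal (exp (lam * v) * eml_term \<alpha> lam k v)) y"
proof -
  have i: "set_integrable lborel {0..y} (\<lambda>z. exp (lam * (y - z)) * (exp (lam * z) * eml_term \<alpha> lam k z))"
    by (rule borel_integrable_atLeastAtMost') (intro continuous_intros eml_term_continuous)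
  have "conv (\<lambda>v. ennreal (exp (lam * v))) (\<lambda>v. ennreal (exp (lam * v) * eml_term \<alpha> lam k v)) y =
      ennreal (LBINT z:{0..y}. exp (lam * (y - z)) * (exp (lam * z) * eml_term \<alpha> lam k z))"
    by (rule conv_eq_LINT[OF i]) (auto simp: eml_term_nonneg)
  also have "(LBINT z:{0..y}. exp (lam * (y - z)) * (exp (lam * z) * eml_term \<alpha> lam k z)) =
      (LBINT z:{0..y}. exp (lam * y) * eml_term \<alpha> lam k z)"
    by (intro set_lebesgue_integral_cong) (auto simp: right_diff_distrib exp_diff)
  also have "\<dots> = exp (lam * y) * eml_iterm \<alpha> lam k y" by (simp add: eml_iterm_def)
  finally show ?thesis ..
qed

lemma conv_rl_weight:
  assumes c: "0 < c" and t: "0 \<le> t" and F: "continuous_on {0..t} F" "\<And>y. 0 \<le> F y"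
  shows "conv (\<lambda>v. ennreal (pow_kernel c v)) (\<lambda>v. ennreal (exp (lam * v) * F v)) t =
    ennreal (LBINT y:{0..t}. rl_weight lam c t y * F y)"
    and "0 \<le> (LBINT y:{0..t}. rl_weight lam c t y * F y)"
proof -
  have i: "set_integrable lborel {0..t} (\<lambda>y. pow_kernel c (t - y) * (exp (lam * y) * F y))"
    using set_integrable_mult_continuous[OF rl_weight_integrable[OF c t] F(1)]
    by (simp add: rl_weight_def mult.assoc)
  show "conv (\<lambda>v. ennreal (pow_kernel c v)) (\<lambda>v. ennreal (exp (lam * v) * F v)) t =
    ennreal (LBINT y:{0..t}. rl_weight lam c t y * F y)"
    using conv_eq_LINT[of t "pow_kernel c" "\<lambda>y. exp (lam * y) * F y"] i c F
    by (simp add: rl_weight_def mult.assoc pow_kernel_nonneg)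
  show "0 \<le> (LBINT y:{0..t}. rl_weight lam c t y * F y)"
    using c F by (auto simp: set_lebesgue_integral_def rl_weight_def pow_kernel_nonneg intro!: integral_nonneg_AE)
qed

text \<open>With E(v) = e^(lam v), both sides equal the convolution of E with the power kernel of
  order \<beta> + (k + 1)\<alpha> = n + k\<alpha>.\<close>

lemma eml_term_shift_conv:
  assumes \<beta>: "0 < \<beta>" and n: "\<beta> + \<alpha> = n" and t: "0 \<le> t"
  shows "conv (\<lambda>v. ennreal (pow_kernel \<beta> v)) (\<lambda>v. ennreal (exp (lam * v) * eml_term \<alpha> lam (Suc k) v)) t =
    conv (\<lambda>v. ennreal (pow_kernel n v)) (\<lambda>v. ennreal (exp (lam * v) * eml_term \<alpha> lam k v)) t"
proof -
  let ?E = "\<lambda>v. ennreal (exp (lam * v))"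
  let ?u = "\<lambda>a v. ennreal (pow_kernel a v)"
  let ?G = "\<lambda>k v. ennreal (exp (lam * v) * eml_term \<alpha> lam k v)"
  have n0: "n > 0" using n \<alpha> \<beta> by simp
  have *: "conv (?u c) (?G j) t = conv (?u (c + real j * \<alpha>)) ?E t" if c: "0 < c" and j: "j \<noteq> 0" for c j
  proof -
    have a: "0 < real j * \<alpha>" using j \<alpha> by simp
    have "conv (?u c) (?G j) t = conv (?u c) (conv ?E (?u (real j * \<alpha>))) t"
      by (rule conv_cong) (auto simp: eml_term_conv[OF j])
    also have "\<dots> = conv (?u c) (conv (?u (real j * \<alpha>)) ?E) t"
      by (rule conv_cong) (auto intro!: conv_commute)
    also have "\<dots> = conv (conv (?u c) (?u (real j * \<alpha>))) ?E t"
      by (rule conv_assoc) measurable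
    also have "\<dots> = conv (?u (c + real j * \<alpha>)) ?E t"
      by (rule conv_cong) (auto simp: conv_pow_kernel[OF c a])
    finally show ?thesis .
  qed
  have "conv (?u \<beta>) (?G (Suc k)) t = conv (?u (n + real k * \<alpha>)) ?E t"
  proof -
    have "\<beta> + real (Suc k) * \<alpha> = n + real k * \<alpha>" using n by (simp add: algebra_simps)
    then show ?thesis using *[OF \<beta>, of "Suc k"] by (simp del: of_nat_Suc)
  qed
  also have "\<dots> = conv (?u n) (?G k) t"
  \<comment> \<open>At k = 0 the coefficient is the constant 1, so the second factor is already
    \<open>?E\<close>.\<close>
  proof (cases "k = 0")
    case True
    then show ?thesis by (simp add: eml_term_def)
  qed (use *[OF n0, of k] in simp)
  finally show ?thesis .
qed

lemma eml_term_shift: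
  assumes \<beta>: "0 < \<beta>" and n: "\<beta> + \<alpha> = n" and t: "0 \<le> t"
  shows "(LBINT y:{0..t}. rl_weight lam \<beta> t y * eml_term \<alpha> lam (Suc k) y) =
    (LBINT y:{0..t}. rl_weight lam n t y * eml_term \<alpha> lam k y)"
proof -
  have n0: "n > 0" using n \<alpha> \<beta> by simp
  show ?thesis
    using eml_term_shift_conv[OF assms, of k]
    by (simp add: conv_rl_weight[OF \<beta> t eml_term_continuous eml_term_nonneg]
      conv_rl_weight[OF n0 t eml_term_continuous eml_term_nonneg])
qed

text \<open>The factor E that represents the time integral commutes to the outside. The shift for
  \<open>eml_term\<close> holds at every time up to t, hence under the outer convolution.\<close>

lemma eml_iterm_shift:
  assumes \<beta>: "0 < \<beta>" and n: "\<beta> + \<alpha> = n" and t: "0 \<le> t"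
  shows "(LBINT y:{0..t}. rl_weight lam \<beta> t y * eml_iterm \<alpha> lam (Suc k) y) =
    (LBINT y:{0..t}. rl_weight lam n t y * eml_iterm \<alpha> lam k y)"
proof -
  let ?E = "\<lambda>v. ennreal (exp (lam * v))"
  let ?u = "\<lambda>a v. ennreal (pow_kernel a v)"
  let ?G = "\<lambda>k v. ennreal (exp (lam * v) * eml_term \<alpha> lam k v)"
  let ?H = "\<lambda>k v. ennreal (exp (lam * v) * eml_iterm \<alpha> lam k v)"
  have n0: "n > 0" using n \<alpha> \<beta> by simp
  have *: "conv (?u c) (?H j) t = conv ?E (conv (?u c) (?G j)) t" for c j
  proof -
    have "conv (?u c) (?H j) t = conv (?u c) (conv ?E (?G j)) t"
      by (rule conv_cong) (auto simp: eml_iterm_conv)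
    also have "\<dots> = conv (conv (?u c) ?E) (?G j) t" by (rule conv_assoc) measurable
    also have "\<dots> = conv (conv ?E (?u c)) (?G j) t" by (rule conv_cong) (auto intro!: conv_commute)
    also have "\<dots> = conv ?E (conv (?u c) (?G j)) t" by (rule conv_assoc[symmetric]) measurable
    finally show ?thesis .
  qed
  have "conv (?u \<beta>) (?H (Suc k)) t = conv (?u n) (?H k) t"
    unfolding * by (rule conv_cong) (auto simp: eml_term_shift_conv[OF \<beta> n])
  then show ?thesis
    by (simp add: conv_rl_weight[OF \<beta> t eml_iterm_continuous eml_iterm_nonneg]
      conv_rl_weight[OF n0 t eml_iterm_continuous eml_iterm_nonneg])
qed

end

section \<open>Power series in s with time-dependent coefficients\<close>

context
  fixes s t :: real and c :: "nat \<Rightarrow> real \<Rightarrow> real" and B :: "nat \<Rightarrow> real"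
  assumes c_cont: "\<And>k. continuous_on {0..t} (c k)"
    and c_bound: "\<And>k y. 0 \<le> y \<Longrightarrow> y \<le> t \<Longrightarrow> \<bar>c k y\<bar> \<le> B k"
    and B_summable: "summable (\<lambda>k. \<bar>s\<bar> ^ k * B k)"
begin

lemma series_abs_summable: "0 \<le> y \<Longrightarrow> y \<le> t \<Longrightarrow> summable (\<lambda>k. \<bar>s ^ k * c k y\<bar>)"
  by (rule summable_comparison_test'[OF B_summable])
    (auto simp: abs_mult power_abs intro!: mult_left_mono c_bound)

lemma series_summable: "0 \<le> y \<Longrightarrow> y \<le> t \<Longrightarrow> summable (\<lambda>k. s ^ k * c k y)"
  using series_abs_summable by (rule summable_rabs_cancel)

lemma series_continuous: "continuous_on {0..t} (\<lambda>y. \<Sum>k. s ^ k * c k y)"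
proof -
  have "uniform_limit {0..t} (\<lambda>n y. \<Sum>k<n. s ^ k * c k y) (\<lambda>y. \<Sum>k. s ^ k * c k y) sequentially"
    by (rule Weierstrass_m_test[OF _ B_summable])
      (auto simp: abs_mult power_abs intro!: mult_left_mono c_bound)
  then show ?thesis
    by (rule uniform_limit_theorem[rotated]) (auto intro!: always_eventually continuous_intros c_cont)
qed

text \<open>The majorant is uniform in y, so the L1 norms of the terms are at most that of
  \<open>w\<close> times |s|^k B k. Their sum is finite, which permits termwise integration even for
  a singular \<open>w\<close>.\<close>

lemma series_integral:
  assumes w: "set_integrable lborel {0..t} w"
  shows "(\<lambda>k. s ^ k * (LBINT y:{0..t}. w y * c k y)) sums
    (LBINT y:{0..t}. w y * (\<Sum>k. s ^ k * c k y))"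
proof -
  define f where "f k y = indicator {0..t} y *\<^sub>R (w y * (s ^ k * c k y))" for k y
  have wc: "set_integrable lborel {0..t} (\<lambda>y. w y * (s ^ k * c k y))" for k
    by (intro set_integrable_mult_continuous w continuous_intros c_cont)
  have int: "integrable lborel (f k)" for k
  proof -
    have "f k = (\<lambda>y. indicator {0..t} y *\<^sub>R (w y * (s ^ k * c k y)))" by (simp add: f_def fun_eq_iff)
    then show ?thesis using wc[of k] by (simp add: set_integrable_def)
  qed
  have wa: "integrable lborel (\<lambda>y. \<bar>indicator {0..t} y * w y\<bar>)"
    using w by (auto simp: set_integrable_def)
  define W where "W = (\<integral>y. \<bar>indicator {0..t} y * w y\<bar> \<partial>lborel)"
  have fb: "norm (f k y) \<le> \<bar>indicator {0..t} y * w y\<bar> * (\<bar>s\<bar> ^ k * B k)" for k y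
  proof (cases "y \<in> {0..t}")
    case True
    then have "\<bar>w y\<bar> * (\<bar>s\<bar> ^ k * \<bar>c k y\<bar>) \<le> \<bar>w y\<bar> * (\<bar>s\<bar> ^ k * B k)"
      by (intro mult_left_mono c_bound) auto
    then show ?thesis using True by (simp add: f_def abs_mult power_abs)
  qed (simp add: f_def)
  have "(\<lambda>k. integral\<^sup>L lborel (f k)) sums (\<integral>y. (\<Sum>k. f k y) \<partial>lborel)"
  proof (rule sums_integral)
    show "integrable lborel (f k)" for k by (rule int)
    show "AE y in lborel. summable (\<lambda>k. norm (f k y))"
      by (rule AE_I2, rule summable_comparison_test'[OF summable_mult[OF B_summable]])
        (use fb in \<open>auto\<close>)
    show "summable (\<lambda>k. \<integral>y. norm (f k y) \<partial>lborel)"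
    proof (rule summable_comparison_test'[OF summable_mult[OF B_summable, of W]])
      fix k
      have "(\<integral>y. norm (f k y) \<partial>lborel) \<le> (\<integral>y. \<bar>indicator {0..t} y * w y\<bar> * (\<bar>s\<bar> ^ k * B k) \<partial>lborel)"
        by (intro integral_mono fb integrable_norm int integrable_mult_left wa)
      also have "\<dots> = W * (\<bar>s\<bar> ^ k * B k)" by (simp add: W_def)
      finally show "norm (\<integral>y. norm (f k y) \<partial>lborel) \<le> W * (\<bar>s\<bar> ^ k * B k)"
        by (simp add: integral_nonneg_AE)
    qed
  qed
  moreover have "integral\<^sup>L lborel (f k) = s ^ k * (LBINT y:{0..t}. w y * c k y)" for k
  proof -
    have "integral\<^sup>L lborel (f k) = (\<integral>y. s ^ k * (indicator {0..t} y *\<^sub>R (w y * c k y)) \<partial>lborel)"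
      by (rule Bochner_Integration.integral_cong) (auto simp: f_def)
    then show ?thesis by (simp add: set_lebesgue_integral_def)
  qed
  moreover have "(\<integral>y. (\<Sum>k. f k y) \<partial>lborel) = (LBINT y:{0..t}. w y * (\<Sum>k. s ^ k * c k y))"
    unfolding set_lebesgue_integral_def
    by (rule Bochner_Integration.integral_cong)
      (auto simp: f_def indicator_def suminf_mult series_summable)
  ultimately show ?thesis by simp
qed

text \<open>In the applications \<open>v\<close> is the weight of order n - \<alpha> and
  \<open>w\<close> that of order n. The index shift releases a factor s; the term of index 0 has no
  predecessor and is left over as a source term of the equation.\<close>

lemma series_shift:
  assumes v: "set_integrable lborel {0..t} v" and w: "set_integrable lborel {0..t} w"
    and eq: "\<And>k. (LBINT y:{0..t}. v y * c (Suc k) y) = (LBINT y:{0..t}. w y * c k y)"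
  shows "(LBINT y:{0..t}. v y * (\<Sum>k. s ^ k * c k y)) =
    (LBINT y:{0..t}. v y * c 0 y) + s * (LBINT y:{0..t}. w y * (\<Sum>k. s ^ k * c k y))"
proof -
  have "(\<lambda>k. s ^ Suc k * (LBINT y:{0..t}. v y * c (Suc k) y)) sums
      (s * (LBINT y:{0..t}. w y * (\<Sum>k. s ^ k * c k y)))"
    using sums_mult[OF series_integral[OF w], of s] by (simp add: eq mult.assoc)
  then have "(\<lambda>k. s ^ k * (LBINT y:{0..t}. v y * c k y)) sums
      (s * (LBINT y:{0..t}. w y * (\<Sum>k. s ^ k * c k y)) + s ^ 0 * (LBINT y:{0..t}. v y * c 0 y))"
    by (rule sums_Suc)
  from sums_unique2[OF series_integral[OF v] this] show ?thesis by simp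
qed

end

section \<open>Tempered fractional derivatives\<close>

text \<open>The time domains of the two equations, treated together: (0, oo) for the starred
  process, (0, T] for the other.\<close>

definition time_range :: "real set \<Rightarrow> bool" where
  "time_range S \<longleftrightarrow> S = {0<..} \<or> (\<exists>T>0. S = {0<..T})"

lemma time_range_pos: "time_range S \<Longrightarrow> t \<in> S \<Longrightarrow> 0 < t"
  by (auto simp: time_range_def)

text \<open>Every point of S is a limit of S from the left, so derivatives within S are unique and
  \<open>vector_derivative\<close> returns them.\<close>

lemma time_range_nontrivial:
  assumes "time_range S" "t \<in> S"
  shows "at t within S \<noteq> bot"
proof -
  have t: "0 < t" using assms by (rule time_range_pos)
  have "{0<..<t} \<subseteq> S" using assms by (auto simp: time_range_def)
  moreover have "at t within {0<..<t} \<noteq> bot"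
    using islimpt_greaterThanLessThan2[OF t] by (simp add: trivial_limit_within)
  ultimately show ?thesis by (metis at_le bot.extremum_unique)
qed

text \<open>The fundamental theorem of calculus yields derivatives within a compact interval. On (0,
  oo) the end b = t + 1 makes t interior; on (0, T] the interval with end b = T contains S.\<close>

lemma time_range_vector_derivative:
  assumes "time_range S" "t \<in> S"
  obtains b where "b \<in> S" "t \<le> b"
    "\<And>(f :: real \<Rightarrow> real) d. (f has_vector_derivative d) (at t within {0..b}) \<Longrightarrow> (f has_vector_derivative d) (at t within S)"
proof (cases "S = {0<..}")
  case True
  have t: "0 < t" using assms by (rule time_range_pos)
  have at: "at t within {0..t + 1} = at t" using t by (intro at_within_interior) auto
  show ?thesis
  proof (rule that[of "t + 1"])
    show "(f has_vector_derivative d) (at t within S)"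
      if "(f has_vector_derivative d) (at t within {0..t + 1})" for f :: "real \<Rightarrow> real" and d
      using that unfolding at by (rule has_vector_derivative_at_within)
  qed (use True t in auto)
next
  case False
  then obtain T where T: "T > 0" "S = {0<..T}" using assms by (auto simp: time_range_def)
  show ?thesis
    by (rule that[of T]) (use T assms in \<open>auto elim: has_vector_derivative_within_subset\<close>)
qed

text \<open>A chain of explicit functions from \<open>F\<close> to \<open>G\<close>, each the
  derivative of its predecessor. Such chains combine linearly before any iterated
  \<open>nderiv_within\<close> is evaluated.\<close>

definition ndiff :: "real set \<Rightarrow> nat \<Rightarrow> (real \<Rightarrow> real) \<Rightarrow> (real \<Rightarrow> real) \<Rightarrow> bool" where
  "ndiff S n F G \<longleftrightarrow> (\<exists>C. (\<forall>t\<in>S. C 0 t = F t) \<and> (\<forall>t\<in>S. C n t = G t) \<and>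
     (\<forall>k<n. \<forall>t\<in>S. (C k has_vector_derivative C (Suc k) t) (at t within S)))"

lemma ndiff_nderiv_within:
  assumes S: "time_range S" and d: "ndiff S n F G"
  shows "k < n \<Longrightarrow> nderiv_within S k F differentiable_on S"
    and "t \<in> S \<Longrightarrow> nderiv_within S n F t = G t"
proof -
  from d obtain C where C: "\<And>t. t \<in> S \<Longrightarrow> C 0 t = F t" "\<And>t. t \<in> S \<Longrightarrow> C n t = G t"
    "\<And>k t. k < n \<Longrightarrow> t \<in> S \<Longrightarrow> (C k has_vector_derivative C (Suc k) t) (at t within S)"
    unfolding ndiff_def by blast
  have eq: "k \<le> n \<Longrightarrow> (\<forall>t\<in>S. nderiv_within S k F t = C k t)" for k
  proof (induction k)
    case (Suc k)
    show ?case
    proof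
      fix t assume t: "t \<in> S"
      have "(nderiv_within S k F has_vector_derivative C (Suc k) t) (at t within S)"
        by (rule has_vector_derivative_transform[OF t _ C(3)]) (use Suc t in auto)
      then show "nderiv_within S (Suc k) F t = C (Suc k) t"
        using vector_derivative_within[OF time_range_nontrivial[OF S t]] by simp
    qed
  qed (simp add: C)
  show "nderiv_within S n F t = G t" if "t \<in> S" using eq[of n] C(2) that by simp
  show "nderiv_within S k F differentiable_on S" if k: "k < n"
    unfolding differentiable_on_def
  proof
    fix t assume t: "t \<in> S"
    have "(nderiv_within S k F has_vector_derivative C (Suc k) t) (at t within S)"
      by (rule has_vector_derivative_transform[OF t _ C(3)]) (use eq[of k] k t in auto)
    then show "nderiv_within S k F differentiable at t within S" by (rule differentiableI_vector)
  qed
qed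

lemma ndiff_cong:
  assumes "ndiff S n F G" "\<And>t. t \<in> S \<Longrightarrow> F t = F' t" "\<And>t. t \<in> S \<Longrightarrow> G t = G' t"
  shows "ndiff S n F' G'"
  using assms unfolding ndiff_def by (metis (no_types, lifting))

lemma ndiff_linear:
  assumes "ndiff S n F G" "ndiff S n F' G'"
  shows "ndiff S n (\<lambda>t. a * F t + b * F' t) (\<lambda>t. a * G t + b * G' t)"
proof -
  from assms obtain C C' where
    C: "\<forall>t\<in>S. C 0 t = F t" "\<forall>t\<in>S. C n t = G t"
      "\<forall>k<n. \<forall>t\<in>S. (C k has_vector_derivative C (Suc k) t) (at t within S)" and
    C': "\<forall>t\<in>S. C' 0 t = F' t" "\<forall>t\<in>S. C' n t = G' t"
      "\<forall>k<n. \<forall>t\<in>S. (C' k has_vector_derivative C' (Suc k) t) (at t within S)"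
    unfolding ndiff_def by blast
  show ?thesis
    unfolding ndiff_def
    by (rule exI[of _ "\<lambda>k t. a * C k t + b * C' k t"])
      (use C C' in \<open>auto intro!: has_vector_derivative_add has_vector_derivative_mult_right\<close>)
qed

lemma ndiff_1: "(\<And>t. t \<in> S \<Longrightarrow> (F has_vector_derivative G t) (at t within S)) \<Longrightarrow> ndiff S 1 F G"
  unfolding ndiff_def by (rule exI[of _ "\<lambda>k. if k = 0 then F else G"]) auto

lemma ndiff_2:
  assumes "\<And>t. t \<in> S \<Longrightarrow> (F has_vector_derivative F' t) (at t within S)"
    "\<And>t. t \<in> S \<Longrightarrow> (F' has_vector_derivative G t) (at t within S)"
  shows "ndiff S 2 F G"
  unfolding ndiff_def
  by (rule exI[of _ "\<lambda>k. if k = 0 then F else if k = 1 then F' else G"])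
    (use assms in \<open>auto simp: less_2_cases_iff\<close>)

text \<open>Continuity is asked at t alone, because the kernels to be integrated may blow up at
  0.\<close>

lemma LINT_has_vector_derivative:
  fixes g :: "real \<Rightarrow> real"
  assumes S: "time_range S" and t: "t \<in> S"
    and i: "\<And>b. b \<in> S \<Longrightarrow> set_integrable lborel {0..b} g"
    and c: "\<And>b. b \<in> S \<Longrightarrow> continuous (at t within {0..b}) g"
  shows "((\<lambda>u. LBINT y:{0..u}. g y) has_vector_derivative g t) (at t within S)"
proof -
  obtain b where b: "b \<in> S" "t \<le> b"
    and mono: "\<And>(f :: real \<Rightarrow> real) d. (f has_vector_derivative d) (at t within {0..b}) \<Longrightarrow> (f has_vector_derivative d) (at t within S)"
    using time_range_vector_derivative[OF S t] by metis
  have t0: "0 < t" using S t by (rule time_range_pos)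
  have "((\<lambda>u. integral {0..u} g) has_vector_derivative g t) (at t within ({0..b} - {}))"
    by (rule integral_has_vector_derivative_continuous_at)
      (use set_borel_integral_eq_integral(1)[OF i[OF b(1)]] t0 b c in auto)
  then have *: "((\<lambda>u. integral {0..u} g) has_vector_derivative g t) (at t within {0..b})" by simp
  have "(LBINT y:{0..u}. g y) = integral {0..u} g" if "u \<in> {0..b}" for u
    by (rule set_borel_integral_eq_integral(2)[OF set_integrable_subset[OF i[OF b(1)]]]) (use that in auto)
  then have "((\<lambda>u. LBINT y:{0..u}. g y) has_vector_derivative g t) (at t within {0..b})"
    using t0 b by (intro has_vector_derivative_transform[OF _ _ *]) auto
  then show ?thesis by (rule mono)
qed

lemma LINT_continuous_has_vector_derivative:
  fixes g :: "real \<Rightarrow> real"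
  assumes S: "time_range S" and t: "t \<in> S"
    and c: "\<And>b. b \<in> S \<Longrightarrow> continuous_on {0..b} g"
  shows "((\<lambda>u. LBINT y:{0..u}. g y) has_vector_derivative g t) (at t within S)"
proof (rule LINT_has_vector_derivative[OF S t])
  have t0: "0 < t" using S t by (rule time_range_pos)
  show "set_integrable lborel {0..b} g" if "b \<in> S" for b
    by (rule borel_integrable_atLeastAtMost'[OF c[OF that]])
  show "continuous (at t within {0..b}) g" if "b \<in> S" for b
  proof (cases "t \<le> b")
    case True
    then show ?thesis using c[OF that] t0 by (simp add: continuous_on_eq_continuous_within)
  next
    case False
    \<comment> \<open>For t > b the point t is not a limit point of [0, b], so continuity there is
      vacuous.\<close>
    then have "{0..b} - {t} = {0..b}" by auto
    then have "at t within {0..b} = bot" using False by (simp add: at_within_eq_bot_iff)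
    then show ?thesis by (simp add: continuous_bot)
  qed
qed

text \<open>With A the integral of g and B that of y g(y), this differentiates the integral of (t -
  y) g(y) over [0, t]: the two terms containing t g(t) cancel.\<close>

lemma mult_minus_deriv:
  fixes A B :: "real \<Rightarrow> real"
  assumes "(A has_real_derivative a) (at t within S)" "(B has_real_derivative a * t) (at t within S)"
  shows "((\<lambda>t. t * A t - B t) has_real_derivative A t) (at t within S)"
  by (rule derivative_eq_intros assms refl)+ (simp add: algebra_simps)

lemma pow_kernel_1: "u \<noteq> 0 \<Longrightarrow> pow_kernel 1 u = 1"
  by (simp add: pow_kernel_def)

lemma pow_kernel_2: "0 \<le> u \<Longrightarrow> pow_kernel 2 u = u"
  using Gamma_fact[of 1, where 'a = real] by (simp add: pow_kernel_def)

text \<open>Cauchy's formula for repeated integration, for the two orders that occur.\<close>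

lemma ndiff_repeated_integral:
  fixes g :: "real \<Rightarrow> real"
  assumes S: "time_range S" and c: "\<And>b. b \<in> S \<Longrightarrow> continuous_on {0..b} g" and n: "n = 1 \<or> n = 2"
  shows "ndiff S n (\<lambda>t. LBINT y:{0..t}. pow_kernel (real n) (t - y) * g y) g"
  using n
proof
  assume n: "n = 1"
  \<comment> \<open>The kernel of order 1 equals 1 except at y = t, where
    \<open>0 powr 0 = 0\<close>, so the integrands agree only almost everywhere.\<close>
  have eq: "(LBINT y:{0..t}. pow_kernel 1 (t - y) * g y) = (LBINT y:{0..t}. g y)" if "t \<in> S" for t
  proof -
    have [measurable]: "(\<lambda>y. indicator {0..t} y * g y) \<in> borel_measurable borel"
      using borel_measurable_continuous_on_indicator[OF _ c[OF that]] by simp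
    have "(\<lambda>y. indicator {0..t} y * (pow_kernel 1 (t - y) * g y)) = (\<lambda>y. pow_kernel 1 (t - y) * (indicator {0..t} y * g y))"
      by (auto simp: fun_eq_iff)
    then have m: "(\<lambda>y. indicator {0..t} y * (pow_kernel 1 (t - y) * g y)) \<in> borel_measurable borel" by simp
    have "AE y in lborel. y \<noteq> t" by (rule AE_lborel_singleton)
    then show ?thesis unfolding set_lebesgue_integral_def
      by (intro integral_cong_AE, use m in simp, simp, eventually_elim) (auto simp: pow_kernel_1)
  qed
  show ?thesis unfolding n
    by (rule ndiff_cong[OF ndiff_1[OF LINT_continuous_has_vector_derivative[OF S _ c]]]) (auto simp: eq)
next
  assume n: "n = 2"
  let ?I = "\<lambda>t. LBINT y:{0..t}. g y" and ?M = "\<lambda>t. LBINT y:{0..t}. y * g y"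
  have eq: "(LBINT y:{0..t}. pow_kernel 2 (t - y) * g y) = t * ?I t - ?M t" if "t \<in> S" for t
  proof -
    have "(LBINT y:{0..t}. pow_kernel 2 (t - y) * g y) = (LBINT y:{0..t}. t * g y - y * g y)"
      by (rule set_lebesgue_integral_cong) (auto simp: pow_kernel_2 algebra_simps)
    also have "\<dots> = t * ?I t - ?M t"
      by (subst set_integral_diff(2))
        (auto intro!: borel_integrable_atLeastAtMost' continuous_intros c[OF that])
    finally show ?thesis .
  qed
  have d: "((\<lambda>t. t * ?I t - ?M t) has_vector_derivative ?I t) (at t within S)" if t: "t \<in> S" for t
  proof -
    have "(?I has_vector_derivative g t) (at t within S)" "(?M has_vector_derivative t * g t) (at t within S)"
      by (rule LINT_continuous_has_vector_derivative[OF S t]; intro continuous_intros c; assumption)+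
    then have I: "(?I has_real_derivative g t) (at t within S)" and M: "(?M has_real_derivative g t * t) (at t within S)"
      by (simp_all add: has_real_derivative_iff_has_vector_derivative mult.commute)
    have "((\<lambda>t. t * ?I t - ?M t) has_real_derivative ?I t) (at t within S)"
      by (rule mult_minus_deriv[OF I M])
    then show ?thesis by (simp add: has_real_derivative_iff_has_vector_derivative)
  qed
  show ?thesis unfolding n
    by (rule ndiff_cong[OF ndiff_2[OF d LINT_continuous_has_vector_derivative[OF S _ c]]]) (auto simp: eq)
qed

lemma LINT_reflect:
  fixes f :: "real \<Rightarrow> real"
  shows "(LBINT y:{0..t}. f (t - y)) = (LBINT y:{0..t}. f y)"
proof -
  have "(LBINT y:{0..t}. f y) = \<bar>-1 :: real\<bar> *\<^sub>R (\<integral>y. indicator {0..t} (t + (-1) * y) *\<^sub>R f (t + (-1) * y) \<partial>lborel)"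
    unfolding set_lebesgue_integral_def by (rule lborel_integral_real_affine) simp
  also have "\<dots> = (LBINT y:{0..t}. f (t - y))"
    unfolding set_lebesgue_integral_def by (auto intro!: Bochner_Integration.integral_cong simp: indicator_def)
  finally show ?thesis ..
qed

text \<open>With \<beta> = n - \<alpha>, the n-th time derivatives of \<open>rl_one\<close> and
  \<open>rl_id\<close>, times e^(-lam t), are the tempered derivatives of 1 and of t in the source
  terms.\<close>

definition rl_one :: "real \<Rightarrow> real \<Rightarrow> real \<Rightarrow> real" where
  "rl_one lam \<beta> t = (LBINT y:{0..t}. rl_weight lam \<beta> t y)"

definition rl_id :: "real \<Rightarrow> real \<Rightarrow> real \<Rightarrow> real" where
  "rl_id lam \<beta> t = (LBINT y:{0..t}. rl_weight lam \<beta> t y * y)"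

lemma rl_weight_reflect: "rl_weight lam \<beta> t (t - v) = exp (lam * t) * (pow_kernel \<beta> v * exp (- lam * v))"
  by (simp add: rl_weight_def right_diff_distrib exp_diff exp_minus divide_inverse)

text \<open>The reflection v = t - y takes t out of the singular kernel. It then occurs only in a
  factor and as the upper limit, where it can be differentiated.\<close>

lemma rl_one_eq:
  "rl_one lam \<beta> t = exp (lam * t) * (LBINT v:{0..t}. pow_kernel \<beta> v * exp (- lam * v))"
proof -
  have "rl_one lam \<beta> t = (LBINT v:{0..t}. rl_weight lam \<beta> t (t - v))"
    unfolding rl_one_def by (rule LINT_reflect[symmetric])
  also have "\<dots> = (LBINT v:{0..t}. exp (lam * t) * (pow_kernel \<beta> v * exp (- lam * v)))"
    by (rule set_lebesgue_integral_cong) (simp_all add: rl_weight_reflect)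
  finally show ?thesis by simp
qed

lemma exp_times_deriv:
  fixes A :: "real \<Rightarrow> real"
  assumes "(A has_real_derivative a) (at t within S)"
  shows "((\<lambda>t. exp (lam * t) * A t) has_real_derivative lam * (exp (lam * t) * A t) + exp (lam * t) * a) (at t within S)"
  by (rule derivative_eq_intros assms refl)+ (simp add: algebra_simps)

context
  fixes \<beta> lam :: real and S :: "real set"
  assumes \<beta>: "0 < \<beta>" and S: "time_range S"
begin

lemma tempered_pow_integral:
  assumes t: "t \<in> S" and h: "continuous_on {0..} h"
  shows "set_integrable lborel {0..t} (\<lambda>v. pow_kernel \<beta> v * h v)"
    and "((\<lambda>u. LBINT v:{0..u}. pow_kernel \<beta> v * h v) has_real_derivative pow_kernel \<beta> t * h t) (at t within S)"
proof -
  have i: "set_integrable lborel {0..b} (\<lambda>v. pow_kernel \<beta> v * h v)" if "b \<in> S" for b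
    using time_range_pos[OF S that] \<beta>
    by (intro set_integrable_mult_continuous pow_kernel_integral continuous_on_subset[OF h]) auto
  show "set_integrable lborel {0..t} (\<lambda>v. pow_kernel \<beta> v * h v)" by (rule i[OF t])
  have t0: "0 < t" using time_range_pos[OF S t] .
  have h: "isCont h t"
    using t0 by (intro continuous_on_interior[OF h]) simp
  have p: "isCont (pow_kernel \<beta>) t"
  proof -
    have "isCont (\<lambda>v. v powr (\<beta> - 1)) t" by (rule DERIV_isCont[OF has_real_derivative_powr[OF t0]])
    then have "isCont (\<lambda>v. v powr (\<beta> - 1) * inverse (Gamma \<beta>)) t" by (intro isCont_mult) simp_all
    then show ?thesis by (simp add: pow_kernel_def[abs_def] divide_inverse)
  qed
  have "continuous (at t within {0..b}) (\<lambda>v. pow_kernel \<beta> v * h v)" for b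
    by (rule continuous_at_imp_continuous_at_within[OF isCont_mult[OF p h]])
  then show "((\<lambda>u. LBINT v:{0..u}. pow_kernel \<beta> v * h v) has_real_derivative pow_kernel \<beta> t * h t) (at t within S)"
    using LINT_has_vector_derivative[OF S t, of "\<lambda>v. pow_kernel \<beta> v * h v"] i
    by (simp add: has_real_derivative_iff_has_vector_derivative)
qed

lemma rl_one_deriv:
  assumes t: "t \<in> S"
  shows "(rl_one lam \<beta> has_real_derivative lam * rl_one lam \<beta> t + pow_kernel \<beta> t) (at t within S)"
proof -
  let ?A = "\<lambda>t. LBINT v:{0..t}. pow_kernel \<beta> v * exp (- lam * v)"
  have eq: "rl_one lam \<beta> = (\<lambda>t. exp (lam * t) * ?A t)" by (simp add: rl_one_eq fun_eq_iff)
  have A: "(?A has_real_derivative pow_kernel \<beta> t * exp (- lam * t)) (at t within S)"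
    by (rule tempered_pow_integral[OF t]) (intro continuous_intros)
  have e: "exp (lam * t) * (pow_kernel \<beta> t * exp (- lam * t)) = pow_kernel \<beta> t" by (simp add: exp_minus)
  show ?thesis unfolding eq using exp_times_deriv[OF A, of lam] unfolding e .
qed

lemma rl_id_deriv:
  assumes t: "t \<in> S"
  shows "(rl_id lam \<beta> has_real_derivative lam * rl_id lam \<beta> t + rl_one lam \<beta> t) (at t within S)"
proof -
  let ?A = "\<lambda>t. LBINT v:{0..t}. pow_kernel \<beta> v * exp (- lam * v)"
  let ?B = "\<lambda>t. LBINT v:{0..t}. pow_kernel \<beta> v * (exp (- lam * v) * v)"
  have eq: "rl_id lam \<beta> t = exp (lam * t) * (t * ?A t - ?B t)" if t: "t \<in> S" for t
  proof -
    have "rl_id lam \<beta> t = (LBINT v:{0..t}. rl_weight lam \<beta> t (t - v) * (t - v))"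
      unfolding rl_id_def by (rule LINT_reflect[symmetric])
    also have "\<dots> = (LBINT v:{0..t}. exp (lam * t) * (t * (pow_kernel \<beta> v * exp (- lam * v)) - pow_kernel \<beta> v * (exp (- lam * v) * v)))"
      by (rule set_lebesgue_integral_cong) (simp_all add: rl_weight_reflect right_diff_distrib left_diff_distrib mult_ac)
    also have "\<dots> = exp (lam * t) * (LBINT v:{0..t}. t * (pow_kernel \<beta> v * exp (- lam * v)) - pow_kernel \<beta> v * (exp (- lam * v) * v))"
      by simp
    also have "(LBINT v:{0..t}. t * (pow_kernel \<beta> v * exp (- lam * v)) - pow_kernel \<beta> v * (exp (- lam * v) * v)) =
       (LBINT v:{0..t}. t * (pow_kernel \<beta> v * exp (- lam * v))) - ?B t"
      by (rule set_integral_diff(2))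
        (intro set_integrable_mult_right impI tempered_pow_integral(1)[OF t] continuous_intros)+
    finally show ?thesis by simp
  qed
  have A: "(?A has_real_derivative pow_kernel \<beta> t * exp (- lam * t)) (at t within S)"
    by (rule tempered_pow_integral[OF t]) (intro continuous_intros)
  have B: "(?B has_real_derivative (pow_kernel \<beta> t * exp (- lam * t)) * t) (at t within S)"
    using tempered_pow_integral(2)[OF t, of "\<lambda>v. exp (- lam * v) * v"] by (simp add: mult.assoc continuous_intros)
  have "((\<lambda>t. exp (lam * t) * (t * ?A t - ?B t)) has_real_derivative
      lam * (exp (lam * t) * (t * ?A t - ?B t)) + exp (lam * t) * ?A t) (at t within S)"
    by (rule exp_times_deriv[OF mult_minus_deriv[OF A B]])
  then have "((\<lambda>t. exp (lam * t) * (t * ?A t - ?B t)) has_real_derivative lam * rl_id lam \<beta> t + rl_one lam \<beta> t) (at t within S)"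
    unfolding eq[OF t] rl_one_eq .
  then show ?thesis
    unfolding has_real_derivative_iff_has_vector_derivative
    by (rule has_vector_derivative_transform[OF t, rotated]) (rule eq)
qed

text \<open>Two derivatives are taken only when \<beta> = 1; the kernel in the first derivative of
  \<open>rl_one\<close> is then the constant 1 and can be differentiated again. \<open>K\<close> and
  \<open>L\<close> stay unspecified because the equations contain the derivatives of 1 and t
  unevaluated.\<close>

lemma ndiff_rl:
  assumes n: "n = 1 \<or> n = 2 \<and> \<beta> = 1"
  obtains K L where "ndiff S n (rl_one lam \<beta>) K" "ndiff S n (rl_id lam \<beta>) L"
proof -
  have 1: "(rl_one lam \<beta> has_vector_derivative lam * rl_one lam \<beta> t + pow_kernel \<beta> t) (at t within S)"
    "(rl_id lam \<beta> has_vector_derivative lam * rl_id lam \<beta> t + rl_one lam \<beta> t) (at t within S)" if "t \<in> S" for t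
    using rl_one_deriv[OF that] rl_id_deriv[OF that] by (simp_all add: has_real_derivative_iff_has_vector_derivative)
  from n show ?thesis
  proof
    assume "n = 1"
    then show ?thesis using that ndiff_1[OF 1(1)] ndiff_1[OF 1(2)] by simp
  next
    assume n: "n = 2 \<and> \<beta> = 1"
    have "(rl_one lam \<beta> has_vector_derivative lam * rl_one lam \<beta> t + 1) (at t within S)" if "t \<in> S" for t
      using 1(1)[OF that] n time_range_pos[OF S that] by (simp add: pow_kernel_1)
    moreover have "((\<lambda>t. lam * rl_one lam \<beta> t + 1) has_vector_derivative lam * (lam * rl_one lam \<beta> t + 1)) (at t within S)" if "t \<in> S" for t
    proof -
      have "((\<lambda>t. lam * rl_one lam \<beta> t + 1) has_real_derivative lam * (lam * rl_one lam \<beta> t + 1)) (at t within S)"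
      proof -
        have "(rl_one lam \<beta> has_real_derivative lam * rl_one lam \<beta> t + 1) (at t within S)"
          using rl_one_deriv[OF that] n time_range_pos[OF S that] by (simp add: pow_kernel_1)
        from DERIV_add[OF DERIV_cmult[OF this, of lam] DERIV_const[of 1]] show ?thesis by simp
      qed
      then show ?thesis by (simp add: has_real_derivative_iff_has_vector_derivative)
    qed
    ultimately have "ndiff S 2 (rl_one lam \<beta>) (\<lambda>t. lam * (lam * rl_one lam \<beta> t + 1))" by (rule ndiff_2)
    moreover have "((\<lambda>t. lam * rl_id lam \<beta> t + rl_one lam \<beta> t) has_vector_derivative
      lam * (lam * rl_id lam \<beta> t + rl_one lam \<beta> t) + (lam * rl_one lam \<beta> t + pow_kernel \<beta> t)) (at t within S)" if "t \<in> S" for t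
    proof -
      have "((\<lambda>t. lam * rl_id lam \<beta> t + rl_one lam \<beta> t) has_real_derivative
        lam * (lam * rl_id lam \<beta> t + rl_one lam \<beta> t) + (lam * rl_one lam \<beta> t + pow_kernel \<beta> t)) (at t within S)"
        by (rule DERIV_add[OF DERIV_cmult[OF rl_id_deriv[OF that]] rl_one_deriv[OF that]])
      then show ?thesis by (simp add: has_real_derivative_iff_has_vector_derivative)
    qed
    then have "ndiff S 2 (rl_id lam \<beta>) (\<lambda>t. lam * (lam * rl_id lam \<beta> t + rl_one lam \<beta> t) + (lam * rl_one lam \<beta> t + pow_kernel \<beta> t))"
      by (intro ndiff_2[OF 1(2)])
    ultimately show ?thesis using that n by simp
  qed
qed

end

section \<open>From chains of derivatives to the tempered derivative\<close>

lemma frac_order_cases: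
  assumes "0 < \<alpha>" "\<alpha> \<le> 1"
  shows "frac_order \<alpha> = 1 \<or> frac_order \<alpha> = 2 \<and> real (frac_order \<alpha>) - \<alpha> = 1"
    and "0 < real (frac_order \<alpha>) - \<alpha>"
proof -
  have "\<lfloor>\<alpha>\<rfloor> = 0" if "\<alpha> \<noteq> 1" using assms that by (simp add: floor_eq_iff)
  then have "frac_order \<alpha> = (if \<alpha> = 1 then 2 else 1)" by (simp add: frac_order_def)
  then show "frac_order \<alpha> = 1 \<or> frac_order \<alpha> = 2 \<and> real (frac_order \<alpha>) - \<alpha> = 1"
    "0 < real (frac_order \<alpha>) - \<alpha>" using assms by auto
qed

lemma tempered_kernel_eq:
  assumes "0 < real (frac_order \<alpha>) - \<alpha>"
  shows "tempered_kernel \<alpha> lam f t y = Gamma (real (frac_order \<alpha>) - \<alpha>) *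
    (rl_weight lam (real (frac_order \<alpha>) - \<alpha>) t y * f y)"
  using Gamma_real_pos[OF assms]
  by (simp add: tempered_kernel_def rl_weight_def pow_kernel_def algebra_simps)

lemma tempered_of_ndiff:
  assumes \<alpha>: "0 < \<alpha>" "\<alpha> \<le> 1" and S: "time_range S"
    and f: "\<And>b. b \<in> S \<Longrightarrow> continuous_on {0..b} f"
    and d: "ndiff S (frac_order \<alpha>)
      (\<lambda>t. LBINT y:{0..t}. rl_weight lam (real (frac_order \<alpha>) - \<alpha>) t y * f y) G"
  shows "tempered_differentiable S \<alpha> lam f"
    and "t \<in> S \<Longrightarrow> tempered_deriv S \<alpha> lam f t = exp (- lam * t) * G t"
proof -
  let ?\<beta> = "real (frac_order \<alpha>) - \<alpha>"
  have \<beta>: "0 < ?\<beta>" by (rule frac_order_cases[OF \<alpha>])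
  \<comment> \<open>The factor Gamma(n - \<alpha>), divided out again in the definition of the
    derivative, comes from linearity with second coefficient 0.\<close>
  have "ndiff S (frac_order \<alpha>) (\<lambda>t. Gamma ?\<beta> * (LBINT y:{0..t}. rl_weight lam ?\<beta> t y * f y) +
      0 * (LBINT y:{0..t}. rl_weight lam ?\<beta> t y * f y)) (\<lambda>t. Gamma ?\<beta> * G t + 0 * G t)"
    by (rule ndiff_linear[OF d d])
  then have d': "ndiff S (frac_order \<alpha>) (tempered_integral \<alpha> lam f) (\<lambda>t. Gamma ?\<beta> * G t)"
    by (rule ndiff_cong) (auto simp: tempered_integral_def tempered_kernel_eq[OF \<beta>])
  have "set_integrable lborel {0..t} (tempered_kernel \<alpha> lam f t)" if "t \<in> S" for t
    unfolding tempered_kernel_eq[OF \<beta>, abs_def] using time_range_pos[OF S that] f[OF that] \<beta>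
    by (intro set_integrable_mult_right impI set_integrable_mult_continuous rl_weight_integrable) auto
  then show "tempered_differentiable S \<alpha> lam f"
    unfolding tempered_differentiable_def using ndiff_nderiv_within(1)[OF S d'] by auto
  show "tempered_deriv S \<alpha> lam f t = exp (- lam * t) * G t" if "t \<in> S"
    unfolding tempered_deriv_def using ndiff_nderiv_within(2)[OF S d' that] Gamma_real_pos[OF \<beta>] by simp
qed

section \<open>The inverse stable subordinator\<close>

locale stable_process =
  fixes \<alpha> :: real and N :: "'c measure" and D :: "real \<Rightarrow> 'c \<Rightarrow> real"
  assumes \<alpha>: "0 < \<alpha>" and S: "stable_subordinator \<alpha> N D"
begin

sublocale prob_space N using S by (simp add: stable_subordinator_def)

lemma sub_measurable: "0 \<le> x \<Longrightarrow> D x \<in> borel_measurable N"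
  using S by (simp add: stable_subordinator_def)

lemma sub_measurable_1 [measurable]: "D 1 \<in> borel_measurable N"
  by (rule sub_measurable) simp

lemma sub_mono: "\<omega> \<in> space N \<Longrightarrow> 0 \<le> x \<Longrightarrow> x \<le> y \<Longrightarrow> D x \<omega> \<le> D y \<omega>"
  using S by (auto simp: stable_subordinator_def mono_on_def)

lemma sub_nonneg: "\<omega> \<in> space N \<Longrightarrow> 0 \<le> x \<Longrightarrow> 0 \<le> D x \<omega>"
  using sub_mono[of \<omega> 0 x] S by (simp add: stable_subordinator_def)

lemma sub_laplace: "0 \<le> x \<Longrightarrow> 0 \<le> s \<Longrightarrow> (\<integral>\<omega>. exp (- s * D x \<omega>) \<partial>N) = exp (- x * s powr \<alpha>)"
  using S by (simp add: stable_subordinator_def)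

lemma sub_exp_integrable: "0 \<le> x \<Longrightarrow> 0 \<le> s \<Longrightarrow> integrable N (\<lambda>\<omega>. exp (- s * D x \<omega>))"
  using sub_measurable[of x] sub_nonneg[of _ x]
  by (intro integrable_const_bound[of _ 1]) auto

text \<open>The probability of D x <= 0 is at most E exp(-s D x) = exp(-x s^\<alpha>), which tends
  to 0 as s grows. Positivity makes division by \<open>D 1\<close> legitimate.\<close>

lemma sub_pos:
  assumes x: "0 < x"
  shows "AE \<omega> in N. 0 < D x \<omega>"
proof -
  have [measurable]: "D x \<in> borel_measurable N" using x by (intro sub_measurable) simp
  define A where "A = {\<omega> \<in> space N. D x \<omega> \<le> 0}"
  have A [measurable]: "A \<in> sets N" unfolding A_def by measurable
  have "prob A \<le> 0 + e" if e: "0 < e" for e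
  proof (cases "e < 1")
    case True
    \<comment> \<open>The solution of exp(-x s^\<alpha>) = e.\<close>
    define s where "s = (- ln e / x) powr (1 / \<alpha>)"
    have "- ln e / x > 0" using e True x by (intro divide_pos_pos) auto
    moreover have "(r powr (1 / \<alpha>)) powr \<alpha> = r" if "r > 0" for r
      using \<alpha> that by (simp add: powr_powr)
    ultimately have s: "s powr \<alpha> = - ln e / x" unfolding s_def by blast
    have "prob A = (\<integral>\<omega>. indicator A \<omega> \<partial>N)" by simp
    also have "\<dots> \<le> (\<integral>\<omega>. exp (- s * D x \<omega>) \<partial>N)"
    proof (rule integral_mono)
      show "integrable N (\<lambda>\<omega>. exp (- s * D x \<omega>))"
        using x by (intro sub_exp_integrable) (auto simp: s_def)
      show "indicator A \<omega> \<le> exp (- s * D x \<omega>)" if "\<omega> \<in> space N" for \<omega>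
        using sub_nonneg[OF that, of x] x by (auto simp: A_def indicator_def)
      show "integrable N (indicator A :: 'c \<Rightarrow> real)"
        by (intro integrable_real_indicator A) (simp add: less_top[symmetric])
    qed
    also have "\<dots> = exp (- x * s powr \<alpha>)" using x by (intro sub_laplace) (auto simp: s_def)
    also have "\<dots> = e" using x e by (simp add: s)
    finally show ?thesis by simp
  next
    case False
    then show ?thesis using prob_le_1[of A] by linarith
  qed
  then have "prob A \<le> 0" by (rule field_le_epsilon)
  then have "prob A = 0" using measure_nonneg[of N A] by linarith
  then have "AE \<omega> in N. \<omega> \<notin> A" using prob_eq_0[OF A] by simp
  then show ?thesis by (rule AE_mp) (auto intro!: AE_I2 simp: A_def not_le)
qed

text \<open>The Laplace transforms agree because x i^\<alpha> = (i x^(1/\<alpha>))^\<alpha>, and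
  integer arguments suffice by \<open>laplace_uniqueness\<close>.\<close>

lemma sub_scaling:
  assumes x: "0 < x"
  shows "distr N borel (D x) = distr N borel (\<lambda>\<omega>. x powr (1 / \<alpha>) * D 1 \<omega>)"
proof (rule laplace_uniqueness)
  have [measurable]: "D x \<in> borel_measurable N" using x by (intro sub_measurable) simp
  show "real_distribution (distr N borel (D x))"
    by (intro real_distribution.intro prob_space_distr) (auto simp: real_distribution_axioms_def)
  show "real_distribution (distr N borel (\<lambda>\<omega>. x powr (1 / \<alpha>) * D 1 \<omega>))"
    by (intro real_distribution.intro prob_space_distr) (auto simp: real_distribution_axioms_def)
  show "AE y in distr N borel (D x). 0 \<le> y"
    using x by (subst AE_distr_iff) (auto intro!: AE_I2 sub_nonneg)
  show "AE y in distr N borel (\<lambda>\<omega>. x powr (1 / \<alpha>) * D 1 \<omega>). 0 \<le> y"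
    by (subst AE_distr_iff) (auto intro!: AE_I2 mult_nonneg_nonneg sub_nonneg)
  fix i :: nat
  have "(\<integral>y. exp (- real i * y) \<partial>distr N borel (D x)) = (\<integral>\<omega>. exp (- real i * D x \<omega>) \<partial>N)"
    by (rule integral_distr) auto
  also have "\<dots> = exp (- x * real i powr \<alpha>)" using x by (intro sub_laplace) auto
  also have "\<dots> = exp (- 1 * (real i * x powr (1 / \<alpha>)) powr \<alpha>)"
    using x \<alpha> by (simp add: powr_mult powr_powr)
  also have "\<dots> = (\<integral>\<omega>. exp (- (real i * x powr (1 / \<alpha>)) * D 1 \<omega>) \<partial>N)"
    by (rule sub_laplace[symmetric]) auto
  also have "\<dots> = (\<integral>y. exp (- real i * y) \<partial>distr N borel (\<lambda>\<omega>. x powr (1 / \<alpha>) * D 1 \<omega>))"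
    by (subst integral_distr) (auto simp: mult.assoc)
  finally show "(\<integral>y. exp (- real i * y) \<partial>distr N borel (D x)) =
    (\<integral>y. exp (- real i * y) \<partial>distr N borel (\<lambda>\<omega>. x powr (1 / \<alpha>) * D 1 \<omega>))" .
qed

text \<open>Markov's inequality for exp(-D n) bounds the probability of not having exceeded t at
  time n by exp(t - n).\<close>

lemma sub_unbounded: "AE \<omega> in N. \<exists>n::nat. t < D (real n) \<omega>"
proof -
  have [measurable]: "D (real n) \<in> borel_measurable N" for n by (intro sub_measurable) simp
  define A where "A = {\<omega> \<in> space N. \<forall>n::nat. D (real n) \<omega> \<le> t}"
  have A [measurable]: "A \<in> sets N" unfolding A_def by measurable
  have le: "prob A \<le> exp (t - real n)" for n :: nat
  proof -
    have "exp (- t) * prob A = (\<integral>\<omega>. exp (- t) * indicator A \<omega> \<partial>N)" by simp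
    also have "\<dots> \<le> (\<integral>\<omega>. exp (- 1 * D (real n) \<omega>) \<partial>N)"
    proof (rule integral_mono)
      show "integrable N (\<lambda>\<omega>. exp (- 1 * D (real n) \<omega>))" by (rule sub_exp_integrable) auto
      show "exp (- t) * indicator A \<omega> \<le> exp (- 1 * D (real n) \<omega>)" for \<omega>
        by (auto simp: A_def indicator_def)
      show "integrable N (\<lambda>\<omega>. exp (- t) * indicator A \<omega>)"
        by (intro integrable_mult_right integrable_real_indicator A) (simp add: less_top[symmetric])
    qed
    also have "\<dots> = exp (- real n * 1 powr \<alpha>)" by (rule sub_laplace) auto
    finally show ?thesis by (simp add: exp_diff exp_minus field_simps)
  qed
  have "prob A \<le> 0"
  proof (rule ccontr)
    assume "\<not> prob A \<le> 0"
    then have p: "prob A > 0" by simp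
    obtain n :: nat where "t - ln (prob A) < real n" using reals_Archimedean2 by blast
    then have "exp (t - real n) < exp (ln (prob A))" by simp
    then show False using le[of n] p by simp
  qed
  then have "prob A = 0" using measure_nonneg[of N A] by linarith
  then have "AE \<omega> in N. \<omega> \<notin> A" using prob_eq_0[OF A] by simp
  then show ?thesis by (rule AE_mp) (auto intro!: AE_I2 simp: A_def not_le)
qed

text \<open>Monotonicity reduces the infimum to rational times. Measurability concerns every sample
  point, so the null event of paths that never exceed t must be tracked: there the value is the
  fixed constant \<open>Inf {}\<close>.\<close>

lemma inverse_measurable [measurable]: "inverse_subordinator D t \<in> borel_measurable N"
proof -
  have [measurable]: "D (real n) \<in> borel_measurable N" for n by (intro sub_measurable) simp
  \<comment> \<open>The truncation keeps the time nonnegative for every rational, which is where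
    \<open>D\<close> is known to be measurable.\<close>
  have [measurable]: "D (max 0 (of_rat q)) \<in> borel_measurable N" for q by (intro sub_measurable) simp
  have "{\<omega> \<in> space N. inverse_subordinator D t \<omega> < x} =
    {\<omega> \<in> space N. (\<exists>q::rat. 0 \<le> (of_rat q :: real) \<and> of_rat q < x \<and> t < D (max 0 (of_rat q)) \<omega>) \<or>
      ((\<forall>n::nat. D (real n) \<omega> \<le> t) \<and> Inf {} < x)}" (is "?A = ?B") for x
  proof -
    have "inverse_subordinator D t \<omega> < x \<longleftrightarrow> (\<exists>q::rat. 0 \<le> (of_rat q :: real) \<and> of_rat q < x \<and> t < D (max 0 (of_rat q)) \<omega>) \<or>
      ((\<forall>n::nat. D (real n) \<omega> \<le> t) \<and> Inf {} < x)" if \<omega>: "\<omega> \<in> space N" for \<omega>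
    proof (cases "\<exists>n::nat. t < D (real n) \<omega>")
      case True
      let ?S = "{x. 0 \<le> x \<and> t < D x \<omega>}"
      have ne: "?S \<noteq> {}" using True of_nat_0_le_iff by blast
      have "Inf ?S < x \<longleftrightarrow> (\<exists>y\<in>?S. y < x)"
        by (rule cInf_less_iff[OF ne]) (auto intro!: bdd_belowI[of _ 0])
      also have "\<dots> \<longleftrightarrow> (\<exists>q::rat. 0 \<le> (of_rat q :: real) \<and> of_rat q < x \<and> t < D (max 0 (of_rat q)) \<omega>)"
      proof
        assume "\<exists>y\<in>?S. y < x"
        then obtain y where y: "0 \<le> y" "t < D y \<omega>" "y < x" by auto
        obtain q :: rat where q: "y < of_rat q" "of_rat q < x" using of_rat_dense[OF y(3)] by blast
        have "D y \<omega> \<le> D (of_rat q) \<omega>" using q y by (intro sub_mono[OF \<omega>]) auto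
        then show "\<exists>q::rat. 0 \<le> (of_rat q :: real) \<and> of_rat q < x \<and> t < D (max 0 (of_rat q)) \<omega>"
        proof (intro exI[of _ q] conjI)
          show "0 \<le> (of_rat q :: real)" using q y by linarith
          then show "t < D (max 0 (of_rat q)) \<omega>" using y \<open>D y \<omega> \<le> _\<close> by (simp add: max_absorb2)
        qed (rule q)
      next
        assume "\<exists>q::rat. 0 \<le> (of_rat q :: real) \<and> of_rat q < x \<and> t < D (max 0 (of_rat q)) \<omega>"
        then obtain q :: rat where "0 \<le> (of_rat q :: real)" "of_rat q < x" "t < D (max 0 (of_rat q)) \<omega>" by auto
        then show "\<exists>y\<in>?S. y < x" by (intro bexI[of _ "of_rat q"]) (auto simp: max_def)
      qed
      finally show ?thesis using True unfolding inverse_subordinator_def by (auto simp: not_le[symmetric])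
    next
      case False
      have "D x \<omega> \<le> t" if "0 \<le> x" for x
      proof -
        obtain n where n: "x \<le> real n" using real_arch_simple by blast
        then show ?thesis using sub_mono[OF \<omega> that n] False by (meson not_le order_trans)
      qed
      then have empty: "{x. 0 \<le> x \<and> t < D x \<omega>} = {}" by (auto simp: not_less)
      moreover have "\<not> (\<exists>q::rat. 0 \<le> (of_rat q :: real) \<and> of_rat q < x \<and> t < D (max 0 (of_rat q)) \<omega>)"
        using \<open>\<And>x. 0 \<le> x \<Longrightarrow> D x \<omega> \<le> t\<close> by (auto simp: not_less max_def)
      ultimately show ?thesis using False unfolding inverse_subordinator_def empty by (auto simp: not_less)
    qed
    then show ?thesis by blast
  qed
  moreover have "{\<omega> \<in> space N. (\<exists>q::rat. 0 \<le> (of_rat q :: real) \<and> of_rat q < x \<and> t < D (max 0 (of_rat q)) \<omega>) \<or>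
      ((\<forall>n::nat. D (real n) \<omega> \<le> t) \<and> Inf {} < x)} \<in> sets N" for x
    by measurable
  ultimately show ?thesis by (subst borel_measurable_iff_less) simp
qed

text \<open>The set of times whose infimum is taken is upward closed and almost surely nonempty.
  Only q equal to the infimum is left undecided, and \<open>cdf_le_of_lt\<close> absorbs
  this.\<close>

lemma inverse_bracket:
  "AE \<omega> in N. 0 \<le> inverse_subordinator D t \<omega> \<and>
    (\<forall>q\<ge>0. (q < inverse_subordinator D t \<omega> \<longrightarrow> D q \<omega> \<le> t) \<and>
      (D q \<omega> \<le> t \<longrightarrow> q \<le> inverse_subordinator D t \<omega>))"
  using sub_unbounded[of t]
proof (rule AE_mp, intro AE_I2 impI)
  fix \<omega> assume \<omega>: "\<omega> \<in> space N" and ex: "\<exists>n::nat. t < D (real n) \<omega>"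
  let ?S = "{x. 0 \<le> x \<and> t < D x \<omega>}"
  have ne: "?S \<noteq> {}" using ex of_nat_0_le_iff by blast
  have bdd: "bdd_below ?S" by (auto intro!: bdd_belowI[of _ 0])
  show "0 \<le> inverse_subordinator D t \<omega> \<and>
    (\<forall>q\<ge>0. (q < inverse_subordinator D t \<omega> \<longrightarrow> D q \<omega> \<le> t) \<and>
      (D q \<omega> \<le> t \<longrightarrow> q \<le> inverse_subordinator D t \<omega>))"
    unfolding inverse_subordinator_def
  proof (intro conjI allI impI)
    show "0 \<le> Inf ?S" by (rule cInf_greatest[OF ne]) auto
    fix q :: real assume q: "0 \<le> q"
    show "D q \<omega> \<le> t" if "q < Inf ?S"
      using that cInf_lower[OF _ bdd, of q] q by (force simp: not_less[symmetric])
    show "q \<le> Inf ?S" if "D q \<omega> \<le> t"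
    proof (rule cInf_greatest[OF ne])
      fix y assume "y \<in> ?S"
      then show "q \<le> y" using sub_mono[OF \<omega>, of y q] that by force
    qed
  qed
qed

lemma inverse_nonneg: "AE \<omega> in N. 0 \<le> inverse_subordinator D t \<omega>"
  using inverse_bracket[of t] by (rule AE_mp) auto

text \<open>
  Comparing strict with weak inequalities at nearby levels suffices by right continuity, so nothing
  has to be known about atoms.
\<close>

lemma cdf_le_of_lt:
  fixes X Y :: "'c \<Rightarrow> real"
  assumes [measurable]: "X \<in> borel_measurable N" "Y \<in> borel_measurable N"
    and le: "\<And>q. x < q \<Longrightarrow> prob {\<omega> \<in> space N. X \<omega> < q} \<le> prob {\<omega> \<in> space N. Y \<omega> \<le> q}"
  shows "cdf (distr N borel X) x \<le> cdf (distr N borel Y) x"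
proof -
  interpret Y: real_distribution "distr N borel Y"
    by (intro real_distribution.intro prob_space_distr) (auto simp: real_distribution_axioms_def)
  have cdf: "cdf (distr N borel Z) q = prob {\<omega> \<in> space N. Z \<omega> \<le> q}" if [measurable]: "Z \<in> borel_measurable N" for Z q
    unfolding cdf_def by (subst measure_distr) (auto intro!: arg_cong[where f = prob])
  have "cdf (distr N borel X) x \<le> cdf (distr N borel Y) q" if "x < q" for q
  proof -
    have "prob {\<omega> \<in> space N. X \<omega> \<le> x} \<le> prob {\<omega> \<in> space N. X \<omega> < q}"
      using that by (intro finite_measure_mono) auto
    then show ?thesis using le[OF that] by (simp add: cdf)
  qed
  then have "\<forall>\<^sub>F q in at_right x. cdf (distr N borel X) x \<le> cdf (distr N borel Y) q"
    by (auto intro: eventually_mono[OF eventually_at_right_less])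
  moreover have "(cdf (distr N borel Y) \<longlongrightarrow> cdf (distr N borel Y) x) (at_right x)"
    using Y.finite_borel_measure_M finite_borel_measure.cdf_is_right_cont
    by (auto simp: continuous_within)
  ultimately show ?thesis
    by (intro tendsto_lowerbound[where F = "at_right x"]) auto
qed

text \<open>For q > 0 the event t < D q lies, up to null sets, between the events H < q and H <= q
  for the hitting time H. By scaling it has the probability of (t / D 1)^\<alpha> < q. Applying
  \<open>cdf_le_of_lt\<close> in both directions equates the distribution functions.\<close>

lemma inverse_law:
  assumes t: "0 \<le> t"
  shows "distr N borel (inverse_subordinator D t) = distr N borel (\<lambda>\<omega>. (t / D 1 \<omega>) powr \<alpha>)"
proof (rule cdf_unique)
  let ?H = "inverse_subordinator D t" and ?W = "\<lambda>\<omega>. (t / D 1 \<omega>) powr \<alpha>"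
  show r: "real_distribution (distr N borel ?H)" "real_distribution (distr N borel ?W)"
    by (intro real_distribution.intro prob_space_distr; simp add: real_distribution_axioms_def)+
  have mid: "prob {\<omega> \<in> space N. t < D q \<omega>} = prob {\<omega> \<in> space N. ?W \<omega> < q}" if q: "0 < q" for q
  proof -
    have [measurable]: "D q \<in> borel_measurable N" using q by (intro sub_measurable) simp
    have "prob {\<omega> \<in> space N. t < D q \<omega>} = measure (distr N borel (D q)) {t<..}"
      by (subst measure_distr) (auto intro!: arg_cong[where f = prob])
    also have "\<dots> = prob {\<omega> \<in> space N. t < q powr (1 / \<alpha>) * D 1 \<omega>}"
      unfolding sub_scaling[OF q] by (subst measure_distr) (auto intro!: arg_cong[where f = prob])
    also have "\<dots> = prob {\<omega> \<in> space N. ?W \<omega> < q}"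
    proof (rule finite_measure_eq_AE)
      show "AE \<omega> in N. (\<omega> \<in> {\<omega> \<in> space N. t < q powr (1 / \<alpha>) * D 1 \<omega>}) = (\<omega> \<in> {\<omega> \<in> space N. ?W \<omega> < q})"
        using sub_pos[of 1, simplified]
      proof eventually_elim
        case (elim \<omega>)
        have "t < q powr (1 / \<alpha>) * D 1 \<omega> \<longleftrightarrow> t / D 1 \<omega> < q powr (1 / \<alpha>)"
          using elim by (simp add: pos_divide_less_eq)
        also have "\<dots> \<longleftrightarrow> (t / D 1 \<omega>) powr \<alpha> < (q powr (1 / \<alpha>)) powr \<alpha>"
          using \<alpha> t elim powr_less_mono2[of \<alpha> "t / D 1 \<omega>" "q powr (1 / \<alpha>)"]
            powr_mono2[of \<alpha> "q powr (1 / \<alpha>)" "t / D 1 \<omega>"]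
            divide_nonneg_pos[OF t elim] by (auto simp: not_less[symmetric])
        also have "(q powr (1 / \<alpha>)) powr \<alpha> = q" using \<alpha> q by (simp add: powr_powr)
        finally show ?case by simp
      qed
    qed measurable
    finally show ?thesis .
  qed
  show "cdf (distr N borel ?H) = cdf (distr N borel ?W)"
  proof
    fix x
    show "cdf (distr N borel ?H) x = cdf (distr N borel ?W) x"
    proof (cases "0 \<le> x")
      case True
      have "prob {\<omega> \<in> space N. ?H \<omega> < q} \<le> prob {\<omega> \<in> space N. ?W \<omega> \<le> q}" if "x < q" for q
      proof -
        have q: "0 < q" using that True by simp
        then have [measurable]: "D q \<in> borel_measurable N" by (intro sub_measurable) simp
        have "prob {\<omega> \<in> space N. ?H \<omega> < q} \<le> prob {\<omega> \<in> space N. t < D q \<omega>}"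
        proof (rule finite_measure_mono_AE)
          show "AE \<omega> in N. \<omega> \<in> {\<omega> \<in> space N. ?H \<omega> < q} \<longrightarrow> \<omega> \<in> {\<omega> \<in> space N. t < D q \<omega>}"
            using inverse_bracket[of t]
          proof eventually_elim
            case (elim \<omega>)
            then have "D q \<omega> \<le> t \<longrightarrow> q \<le> ?H \<omega>" using q by simp
            then show ?case by auto
          qed
        qed measurable
        also have "\<dots> \<le> prob {\<omega> \<in> space N. ?W \<omega> \<le> q}"
          unfolding mid[OF q] by (intro finite_measure_mono) auto
        finally show ?thesis .
      qed
      moreover have "prob {\<omega> \<in> space N. ?W \<omega> < q} \<le> prob {\<omega> \<in> space N. ?H \<omega> \<le> q}" if "x < q" for q
      proof -
        have q: "0 < q" using that True by simp
        show ?thesis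
          unfolding mid[OF q, symmetric]
        proof (rule finite_measure_mono_AE)
          show "AE \<omega> in N. \<omega> \<in> {\<omega> \<in> space N. t < D q \<omega>} \<longrightarrow> \<omega> \<in> {\<omega> \<in> space N. ?H \<omega> \<le> q}"
            using inverse_bracket[of t]
          proof eventually_elim
            case (elim \<omega>)
            then have "q < ?H \<omega> \<longrightarrow> D q \<omega> \<le> t" using q by simp
            then show ?case by auto
          qed
        qed measurable
      qed
      ultimately show ?thesis by (intro antisym cdf_le_of_lt) auto
    next
      case False
      have "cdf (distr N borel Z) x = 0" if [measurable]: "Z \<in> borel_measurable N" and "AE \<omega> in N. 0 \<le> Z \<omega>" for Z
      proof -
        have "cdf (distr N borel Z) x = prob {\<omega> \<in> space N. Z \<omega> \<le> x}"
          unfolding cdf_def by (subst measure_distr) (auto intro!: arg_cong[where f = prob])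
        also have "\<dots> = prob {}"
          by (rule finite_measure_eq_AE, use \<open>AE \<omega> in N. 0 \<le> Z \<omega>\<close> in eventually_elim) (use False in auto)
        finally show ?thesis by simp
      qed
      then show ?thesis using inverse_nonneg[of t] by simp
    qed
  qed
qed

text \<open>For z > 0, Gamma(a) z^(-a) is the integral of s^(a - 1) exp(-s z) over s > 0. Tonelli
  inserts the Laplace transform exp(-s^\<alpha>), and the substitution u = s^\<alpha> leaves
  Gamma(k) / \<alpha>.\<close>

lemma sub_moment:
  assumes k: "k \<noteq> 0"
  shows "(\<integral>\<^sup>+\<omega>. ennreal (D 1 \<omega> powr (- (real k * \<alpha>))) \<partial>N) = ennreal (fact k / Gamma (real k * \<alpha> + 1))"
proof -
  define a where "a = real k * \<alpha>"
  have a: "a > 0" using k \<alpha> by (simp add: a_def)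
  have Ga: "Gamma a > 0" by (rule Gamma_real_pos[OF a])
  have G: "(\<integral>\<^sup>+u\<in>{0<..}. ennreal (u powr (b - 1) * exp (- u)) \<partial>lborel) = ennreal (Gamma b)" if b: "b > 0" for b :: real
  proof -
    have "(\<integral>\<^sup>+u. ennreal (u powr (b - 1) / exp u) * indicator {0..} u \<partial>lborel) = ennreal (Gamma b)"
      by (rule nn_integral_has_integral_lebesgue'[OF _ Gamma_integral_real[OF b]]) simp
    moreover have "(\<integral>\<^sup>+u. ennreal (u powr (b - 1) / exp u) * indicator {0..} u \<partial>lborel) =
        (\<integral>\<^sup>+u\<in>{0<..}. ennreal (u powr (b - 1) * exp (- u)) \<partial>lborel)"
      by (intro nn_integral_cong) (auto simp: indicator_def exp_minus divide_inverse)
    ultimately show ?thesis by simp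
  qed
  have inner: "(\<integral>\<^sup>+s\<in>{0<..}. ennreal (s powr (a - 1) * exp (- s * z)) \<partial>lborel) = ennreal (Gamma a) * ennreal (z powr (- a))"
    if z: "z > 0" for z :: real
  proof -
    have "(\<integral>\<^sup>+s\<in>{0<..}. ennreal (s powr (a - 1) * exp (- s * z)) \<partial>lborel) =
      (\<integral>\<^sup>+x\<in>{0<..}. ennreal (inverse z * \<bar>1\<bar> * x powr (1 - 1)) * ennreal ((inverse z * x powr 1) powr (a - 1) * exp (- (inverse z * x powr 1) * z)) \<partial>lborel)"
      by (rule nn_integral_powr_substitution) (use z in auto)
    also have "\<dots> = (\<integral>\<^sup>+x. ennreal (z powr (- a)) * (ennreal (x powr (a - 1) * exp (- x)) * indicator {0<..} x) \<partial>lborel)"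
      using z by (intro nn_integral_cong)
        (auto simp: indicator_def powr_mult powr_minus powr_diff inverse_powr powr_divide field_simps simp flip: ennreal_mult)
    also have "\<dots> = ennreal (z powr (- a)) * ennreal (Gamma a)"
      by (subst nn_integral_cmult) (auto simp: G[OF a])
    finally show ?thesis by (simp add: mult.commute)
  qed
  have "ennreal (Gamma a) * (\<integral>\<^sup>+\<omega>. ennreal (D 1 \<omega> powr (- a)) \<partial>N) =
      (\<integral>\<^sup>+\<omega>. ennreal (Gamma a) * ennreal (D 1 \<omega> powr (- a)) \<partial>N)"
    by (rule nn_integral_cmult[symmetric]) measurable
  also have "\<dots> = (\<integral>\<^sup>+\<omega>. \<integral>\<^sup>+s. ennreal (s powr (a - 1) * exp (- s * D 1 \<omega>)) * indicator {0<..} s \<partial>lborel \<partial>N)"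
    by (rule nn_integral_cong_AE, use sub_pos[of 1, simplified] in eventually_elim) (rule inner[symmetric])
  also have "\<dots> = (\<integral>\<^sup>+s. \<integral>\<^sup>+\<omega>. ennreal (s powr (a - 1) * exp (- s * D 1 \<omega>)) * indicator {0<..} s \<partial>N \<partial>lborel)"
    by (rule pair_sigma_finite.Fubini'[symmetric])
      (auto intro!: pair_sigma_finite.intro sigma_finite_lborel simp: sigma_finite_measure_axioms)
  also have "\<dots> = (\<integral>\<^sup>+s. ennreal (s powr (a - 1) * exp (- (s powr \<alpha>))) * indicator {0<..} s \<partial>lborel)"
  proof (rule nn_integral_cong)
    fix s :: real
    show "(\<integral>\<^sup>+\<omega>. ennreal (s powr (a - 1) * exp (- s * D 1 \<omega>)) * indicator {0<..} s \<partial>N) =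
      ennreal (s powr (a - 1) * exp (- (s powr \<alpha>))) * indicator {0<..} s"
    proof (cases "s > 0")
      case True
      have "(\<integral>\<^sup>+\<omega>. ennreal (s powr (a - 1) * exp (- s * D 1 \<omega>)) \<partial>N) =
        ennreal (\<integral>\<omega>. s powr (a - 1) * exp (- s * D 1 \<omega>) \<partial>N)"
        using sub_exp_integrable[of 1 s] True by (intro nn_integral_eq_integral) auto
      then show ?thesis using True sub_laplace[of 1 s] by simp
    qed simp
  qed
  \<comment> \<open>The integrand is brought literally into the form that
    \<open>nn_integral_powr_substitution\<close> produces for c = 1 and p = \<alpha>.\<close>
  also have "\<dots> = (\<integral>\<^sup>+s. ennreal (1 / \<alpha>) * (ennreal (1 * \<bar>\<alpha>\<bar> * s powr (\<alpha> - 1)) * ennreal ((1 * s powr \<alpha>) powr (real k - 1) * exp (- (1 * s powr \<alpha>))) * indicator {0<..} s) \<partial>lborel)"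
  proof (rule nn_integral_cong)
    fix s :: real
    have "s powr (a - 1) = 1 / \<alpha> * (\<alpha> * s powr (\<alpha> - 1) * (s powr \<alpha>) powr (real k - 1))" if "s > 0"
      using \<alpha> that by (simp add: powr_powr a_def algebra_simps flip: powr_add)
    then show "ennreal (s powr (a - 1) * exp (- (s powr \<alpha>))) * indicator {0<..} s =
      ennreal (1 / \<alpha>) * (ennreal (1 * \<bar>\<alpha>\<bar> * s powr (\<alpha> - 1)) * ennreal ((1 * s powr \<alpha>) powr (real k - 1) * exp (- (1 * s powr \<alpha>))) * indicator {0<..} s)"
      using \<alpha> by (auto simp: indicator_def mult.assoc simp flip: ennreal_mult)
  qed
  also have "\<dots> = ennreal (1 / \<alpha>) * (\<integral>\<^sup>+s\<in>{0<..}. ennreal (1 * \<bar>\<alpha>\<bar> * s powr (\<alpha> - 1)) * ennreal ((1 * s powr \<alpha>) powr (real k - 1) * exp (- (1 * s powr \<alpha>))) \<partial>lborel)"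
    by (rule nn_integral_cmult) measurable
  also have "(\<integral>\<^sup>+s\<in>{0<..}. ennreal (1 * \<bar>\<alpha>\<bar> * s powr (\<alpha> - 1)) * ennreal ((1 * s powr \<alpha>) powr (real k - 1) * exp (- (1 * s powr \<alpha>))) \<partial>lborel) = 
     (\<integral>\<^sup>+u\<in>{0<..}. ennreal (u powr (real k - 1) * exp (- u)) \<partial>lborel)"
    by (rule nn_integral_powr_substitution[symmetric]) (use \<alpha> in auto)
  also have "\<dots> = ennreal (Gamma (real k))" using k by (intro G) simp
  finally have *: "ennreal (Gamma a) * (\<integral>\<^sup>+\<omega>. ennreal (D 1 \<omega> powr (- a)) \<partial>N) = ennreal (Gamma (real k) / \<alpha>)"
    using \<alpha> k by (simp flip: ennreal_mult add: Gamma_real_nonneg)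
  have "(\<integral>\<^sup>+\<omega>. ennreal (D 1 \<omega> powr (- a)) \<partial>N) = ennreal (1 / Gamma a) * (ennreal (Gamma a) * (\<integral>\<^sup>+\<omega>. ennreal (D 1 \<omega> powr (- a)) \<partial>N))"
    using Ga by (simp flip: mult.assoc ennreal_mult)
  also have "\<dots> = ennreal (Gamma (real k) / (\<alpha> * Gamma a))"
    unfolding * using Ga \<alpha> k by (simp flip: ennreal_mult add: Gamma_real_nonneg)
  also have "Gamma (real k) / (\<alpha> * Gamma a) = fact k / Gamma (a + 1)"
  proof -
    have "Gamma (a + 1) = a * Gamma a" using a by (intro Gamma_plus1) (auto elim!: nonpos_Ints_cases)
    moreover have "fact k = real k * Gamma (real k)"
    proof -
      have "real k \<notin> \<int>\<^sub>\<le>\<^sub>0" using k by (auto elim!: nonpos_Ints_cases)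
      then show ?thesis using Gamma_fact[of k, where 'a = real] Gamma_plus1[of "real k"]
        by (simp add: add.commute)
    qed
    ultimately show ?thesis using k Ga \<alpha> by (simp add: a_def field_simps)
  qed
  finally show ?thesis by (simp add: a_def)
qed

text \<open>The coefficients of the Mittag-Leffler function of s t^\<alpha>. The outer
  natural-number power gives 1 at k = 0 and t = 0 too, where a real power of t would give 0.\<close>

definition inv_term :: "nat \<Rightarrow> real \<Rightarrow> real" where
  "inv_term k t = (t powr \<alpha>) ^ k / Gamma (real k * \<alpha> + 1)"

text \<open>The k-th moment of (t / D 1)^\<alpha> is k! times \<open>inv_term k t\<close>, so the
  factorials of the exponential series cancel. The convergent series at |s| justifies exchanging sum
  and expectation.\<close>

lemma inverse_mgf:
  assumes t: "0 \<le> t"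
  shows "(\<integral>\<omega>. exp (s * inverse_subordinator D t \<omega>) \<partial>N) = (\<Sum>k. s ^ k * inv_term k t)"
proof -
  let ?W = "\<lambda>\<omega>. (t / D 1 \<omega>) powr \<alpha>"
  have Wk: "(\<integral>\<^sup>+\<omega>. ennreal (?W \<omega> ^ k) \<partial>N) = ennreal (fact k * inv_term k t)" for k
  proof (cases "k = 0")
    case True
    then show ?thesis by (simp add: inv_term_def emeasure_space_1)
  next
    case False
    have "(\<integral>\<^sup>+\<omega>. ennreal (?W \<omega> ^ k) \<partial>N) = (\<integral>\<^sup>+\<omega>. ennreal ((t powr \<alpha>) ^ k) * ennreal (D 1 \<omega> powr (- (real k * \<alpha>))) \<partial>N)"
    proof (rule nn_integral_cong_AE, use sub_pos[of 1, simplified] in eventually_elim)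
      fix \<omega> assume z: "0 < D 1 \<omega>"
      have "?W \<omega> = t powr \<alpha> * D 1 \<omega> powr (- \<alpha>)"
        using z t by (simp add: powr_divide powr_minus_divide)
      then have "?W \<omega> ^ k = (t powr \<alpha>) ^ k * (D 1 \<omega> powr (- \<alpha>)) ^ k"
        by (simp add: power_mult_distrib)
      also have "(D 1 \<omega> powr (- \<alpha>)) ^ k = D 1 \<omega> powr (- (real k * \<alpha>))"
        using z by (simp add: powr_powr mult.commute flip: powr_realpow)
      finally show "ennreal (?W \<omega> ^ k) = ennreal ((t powr \<alpha>) ^ k) * ennreal (D 1 \<omega> powr (- (real k * \<alpha>)))"
        by (simp flip: ennreal_mult)
    qed
    also have "\<dots> = ennreal ((t powr \<alpha>) ^ k) * ennreal (fact k / Gamma (real k * \<alpha> + 1))"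
      by (subst nn_integral_cmult) (auto simp: sub_moment[OF False])
    also have "\<dots> = ennreal (fact k * inv_term k t)"
    proof -
      have "Gamma (real k * \<alpha> + 1) \<ge> 0"
        using \<alpha> by (intro Gamma_real_nonneg) (simp add: add_nonneg_pos)
      then show ?thesis by (subst ennreal_mult[symmetric]) (auto simp: inv_term_def)
    qed
    finally show ?thesis .
  qed
  have nn: "inv_term k t \<ge> 0" for k
    unfolding inv_term_def using \<alpha> by (intro divide_nonneg_nonneg Gamma_real_nonneg) (auto simp: add_nonneg_pos)
  have W0: "?W \<omega> \<ge> 0" for \<omega> by simp
  have int: "integrable N (\<lambda>\<omega>. ?W \<omega> ^ k)" for k
    by (rule integrableI_nonneg) (auto simp: Wk)
  have val: "(\<integral>\<omega>. ?W \<omega> ^ k \<partial>N) = fact k * inv_term k t" for k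
    by (subst integral_eq_nn_integral) (auto simp: Wk nn)
  define f where "f k \<omega> = s ^ k / fact k * ?W \<omega> ^ k" for k \<omega>
  have fi: "integrable N (f k)" for k
  proof -
    have "f k = (\<lambda>\<omega>. s ^ k / fact k * ?W \<omega> ^ k)" by (simp add: f_def fun_eq_iff)
    then show ?thesis using int[of k] by simp
  qed
  have fv: "integral\<^sup>L N (f k) = s ^ k * inv_term k t" for k
  proof -
    have "f k = (\<lambda>\<omega>. s ^ k / fact k * ?W \<omega> ^ k)" by (simp add: f_def fun_eq_iff)
    then show ?thesis using val[of k] by simp
  qed
  have fn: "(\<integral>\<omega>. norm (f k \<omega>) \<partial>N) = \<bar>s\<bar> ^ k * inv_term k t" for k
  proof -
    have "(\<integral>\<omega>. norm (f k \<omega>) \<partial>N) = (\<integral>\<omega>. \<bar>s\<bar> ^ k / fact k * ?W \<omega> ^ k \<partial>N)"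
      by (rule Bochner_Integration.integral_cong) (auto simp: f_def abs_mult power_abs)
    then show ?thesis using val[of k] by simp
  qed
  have fs: "(\<lambda>k. f k \<omega>) sums exp (s * ?W \<omega>)" for \<omega>
    using exp_converges[of "s * ?W \<omega>"] by (simp add: f_def power_mult_distrib divide_inverse mult_ac)
  have "(\<integral>\<omega>. exp (s * inverse_subordinator D t \<omega>) \<partial>N) = (\<integral>x. exp (s * x) \<partial>distr N borel (inverse_subordinator D t))"
    by (rule integral_distr[symmetric]) measurable
  also have "\<dots> = (\<integral>\<omega>. exp (s * ?W \<omega>) \<partial>N)"
    unfolding inverse_law[OF t] by (rule integral_distr) measurable
  also have "\<dots> = (\<integral>\<omega>. (\<Sum>k. f k \<omega>) \<partial>N)" using fs by (simp add: sums_iff)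
  also have "\<dots> = (\<Sum>k. integral\<^sup>L N (f k))"
  proof (rule integral_suminf[OF fi])
    show "AE \<omega> in N. summable (\<lambda>k. norm (f k \<omega>))"
    proof (rule AE_I2)
      fix \<omega>
      have "(\<lambda>k. norm (f k \<omega>)) = (\<lambda>k. (\<bar>s\<bar> * ?W \<omega>) ^ k /\<^sub>R fact k)"
        by (auto simp: f_def abs_mult power_abs power_mult_distrib divide_inverse mult_ac)
      then show "summable (\<lambda>k. norm (f k \<omega>))"
        using exp_converges[of "\<bar>s\<bar> * ?W \<omega>"] by (simp add: sums_iff)
    qed
    show "summable (\<lambda>k. \<integral>\<omega>. norm (f k \<omega>) \<partial>N)"
      using summable_mittag_leffler[OF \<alpha>, of "\<bar>s\<bar> * t powr \<alpha>"]
      unfolding fn by (simp add: inv_term_def power_mult_distrib)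
  qed
  finally show ?thesis by (simp add: fv)
qed

end

section \<open>Densities\<close>

text \<open>A point of difference would bring a whole interval of positive length on which the
  functions differ.\<close>

lemma continuous_AE_eq:
  fixes f g :: "real \<Rightarrow> real"
  assumes S: "open S" and f: "continuous_on S f" and g: "continuous_on S g"
    and ae: "AE x in lborel. x \<in> S \<longrightarrow> f x = g x" and x: "x \<in> S"
  shows "f x = g x"
proof (rule ccontr)
  assume ne: "f x \<noteq> g x"
  define U where "U = S \<inter> (\<lambda>x. f x - g x) -` (- {0})"
  have "open U" unfolding U_def by (intro continuous_open_preimage S continuous_intros f g)
  moreover have "x \<in> U" using x ne by (simp add: U_def)
  ultimately obtain e where e: "e > 0" "cball x e \<subseteq> U" by (auto simp: open_contains_cball)
  have U: "U \<in> sets lborel" using \<open>open U\<close> by simp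
  have "emeasure lborel U = 0"
    using ae U by (intro AE_iff_measurable[THEN iffD1, OF U, rotated]) (auto simp: U_def)
  moreover have "emeasure lborel {x - e..x + e} \<le> emeasure lborel U"
    using e U by (intro emeasure_mono) (auto simp: cball_eq_atLeastAtMost)
  ultimately show False using e by (simp add: ennreal_eq_0_iff)
qed

context stable_process
begin

lemma pair_N_lborel: "pair_sigma_finite N (lborel :: real measure)" "pair_sigma_finite (lborel :: real measure) N"
  by (intro pair_sigma_finite.intro sigma_finite_lborel sigma_finite_measure_axioms)+

text \<open>Both sides average over Z = D 1 an integral along the curve t = x^(1/\<alpha>) Z,
  parametrized by t on the left and by x on the right. The weight is the Jacobian dt/dx = t / (x
  \<alpha>).\<close>

lemma transposed_density_stable:
  "transposed_density (\<lambda>x t. t / (x * \<alpha>)) (\<lambda>x. distr N borel (D x))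
     (\<lambda>t. distr N borel (inverse_subordinator D t))"
  unfolding transposed_density_def
proof
  fix \<psi> :: "real \<times> real \<Rightarrow> ennreal" assume "\<psi> \<in> borel_measurable borel"
  then have [measurable]: "\<psi> \<in> borel_measurable (borel \<Otimes>\<^sub>M borel)" by (simp add: borel_prod)
  let ?Z = "D 1"
  have "(\<integral>\<^sup>+t\<in>{0<..}. (\<integral>\<^sup>+x. \<psi> (x, t) \<partial>distr N borel (inverse_subordinator D t)) \<partial>lborel) =
    (\<integral>\<^sup>+t. \<integral>\<^sup>+\<omega>. \<psi> ((t / ?Z \<omega>) powr \<alpha>, t) * indicator {0<..} t \<partial>N \<partial>lborel)"
  proof (rule nn_integral_cong)
    fix t :: real
    show "(\<integral>\<^sup>+x. \<psi> (x, t) \<partial>distr N borel (inverse_subordinator D t)) * indicator {0<..} t =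
      (\<integral>\<^sup>+\<omega>. \<psi> ((t / ?Z \<omega>) powr \<alpha>, t) * indicator {0<..} t \<partial>N)"
    proof (cases "t > 0")
      case True
      then have "(\<integral>\<^sup>+x. \<psi> (x, t) \<partial>distr N borel (inverse_subordinator D t)) = (\<integral>\<^sup>+x. \<psi> (x, t) \<partial>distr N borel (\<lambda>\<omega>. (t / ?Z \<omega>) powr \<alpha>))"
        by (subst inverse_law) auto
      also have "\<dots> = (\<integral>\<^sup>+\<omega>. \<psi> ((t / ?Z \<omega>) powr \<alpha>, t) \<partial>N)" by (rule nn_integral_distr) measurable
      finally show ?thesis using True by simp
    qed simp
  qed
  also have "\<dots> = (\<integral>\<^sup>+\<omega>. \<integral>\<^sup>+t. \<psi> ((t / ?Z \<omega>) powr \<alpha>, t) * indicator {0<..} t \<partial>lborel \<partial>N)"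
    by (rule pair_sigma_finite.Fubini'[OF pair_N_lborel(1)]) measurable
  also have "\<dots> = (\<integral>\<^sup>+\<omega>. \<integral>\<^sup>+x. ennreal ((x powr (1 / \<alpha>) * ?Z \<omega>) / (x * \<alpha>)) * \<psi> (x, x powr (1 / \<alpha>) * ?Z \<omega>) * indicator {0<..} x \<partial>lborel \<partial>N)"
  proof (rule nn_integral_cong_AE, use sub_pos[of 1, simplified] in eventually_elim)
    fix \<omega> assume z: "0 < ?Z \<omega>"
    let ?z = "?Z \<omega>"
    have "(\<integral>\<^sup>+t\<in>{0<..}. \<psi> ((t / ?z) powr \<alpha>, t) \<partial>lborel) =
      (\<integral>\<^sup>+x\<in>{0<..}. ennreal (?z * \<bar>1 / \<alpha>\<bar> * x powr (1 / \<alpha> - 1)) * \<psi> ((?z * x powr (1 / \<alpha>) / ?z) powr \<alpha>, ?z * x powr (1 / \<alpha>)) \<partial>lborel)"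
      by (rule nn_integral_powr_substitution) (use z \<alpha> in auto)
    also have "\<dots> = (\<integral>\<^sup>+x. ennreal ((x powr (1 / \<alpha>) * ?z) / (x * \<alpha>)) * \<psi> (x, x powr (1 / \<alpha>) * ?z) * indicator {0<..} x \<partial>lborel)"
    proof (rule nn_integral_cong)
      fix x :: real
      have "(?z * x powr (1 / \<alpha>) / ?z) powr \<alpha> = x" "?z * \<bar>1 / \<alpha>\<bar> * x powr (1 / \<alpha> - 1) = (x powr (1 / \<alpha>) * ?z) / (x * \<alpha>)" if "x > 0"
      proof -
        have "x powr (1 / \<alpha> - 1) = x powr (1 / \<alpha>) / x" using that by (simp add: powr_diff)
        then show "?z * \<bar>1 / \<alpha>\<bar> * x powr (1 / \<alpha> - 1) = (x powr (1 / \<alpha>) * ?z) / (x * \<alpha>)"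
          using \<alpha> by (simp add: mult.commute)
        show "(?z * x powr (1 / \<alpha>) / ?z) powr \<alpha> = x" using that z \<alpha> by (simp add: powr_powr)
      qed
      then show "ennreal (?z * \<bar>1 / \<alpha>\<bar> * x powr (1 / \<alpha> - 1)) * \<psi> ((?z * x powr (1 / \<alpha>) / ?z) powr \<alpha>, ?z * x powr (1 / \<alpha>)) * indicator {0<..} x =
        ennreal ((x powr (1 / \<alpha>) * ?z) / (x * \<alpha>)) * \<psi> (x, x powr (1 / \<alpha>) * ?z) * indicator {0<..} x"
        by (cases "x > 0") (simp_all add: mult.commute[of ?z "x powr (1 / \<alpha>)"])
    qed
    finally show "(\<integral>\<^sup>+t. \<psi> ((t / ?z) powr \<alpha>, t) * indicator {0<..} t \<partial>lborel) =
      (\<integral>\<^sup>+x. ennreal ((x powr (1 / \<alpha>) * ?z) / (x * \<alpha>)) * \<psi> (x, x powr (1 / \<alpha>) * ?z) * indicator {0<..} x \<partial>lborel)" .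
  qed
  also have "\<dots> = (\<integral>\<^sup>+x. \<integral>\<^sup>+\<omega>. ennreal ((x powr (1 / \<alpha>) * ?Z \<omega>) / (x * \<alpha>)) * \<psi> (x, x powr (1 / \<alpha>) * ?Z \<omega>) * indicator {0<..} x \<partial>N \<partial>lborel)"
    by (rule pair_sigma_finite.Fubini'[OF pair_N_lborel(2)]) measurable
  also have "\<dots> = (\<integral>\<^sup>+x\<in>{0<..}. (\<integral>\<^sup>+t. ennreal (t / (x * \<alpha>)) * \<psi> (x, t) \<partial>distr N borel (D x)) \<partial>lborel)"
  proof (rule nn_integral_cong)
    fix x :: real
    show "(\<integral>\<^sup>+\<omega>. ennreal ((x powr (1 / \<alpha>) * ?Z \<omega>) / (x * \<alpha>)) * \<psi> (x, x powr (1 / \<alpha>) * ?Z \<omega>) * indicator {0<..} x \<partial>N) =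
      (\<integral>\<^sup>+t. ennreal (t / (x * \<alpha>)) * \<psi> (x, t) \<partial>distr N borel (D x)) * indicator {0<..} x"
    proof (cases "x > 0")
      case True
      have "(\<integral>\<^sup>+t. ennreal (t / (x * \<alpha>)) * \<psi> (x, t) \<partial>distr N borel (D x)) =
        (\<integral>\<^sup>+t. ennreal (t / (x * \<alpha>)) * \<psi> (x, t) \<partial>distr N borel (\<lambda>\<omega>. x powr (1 / \<alpha>) * ?Z \<omega>))"
        by (subst sub_scaling[OF True]) simp
      also have "\<dots> = (\<integral>\<^sup>+\<omega>. ennreal ((x powr (1 / \<alpha>) * ?Z \<omega>) / (x * \<alpha>)) * \<psi> (x, x powr (1 / \<alpha>) * ?Z \<omega>) \<partial>N)"
        by (rule nn_integral_distr) measurable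
      finally show ?thesis using True by simp
    qed simp
  qed
  finally show "(\<integral>\<^sup>+t\<in>{0<..}. (\<integral>\<^sup>+x. \<psi> (x, t) \<partial>distr N borel (inverse_subordinator D t)) \<partial>lborel) =
    (\<integral>\<^sup>+x\<in>{0<..}. (\<integral>\<^sup>+t. ennreal (t / (x * \<alpha>)) * \<psi> (x, t) \<partial>distr N borel (D x)) \<partial>lborel)" .
qed

end

locale stable_density_process = stable_process +
  fixes g :: "real \<Rightarrow> real \<Rightarrow> real"
  assumes g: "stable_density N D g"
begin

lemma density_measurable [measurable]: "0 < x \<Longrightarrow> (\<lambda>t. ennreal (g t x)) \<in> borel_measurable borel"
  using g by (auto simp: stable_density_def distributed_def)

lemma density_measurable_1 [measurable]: "(\<lambda>t. ennreal (g t 1)) \<in> borel_measurable borel"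
  by (rule density_measurable) simp

lemma density_nonneg: "0 < x \<Longrightarrow> 0 < t \<Longrightarrow> 0 \<le> g t x"
  using g by (auto simp: stable_density_def)

text \<open>Scaling of the laws gives the identity for almost every t, and continuity in t > 0 makes
  it pointwise. It controls how \<open>g t x\<close> depends on x, about which
  \<open>stable_density\<close> says nothing directly.\<close>

lemma density_scaling:
  assumes x: "0 < x" and t: "0 < t"
  shows "g t x = x powr (- 1 / \<alpha>) * g (t * x powr (- 1 / \<alpha>)) 1"
proof -
  define c where "c = x powr (1 / \<alpha>)"
  have c: "c > 0" using x by (simp add: c_def)
  have cinv: "x powr (- 1 / \<alpha>) = inverse c" by (simp add: c_def powr_minus)
  have d1: "distributed N lborel (D 1) (\<lambda>t. ennreal (g t 1))" using g by (simp add: stable_density_def)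
  have dx: "distributed N lborel (D x) (\<lambda>t. ennreal (g t x))" using g x by (simp add: stable_density_def)
  note [measurable] = density_measurable[OF x]
  have "density lborel (\<lambda>t. ennreal (g t x)) = density lborel (\<lambda>s. ennreal (inverse c) * ennreal (g (s * inverse c) 1))"
  proof (rule measure_eqI)
    fix A assume "A \<in> sets (density lborel (\<lambda>t. ennreal (g t x)))"
    then have [measurable]: "A \<in> sets borel" by simp
    have "emeasure (density lborel (\<lambda>t. ennreal (g t x))) A = emeasure (distr N lborel (D x)) A"
      using dx by (simp add: distributed_def)
    also have "distr N lborel (D x) = distr N borel (D x)" by (rule distr_cong) auto
    also have "\<dots> = distr N borel (\<lambda>\<omega>. c * D 1 \<omega>)" unfolding c_def by (rule sub_scaling[OF x])
    also have "emeasure (distr N borel (\<lambda>\<omega>. c * D 1 \<omega>)) A = (\<integral>\<^sup>+y. indicator A y \<partial>distr N borel (\<lambda>\<omega>. c * D 1 \<omega>))"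
      by simp
    also have "\<dots> = (\<integral>\<^sup>+\<omega>. indicator A (c * D 1 \<omega>) \<partial>N)" by (rule nn_integral_distr) measurable
    also have "\<dots> = (\<integral>\<^sup>+s. ennreal (g s 1) * indicator A (c * s) \<partial>lborel)"
      by (rule distributed_nn_integral[OF d1, symmetric]) measurable
    also have "\<dots> = \<bar>inverse c\<bar> * (\<integral>\<^sup>+s. ennreal (g (0 + inverse c * s) 1) * indicator A (c * (0 + inverse c * s)) \<partial>lborel)"
      by (rule nn_integral_real_affine) (use c in auto)
    also have "\<dots> = \<bar>inverse c\<bar> * (\<integral>\<^sup>+s. ennreal (g (s * inverse c) 1) * indicator A s \<partial>lborel)"
    proof -
      have "c * (0 + inverse c * s) = s" "0 + inverse c * s = s * inverse c" for s
        using c by simp_all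
      then show ?thesis by (simp only:)
    qed
    also have "\<dots> = (\<integral>\<^sup>+s. ennreal (inverse c) * (ennreal (g (s * inverse c) 1) * indicator A s) \<partial>lborel)"
      using c by (subst nn_integral_cmult) auto
    also have "\<dots> = emeasure (density lborel (\<lambda>s. ennreal (inverse c) * ennreal (g (s * inverse c) 1))) A"
      by (subst emeasure_density) (auto simp: mult.assoc)
    finally show "emeasure (density lborel (\<lambda>t. ennreal (g t x))) A =
      emeasure (density lborel (\<lambda>s. ennreal (inverse c) * ennreal (g (s * inverse c) 1))) A" .
  qed simp
  then have "AE s in lborel. ennreal (g s x) = ennreal (inverse c) * ennreal (g (s * inverse c) 1)"
    by (subst (asm) sigma_finite_measure.density_unique_iff[OF sigma_finite_lborel]) auto
  then have "AE s in lborel. s \<in> {0<..} \<longrightarrow> g s x = inverse c * g (s * inverse c) 1"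
  proof eventually_elim
    case (elim s)
    show ?case
    proof
      assume "s \<in> {0<..}"
      then have s: "s > 0" by simp
      have n: "0 \<le> g s x" "0 \<le> g (s * inverse c) 1" using s x c by (auto intro!: density_nonneg)
      then have "ennreal (g s x) = ennreal (inverse c * g (s * inverse c) 1)"
        using elim c by (simp add: ennreal_mult)
      then show "g s x = inverse c * g (s * inverse c) 1" using n c by simp
    qed
  qed
  moreover have "continuous_on {0<..} (\<lambda>s. g s x)" using g x by (simp add: stable_density_def)
  moreover have "continuous_on {0<..} (\<lambda>s. inverse c * g (s * inverse c) 1)"
  proof -
    have "continuous_on {0<..} (\<lambda>s. g s 1)" using g by (simp add: stable_density_def)
    then have "continuous_on {0<..} (\<lambda>s. g (s * inverse c) 1)"
      by (rule continuous_on_compose2) (use c in \<open>auto intro!: continuous_intros\<close>)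
    then show ?thesis by (intro continuous_intros)
  qed
  ultimately have "g t x = inverse c * g (t * inverse c) 1"
    using continuous_AE_eq[of "{0<..}" "\<lambda>s. g s x" "\<lambda>s. inverse c * g (s * inverse c) 1" t] t by auto
  then show ?thesis unfolding cinv .
qed

text \<open>The density of the hitting time rewritten through \<open>g\<close> at x = 1 alone, which
  makes it jointly measurable in x and y as Tonelli requires. \<open>ennreal\<close> is applied to
  \<open>g\<close> because \<open>distributed\<close> asserts measurability of that composition
  only.\<close>

definition inv_dens :: "real \<Rightarrow> real \<Rightarrow> ennreal" where
  "inv_dens x y = (if 0 < x \<and> 0 < y
     then ennreal (y / (x * \<alpha>) * x powr (- 1 / \<alpha>)) * ennreal (g (y * x powr (- 1 / \<alpha>)) 1) else 0)"

lemma inv_dens_measurable [measurable]: "(\<lambda>(x, y). inv_dens x y) \<in> borel_measurable (borel \<Otimes>\<^sub>M borel)"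
  unfolding inv_dens_def by measurable

lemma inv_dens_eq:
  assumes "0 \<le> y"
  shows "inv_dens x y = ennreal (inverse_density \<alpha> g x y)"
proof (cases "0 < x \<and> 0 < y")
  case True
  then have "0 \<le> g (y * x powr (- 1 / \<alpha>)) 1" by (intro density_nonneg) auto
  then show ?thesis
    using True \<alpha> by (simp add: inv_dens_def inverse_density_def density_scaling[of x y] mult.assoc flip: ennreal_mult)
qed (use assms in \<open>auto simp: inv_dens_def inverse_density_def\<close>)

lemma inverse_density_nonneg: "0 \<le> y \<Longrightarrow> 0 \<le> inverse_density \<alpha> g x y"
  using \<alpha> density_nonneg[of x y] by (cases "y = 0") (auto simp: inverse_density_def)

text \<open>Substituting z = t x^(-1/\<alpha>) in the law of (t / D 1)^\<alpha> produces t / (x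
  \<alpha>) times x^(-1/\<alpha>). The last factor turns \<open>g\<close> at 1 into \<open>g\<close>
  at x by \<open>density_scaling\<close>.\<close>

lemma inverse_distributed:
  assumes t: "0 < t"
  shows "distributed N lborel (inverse_subordinator D t) (\<lambda>x. ennreal (inverse_density \<alpha> g x t))"
proof -
  have d1: "distributed N lborel (D 1) (\<lambda>t. ennreal (g t 1))" using g by (simp add: stable_density_def)
  have eq: "(\<lambda>x. ennreal (inverse_density \<alpha> g x t)) = (\<lambda>x. inv_dens x t)"
    using t by (simp add: inv_dens_eq)
  have "distr N lborel (inverse_subordinator D t) = density lborel (\<lambda>x. inv_dens x t)"
  proof (rule measure_eqI)
    fix A assume "A \<in> sets (distr N lborel (inverse_subordinator D t))"
    then have [measurable]: "A \<in> sets borel" by simp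
    have "distr N lborel (inverse_subordinator D t) = distr N borel (inverse_subordinator D t)" by (rule distr_cong) auto
    then have "emeasure (distr N lborel (inverse_subordinator D t)) A =
      (\<integral>\<^sup>+y. indicator A y \<partial>distr N borel (\<lambda>\<omega>. (t / D 1 \<omega>) powr \<alpha>))"
      using t by (simp add: inverse_law)
    also have "\<dots> = (\<integral>\<^sup>+\<omega>. indicator A ((t / D 1 \<omega>) powr \<alpha>) \<partial>N)" by (rule nn_integral_distr) measurable
    also have "\<dots> = (\<integral>\<^sup>+\<omega>. indicator A ((t / D 1 \<omega>) powr \<alpha>) * indicator {0<..} (D 1 \<omega>) \<partial>N)"
      by (rule nn_integral_cong_AE, use sub_pos[of 1, simplified] in eventually_elim) simp
    also have "\<dots> = (\<integral>\<^sup>+z. ennreal (g z 1) * (indicator A ((t / z) powr \<alpha>) * indicator {0<..} z) \<partial>lborel)"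
      by (rule distributed_nn_integral[OF d1, symmetric]) measurable
    also have "\<dots> = (\<integral>\<^sup>+z\<in>{0<..}. (ennreal (g z 1) * indicator A ((t / z) powr \<alpha>)) \<partial>lborel)"
      by (simp add: mult.assoc)
    also have "\<dots> = (\<integral>\<^sup>+x\<in>{0<..}. ennreal (t * \<bar>- 1 / \<alpha>\<bar> * x powr (- 1 / \<alpha> - 1)) *
       (ennreal (g (t * x powr (- 1 / \<alpha>)) 1) * indicator A ((t / (t * x powr (- 1 / \<alpha>))) powr \<alpha>)) \<partial>lborel)"
      by (rule nn_integral_powr_substitution) (use t \<alpha> in auto)
    also have "\<dots> = (\<integral>\<^sup>+x. inv_dens x t * indicator A x \<partial>lborel)"
    proof (rule nn_integral_cong)
      fix x :: real
      show "ennreal (t * \<bar>- 1 / \<alpha>\<bar> * x powr (- 1 / \<alpha> - 1)) *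
       (ennreal (g (t * x powr (- 1 / \<alpha>)) 1) * indicator A ((t / (t * x powr (- 1 / \<alpha>))) powr \<alpha>)) * indicator {0<..} x =
        inv_dens x t * indicator A x"
      proof (cases "0 < x")
        case True
        have 1: "(t / (t * x powr (- 1 / \<alpha>))) powr \<alpha> = x"
          using True t \<alpha> by (simp add: powr_divide powr_powr powr_minus_divide)
        have 2: "t * \<bar>- 1 / \<alpha>\<bar> * x powr (- 1 / \<alpha> - 1) = t / (x * \<alpha>) * x powr (- 1 / \<alpha>)"
          using True \<alpha> by (simp add: powr_diff)
        show ?thesis unfolding 1 2 using True t by (simp add: inv_dens_def mult.assoc)
      qed (simp add: inv_dens_def)
    qed
    also have "\<dots> = emeasure (density lborel (\<lambda>x. inv_dens x t)) A"
      by (subst emeasure_density) auto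
    finally show "emeasure (distr N lborel (inverse_subordinator D t)) A = emeasure (density lborel (\<lambda>x. inv_dens x t)) A" .
  qed simp
  then show ?thesis unfolding distributed_def eq by auto
qed

text \<open>On [0, t] the factor y / (x \<alpha>) is at most t / (x \<alpha>), and \<open>g\<close>
  has total mass 1 in its first argument.\<close>

lemma inverse_density_integrable:
  assumes x: "0 < x" and lam: "0 \<le> lam" and t: "0 \<le> t"
  shows "set_integrable lborel {0..t} (\<lambda>y. exp (- lam * y) * inverse_density \<alpha> g x y)"
  unfolding set_integrable_def
proof (rule integrableI_nonneg)
  have dx: "distributed N lborel (D x) (\<lambda>t. ennreal (g t x))" using g x by (simp add: stable_density_def)
  note [measurable] = density_measurable[OF x]
  \<comment> \<open>Only \<open>ennreal (g y x)\<close> is known to be measurable, so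
    \<open>g\<close> is recovered through \<open>enn2real\<close>. For y <= 0, where
    \<open>g\<close> may be negative, the indicator or the factor y removes the difference.\<close>
  have "(\<lambda>y. indicator {0..t} y *\<^sub>R (exp (- lam * y) * inverse_density \<alpha> g x y)) =
    (\<lambda>y. indicator {0..t} y * (exp (- lam * y) * (y / (x * \<alpha>) * enn2real (ennreal (g y x)))))"
  proof
    fix y
    show "indicator {0..t} y *\<^sub>R (exp (- lam * y) * inverse_density \<alpha> g x y) =
      indicator {0..t} y * (exp (- lam * y) * (y / (x * \<alpha>) * enn2real (ennreal (g y x))))"
      using x density_nonneg[OF x, of y]
      by (cases "y = 0") (auto simp: inverse_density_def indicator_def)
  qed
  also have "\<dots> \<in> borel_measurable lborel" by measurable
  finally show "(\<lambda>y. indicator {0..t} y *\<^sub>R (exp (- lam * y) * inverse_density \<alpha> g x y)) \<in> borel_measurable lborel" .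
  show "AE y in lborel. 0 \<le> indicator {0..t} y *\<^sub>R (exp (- lam * y) * inverse_density \<alpha> g x y)"
    by (rule AE_I2) (auto simp: indicator_def inverse_density_nonneg)
  have "(\<integral>\<^sup>+y. ennreal (indicator {0..t} y *\<^sub>R (exp (- lam * y) * inverse_density \<alpha> g x y)) \<partial>lborel)
    \<le> (\<integral>\<^sup>+y. ennreal (t / (x * \<alpha>)) * ennreal (g y x) \<partial>lborel)"
  proof (rule nn_integral_mono)
    fix y :: real
    show "ennreal (indicator {0..t} y *\<^sub>R (exp (- lam * y) * inverse_density \<alpha> g x y)) \<le> ennreal (t / (x * \<alpha>)) * ennreal (g y x)"
    proof (cases "0 < y \<and> y \<le> t")
      case True
      then have n: "0 \<le> g y x" using x by (intro density_nonneg) auto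
      have "exp (- lam * y) * (y / (x * \<alpha>) * g y x) \<le> 1 * (t / (x * \<alpha>) * g y x)"
        using True n x \<alpha> lam by (intro mult_mono divide_right_mono) auto
      then have "ennreal (exp (- lam * y) * (y / (x * \<alpha>) * g y x)) \<le> ennreal (t / (x * \<alpha>) * g y x)"
        by (intro ennreal_leI) simp
      also have "\<dots> = ennreal (t / (x * \<alpha>)) * ennreal (g y x)"
        using True n x \<alpha> by (intro ennreal_mult) auto
      finally show ?thesis using True x by (simp add: inverse_density_def)
    qed (auto simp: indicator_def inverse_density_def)
  qed
  also have "\<dots> = ennreal (t / (x * \<alpha>)) * (\<integral>\<^sup>+y. ennreal (g y x) \<partial>lborel)"
    by (rule nn_integral_cmult) measurable
  also have "(\<integral>\<^sup>+y. ennreal (g y x) \<partial>lborel) = 1"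
    using distributed_nn_integral[OF dx, of "\<lambda>_. 1"] by (simp add: emeasure_space_1)
  finally show "(\<integral>\<^sup>+y. ennreal (indicator {0..t} y *\<^sub>R (exp (- lam * y) * inverse_density \<alpha> g x y)) \<partial>lborel) < \<infinity>"
    by (auto simp: top_unique less_top[symmetric])
qed

text \<open>Tonelli computes the Laplace transform of the candidate density from those of the
  hitting times, and \<open>laplace_uniqueness\<close> identifies the law.\<close>

lemma mixture_distributed:
  fixes P :: "'d measure"
  assumes lam: "0 \<le> lam" and t: "0 < t" and P: "prob_space P"
    and X [measurable]: "X \<in> borel_measurable P" and X0: "AE \<omega> in P. 0 \<le> X \<omega>"
    and int: "\<And>i. set_integrable lborel {0..t} (\<lambda>y. exp (- lam * y) * (\<integral>\<omega>. exp (- real i * inverse_subordinator D y \<omega>) \<partial>N))"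
    and lap: "\<And>i. (\<integral>\<omega>. exp (- real i * X \<omega>) \<partial>P) =
      exp (- lam * t) * (\<integral>\<omega>. exp (- real i * inverse_subordinator D t \<omega>) \<partial>N) +
      lam * (LBINT y:{0..t}. exp (- lam * y) * (\<integral>\<omega>. exp (- real i * inverse_subordinator D y \<omega>) \<partial>N))"
  shows "distributed P lborel X (\<lambda>x. ennreal (exp (- lam * t) * inverse_density \<alpha> g x t +
    lam * (LBINT y:{0..t}. exp (- lam * y) * inverse_density \<alpha> g x y)))"
proof -
  interpret P: prob_space P by fact
  let ?H = "inverse_subordinator D"
  let ?\<rho>r = "\<lambda>x. exp (- lam * t) * inverse_density \<alpha> g x t +
    lam * (LBINT y:{0..t}. exp (- lam * y) * inverse_density \<alpha> g x y)"
  \<comment> \<open>The same density with values in \<open>ennreal\<close>, built from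
    \<open>inv_dens\<close> so that it is measurable and Tonelli applies.\<close>
  define \<rho> where "\<rho> x = ennreal (exp (- lam * t)) * inv_dens x t +
    ennreal lam * (\<integral>\<^sup>+y. ennreal (exp (- lam * y)) * inv_dens x y * indicator {0..t} y \<partial>lborel)" for x
  have LI: "ennreal (LBINT y:{0..t}. exp (- lam * y) * inverse_density \<alpha> g x y) =
    (\<integral>\<^sup>+y. ennreal (exp (- lam * y)) * inv_dens x y * indicator {0..t} y \<partial>lborel)" for x
  proof (cases "0 < x")
    case True
    have "ennreal (LBINT y:{0..t}. exp (- lam * y) * inverse_density \<alpha> g x y) =
      (\<integral>\<^sup>+y. ennreal (indicator {0..t} y *\<^sub>R (exp (- lam * y) * inverse_density \<alpha> g x y)) \<partial>lborel)"
      unfolding set_lebesgue_integral_def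
      by (rule nn_integral_eq_integral[symmetric])
        (use inverse_density_integrable[OF True lam, of t] t in \<open>auto simp: set_integrable_def indicator_def inverse_density_nonneg\<close>)
    also have "\<dots> = (\<integral>\<^sup>+y. ennreal (exp (- lam * y)) * inv_dens x y * indicator {0..t} y \<partial>lborel)"
      by (intro nn_integral_cong) (auto simp: indicator_def inv_dens_eq inverse_density_nonneg ennreal_mult)
    finally show ?thesis .
  qed (simp add: inverse_density_def inv_dens_def)
  have \<rho>: "ennreal (?\<rho>r x) = \<rho> x" for x
  proof -
    have n: "0 \<le> (LBINT y:{0..t}. exp (- lam * y) * inverse_density \<alpha> g x y)"
      unfolding set_lebesgue_integral_def
      by (intro integral_nonneg_AE AE_I2) (auto simp: indicator_def inverse_density_nonneg)
    show ?thesis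
      unfolding \<rho>_def LI[symmetric] using t lam n inverse_density_nonneg[of t x]
      by (simp add: inv_dens_eq ennreal_mult ennreal_plus)
  qed
  have [measurable]: "\<rho> \<in> borel_measurable borel" unfolding \<rho>_def by measurable
  have tr: "(\<integral>\<^sup>+x. inv_dens x y * f x \<partial>lborel) = (\<integral>\<^sup>+\<omega>. f (?H y \<omega>) \<partial>N)"
    if [measurable]: "f \<in> borel_measurable borel" and y: "0 < y" for f y
    using distributed_nn_integral[OF inverse_distributed[OF y], of f] y by (simp add: inv_dens_eq)
  have i1: "integrable N (\<lambda>\<omega>. exp (- real i * ?H y \<omega>))" for i y
    by (rule integrable_const_bound[of _ 1], use inverse_nonneg[of y] in eventually_elim) auto
  have main: "(\<integral>\<^sup>+x. \<rho> x * ennreal (exp (- real i * x)) \<partial>lborel) = ennreal (\<integral>\<omega>. exp (- real i * X \<omega>) \<partial>P)" for i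
  proof -
    let ?f = "\<lambda>x. ennreal (exp (- real i * x))"
    let ?E = "\<lambda>y. \<integral>\<omega>. exp (- real i * ?H y \<omega>) \<partial>N"
    have E0: "0 \<le> ?E y" for y by simp
    have E: "(\<integral>\<^sup>+x. inv_dens x y * ?f x \<partial>lborel) = ennreal (?E y)" if "0 < y" for y
      using i1[of i y] by (subst tr[OF _ that]) (auto intro!: nn_integral_eq_integral)
    have "(\<integral>\<^sup>+x. \<rho> x * ?f x \<partial>lborel) = (\<integral>\<^sup>+x. ennreal (exp (- lam * t)) * (inv_dens x t * ?f x) +
      ennreal lam * (\<integral>\<^sup>+y. ennreal (exp (- lam * y)) * inv_dens x y * indicator {0..t} y * ?f x \<partial>lborel) \<partial>lborel)"
      unfolding \<rho>_def
      by (intro nn_integral_cong, subst nn_integral_multc) (auto simp: distrib_right mult.assoc)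
    also have "\<dots> = ennreal (exp (- lam * t)) * (\<integral>\<^sup>+x. inv_dens x t * ?f x \<partial>lborel) +
      ennreal lam * (\<integral>\<^sup>+x. \<integral>\<^sup>+y. ennreal (exp (- lam * y)) * inv_dens x y * indicator {0..t} y * ?f x \<partial>lborel \<partial>lborel)"
      by (subst nn_integral_add) (auto simp: nn_integral_cmult)
    also have "(\<integral>\<^sup>+x. \<integral>\<^sup>+y. ennreal (exp (- lam * y)) * inv_dens x y * indicator {0..t} y * ?f x \<partial>lborel \<partial>lborel) =
      (\<integral>\<^sup>+y. \<integral>\<^sup>+x. ennreal (exp (- lam * y)) * inv_dens x y * indicator {0..t} y * ?f x \<partial>lborel \<partial>lborel)"
      by (rule lborel_pair.Fubini') measurable
    also have "\<dots> = (\<integral>\<^sup>+y. ennreal (indicator {0..t} y *\<^sub>R (exp (- lam * y) * ?E y)) \<partial>lborel)"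
    proof (rule nn_integral_cong_AE)
      \<comment> \<open>At y = 0 the hitting time is almost surely 0 and has no density; this single
        time is discarded.\<close>
      have "AE y in lborel. (y::real) \<noteq> 0" by (rule AE_lborel_singleton)
      then show "AE y in lborel. (\<integral>\<^sup>+x. ennreal (exp (- lam * y)) * inv_dens x y * indicator {0..t} y * ?f x \<partial>lborel) =
        ennreal (indicator {0..t} y *\<^sub>R (exp (- lam * y) * ?E y))"
      proof eventually_elim
        case (elim y)
        show ?case
        proof (cases "y \<in> {0..t}")
          case True
          then have y: "0 < y" using elim by auto
          have "(\<integral>\<^sup>+x. ennreal (exp (- lam * y)) * inv_dens x y * indicator {0..t} y * ?f x \<partial>lborel) =
            (\<integral>\<^sup>+x. ennreal (exp (- lam * y)) * (inv_dens x y * ?f x) \<partial>lborel)"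
            using True by (simp add: mult.assoc)
          also have "\<dots> = ennreal (exp (- lam * y)) * ennreal (?E y)"
            by (subst nn_integral_cmult) (auto simp: E[OF y, simplified])
          finally show ?thesis using True E0[of y] by (simp add: ennreal_mult)
        qed simp
      qed
    qed
    also have "\<dots> = ennreal (LBINT y:{0..t}. exp (- lam * y) * ?E y)"
      unfolding set_lebesgue_integral_def
      by (rule nn_integral_eq_integral) (use int[of i] in \<open>auto simp: set_integrable_def indicator_def\<close>)
    also have "(\<integral>\<^sup>+x. inv_dens x t * ?f x \<partial>lborel) = ennreal (?E t)" by (rule E[OF t])
    also have "ennreal (exp (- lam * t)) * ennreal (?E t) + ennreal lam * ennreal (LBINT y:{0..t}. exp (- lam * y) * ?E y) =
      ennreal (\<integral>\<omega>. exp (- real i * X \<omega>) \<partial>P)"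
    proof -
      have "0 \<le> (LBINT y:{0..t}. exp (- lam * y) * ?E y)"
        unfolding set_lebesgue_integral_def by (intro integral_nonneg_AE AE_I2) (auto simp: indicator_def)
      then show ?thesis unfolding lap using lam E0[of t] by (simp add: ennreal_mult ennreal_plus)
    qed
    finally show ?thesis .
  qed
  have "distr P borel X = density lborel \<rho>"
  proof (rule laplace_uniqueness)
    show "real_distribution (distr P borel X)"
      by (intro real_distribution.intro P.prob_space_distr) (auto simp: real_distribution_axioms_def)
    show "real_distribution (density lborel \<rho>)"
    proof (intro real_distribution.intro prob_spaceI)
      \<comment> \<open>Total mass 1 is the Laplace identity at i = 0.\<close>
      show "emeasure (density lborel \<rho>) (space (density lborel \<rho>)) = 1"
        using main[of 0] by (simp add: emeasure_density P.prob_space)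
    qed (simp add: real_distribution_axioms_def)
    show "AE x in distr P borel X. 0 \<le> x" using X0 by (subst AE_distr_iff) auto
    show "AE x in density lborel \<rho>. 0 \<le> x"
    proof (subst AE_density)
      have "\<rho> x = 0" if "\<not> 0 \<le> x" for x using that by (simp add: \<rho>_def inv_dens_def)
      then show "AE x in lborel. 0 < \<rho> x \<longrightarrow> 0 \<le> x" by (intro AE_I2) (metis less_irrefl)
    qed simp
    fix i :: nat
    have "(\<integral>x. exp (- real i * x) \<partial>density lborel \<rho>) = enn2real (\<integral>\<^sup>+x. ennreal (exp (- real i * x)) \<partial>density lborel \<rho>)"
      by (rule integral_eq_nn_integral) auto
    also have "\<dots> = enn2real (\<integral>\<^sup>+x. \<rho> x * ennreal (exp (- real i * x)) \<partial>lborel)"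
      by (subst nn_integral_density) auto
    also have "\<dots> = (\<integral>\<omega>. exp (- real i * X \<omega>) \<partial>P)" unfolding main by simp
    also have "\<dots> = (\<integral>x. exp (- real i * x) \<partial>distr P borel X)" by (rule integral_distr[symmetric]) auto
    finally show "(\<integral>x. exp (- real i * x) \<partial>distr P borel X) = (\<integral>x. exp (- real i * x) \<partial>density lborel \<rho>)" ..
  qed
  moreover have "distr P lborel X = distr P borel X" by (rule distr_cong) auto
  ultimately show ?thesis unfolding distributed_def \<rho> by auto
qed

end

section \<open>The processes\<close>

lemma bdd_functional_cmult: "bdd_functional C L \<Longrightarrow> bdd_functional (\<bar>r\<bar> * C) (\<lambda>f. r * L f)"
  using bdd_functional_add_scaled[of 0 "\<lambda>_. 0" C L r] by (simp add: bdd_functional_def)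

text \<open>The hypothesis \<open>id\<close> is the equation after an integral of order n -
  \<alpha>. Taking n derivatives recovers \<open>h\<close> from its n-fold integral, while
  \<open>rl_one\<close> and \<open>rl_id\<close> become the tempered derivatives of 1 and t.\<close>

lemma tempered_of_identity:
  assumes \<alpha>: "0 < \<alpha>" "\<alpha> \<le> 1" and S: "time_range S"
    and f: "\<And>b. b \<in> S \<Longrightarrow> continuous_on {0..b} f" and h: "\<And>b. b \<in> S \<Longrightarrow> continuous_on {0..b} h"
    and \<beta>: "\<beta> = real (frac_order \<alpha>) - \<alpha>"
    and id: "\<And>t. t \<in> S \<Longrightarrow> (LBINT y:{0..t}. rl_weight lam \<beta> t y * f y) =
      p * rl_one lam \<beta> t + q * rl_id lam \<beta> t + (LBINT y:{0..t}. rl_weight lam (real (frac_order \<alpha>)) t y * h y)"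
  shows "tempered_differentiable S \<alpha> lam f"
    and "t \<in> S \<Longrightarrow> tempered_deriv S \<alpha> lam f t =
      p * tempered_deriv S \<alpha> lam (\<lambda>_. 1) t + q * tempered_deriv S \<alpha> lam (\<lambda>t. t) t + h t"
    and "tempered_differentiable S \<alpha> lam (\<lambda>_. 1)"
    and "tempered_differentiable S \<alpha> lam (\<lambda>t. t)"
proof -
  let ?n = "frac_order \<alpha>"
  have \<beta>0: "0 < \<beta>" unfolding \<beta> by (rule frac_order_cases[OF \<alpha>])
  have n: "?n = 1 \<or> ?n = 2 \<and> \<beta> = 1" unfolding \<beta> by (rule frac_order_cases[OF \<alpha>])
  obtain K L where K: "ndiff S ?n (rl_one lam \<beta>) K" and L: "ndiff S ?n (rl_id lam \<beta>) L"
    using ndiff_rl[OF \<beta>0 S n] by metis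
  have n12: "?n = 1 \<or> ?n = 2" using n by auto
  have J: "ndiff S ?n (\<lambda>t. LBINT y:{0..t}. pow_kernel (real ?n) (t - y) * (exp (lam * y) * h y)) (\<lambda>y. exp (lam * y) * h y)"
    by (rule ndiff_repeated_integral[OF S _ n12]) (intro continuous_intros h)
  have F: "ndiff S ?n (\<lambda>t. LBINT y:{0..t}. rl_weight lam \<beta> t y * f y) (\<lambda>t. p * K t + q * L t + exp (lam * t) * h t)"
    by (rule ndiff_cong[OF ndiff_linear[OF ndiff_linear[OF K L, of p q] J, of 1 1]])
      (auto simp: rl_weight_def mult.assoc id[unfolded rl_weight_def mult.assoc])
  show "tempered_differentiable S \<alpha> lam f"
    by (rule tempered_of_ndiff(1)[OF \<alpha> S _ F[unfolded \<beta>]]) (rule f)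
  have f': "tempered_deriv S \<alpha> lam f t = exp (- lam * t) * (p * K t + q * L t + exp (lam * t) * h t)" if "t \<in> S"
    by (rule tempered_of_ndiff(2)[OF \<alpha> S _ F[unfolded \<beta>] that]) (rule f)
  have K': "ndiff S ?n (\<lambda>t. LBINT y:{0..t}. rl_weight lam (real ?n - \<alpha>) t y * 1) K"
    using K by (simp add: rl_one_def[abs_def] \<beta>)
  note one = tempered_of_ndiff[OF \<alpha> S continuous_on_const K']
  have L': "ndiff S ?n (\<lambda>t. LBINT y:{0..t}. rl_weight lam (real ?n - \<alpha>) t y * y) L"
    using L by (simp add: rl_id_def[abs_def] \<beta>)
  note idf = tempered_of_ndiff[OF \<alpha> S continuous_on_id L']
  show "tempered_differentiable S \<alpha> lam (\<lambda>_. 1)" by (rule one)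
  show "tempered_differentiable S \<alpha> lam (\<lambda>t. t)" by (rule idf)
  show "tempered_deriv S \<alpha> lam f t =
      p * tempered_deriv S \<alpha> lam (\<lambda>_. 1) t + q * tempered_deriv S \<alpha> lam (\<lambda>t. t) t + h t" if "t \<in> S"
    using f'[OF that] one(2)[OF that] idf(2)[OF that] by (simp add: algebra_simps flip: exp_add)
qed

context stable_process
begin

lemma inv_term_bound:
  assumes "0 \<le> y" "y \<le> t"
  shows "\<bar>inv_term k y\<bar> \<le> eml_bound \<alpha> t k"
proof -
  have "0 < Gamma (real k * \<alpha> + 1)" using \<alpha> by (intro Gamma_real_pos) (simp add: add_nonneg_pos)
  moreover have "(y powr \<alpha>) ^ k \<le> ((1 + t) powr \<alpha>) ^ k"
    using assms \<alpha> by (intro power_mono powr_mono2) auto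
  ultimately show ?thesis by (simp add: inv_term_def eml_bound_def abs_mult divide_right_mono)
qed

lemma inv_term_continuous: "continuous_on {0..t} (inv_term k)"
  unfolding inv_term_def[abs_def] divide_inverse using \<alpha>
  by (intro continuous_on_mult continuous_on_power continuous_on_const continuous_on_powr' continuous_on_id) auto

text \<open>For k > 0, \<open>inv_term k\<close> is an antiderivative of the power kernel of order
  k\<alpha>. Integration by parts moves the derivative to e^(-lam y), which brings out the factor
  \<open>lam\<close>.\<close>

lemma eml_term_inv_term:
  assumes lam: "0 \<le> lam" and t: "0 \<le> t"
  shows "eml_term \<alpha> lam k t = exp (- lam * t) * inv_term k t + lam * (LBINT y:{0..t}. exp (- lam * y) * inv_term k y)"
proof -
  \<comment> \<open>The derivative of \<open>inv_term k\<close>: it is 0 for k = 0, where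
    \<open>inv_term\<close> is the constant 1.\<close>
  define u where "u y = (if k = 0 then 0 else pow_kernel (real k * \<alpha>) y)" for y
  define F where "F y = exp (- lam * y) * inv_term k y" for y
  have ui: "set_integrable lborel {0..t} (\<lambda>y. u y * exp (- lam * y))"
  proof (cases "k = 0")
    case True
    then show ?thesis by (simp add: u_def set_integrable_def)
  next
    case False
    then show ?thesis using eml_coeff_integrable[OF \<alpha> lam False t] by (simp add: u_def)
  qed
  have Fc: "continuous_on {0..t} F"
    unfolding F_def by (intro continuous_intros inv_term_continuous)
  have Fi: "set_integrable lborel {0..t} (\<lambda>y. lam * F y)"
    by (intro borel_integrable_atLeastAtMost' continuous_intros Fc)
  have d: "(F has_vector_derivative (u y * exp (- lam * y) - lam * F y)) (at y)" if y: "0 < y" for y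
  proof -
    have "(inv_term k has_real_derivative u y) (at y)"
    proof (cases "k = 0")
      case True
      then show ?thesis by (simp add: inv_term_def[abs_def] u_def)
    next
      case False
      let ?a = "real k * \<alpha>"
      have a: "0 < ?a" using False \<alpha> by simp
      have "((\<lambda>y. y powr ?a / Gamma (?a + 1)) has_real_derivative ?a * y powr (?a - 1) / Gamma (?a + 1)) (at y)"
        by (intro DERIV_cdivide has_real_derivative_powr y)
      moreover have "?a * y powr (?a - 1) / Gamma (?a + 1) = u y"
      proof -
        have "Gamma (?a + 1) = ?a * Gamma ?a" using a by (intro Gamma_plus1) (auto elim!: nonpos_Ints_cases)
        then show ?thesis using a False by (simp add: u_def pow_kernel_def)
      qed
      ultimately have "((\<lambda>y. y powr ?a / Gamma (?a + 1)) has_real_derivative u y) (at y)" by simp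
      then show ?thesis
      proof (rule has_field_derivative_transform_within_open[where S = "{0<..}"])
        show "x powr ?a / Gamma (?a + 1) = inv_term k x" if "x \<in> {0<..}" for x
          using that by (simp add: inv_term_def powr_powr mult.commute flip: powr_realpow)
      qed (use y in auto)
    qed
    then have "(F has_real_derivative (u y * exp (- lam * y) - lam * F y)) (at y)"
      unfolding F_def by (auto intro!: derivative_eq_intros)
    then show ?thesis by (simp add: has_real_derivative_iff_has_vector_derivative)
  qed
  \<comment> \<open>The integrand may blow up at 0, so derivatives are used only inside the
    interval, together with continuity of \<open>F\<close> up to the ends.\<close>
  have "((\<lambda>y. u y * exp (- lam * y) - lam * F y) has_integral F t - F 0) {0..t}"
    by (rule fundamental_theorem_of_calculus_interior[OF t Fc]) (use d in auto)
  moreover have "(LBINT y:{0..t}. u y * exp (- lam * y) - lam * F y) = integral {0..t} (\<lambda>y. u y * exp (- lam * y) - lam * F y)"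
    by (intro set_borel_integral_eq_integral set_integral_diff ui Fi)
  ultimately have "(LBINT y:{0..t}. u y * exp (- lam * y) - lam * F y) = F t - F 0"
    by (simp add: integral_unique)
  then have "(LBINT y:{0..t}. u y * exp (- lam * y)) - (LBINT y:{0..t}. lam * F y) = F t - F 0"
    by (subst (asm) set_integral_diff(2)[OF ui Fi])
  \<comment> \<open>\<open>F 0\<close> is 1 for k = 0 and 0 otherwise, which supplies the constant
    coefficient.\<close>
  moreover have "eml_term \<alpha> lam k t = F 0 + (LBINT y:{0..t}. u y * exp (- lam * y))"
    by (auto simp: eml_term_def eml_coeff_altdef F_def inv_term_def u_def)
  ultimately show ?thesis by (simp add: F_def)
qed

lemma inverse_mgf_continuous: "continuous_on {0..t} (\<lambda>y. \<integral>\<omega>. exp (s * inverse_subordinator D y \<omega>) \<partial>N)"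
proof (cases "0 \<le> t")
  case True
  have "continuous_on {0..t} (\<lambda>y. \<Sum>k. s ^ k * inv_term k y)"
    by (rule series_continuous[OF inv_term_continuous inv_term_bound eml_bound_summable[OF \<alpha> order_refl True]])
  then show ?thesis by (rule continuous_on_eq) (simp add: inverse_mgf)
qed simp

lemma mixture_mgf:
  assumes lam: "0 \<le> lam" and t: "0 \<le> t"
  shows "(\<Sum>k. s ^ k * eml_term \<alpha> lam k t) =
    exp (- lam * t) * (\<integral>\<omega>. exp (s * inverse_subordinator D t \<omega>) \<partial>N) +
    lam * (LBINT y:{0..t}. exp (- lam * y) * (\<integral>\<omega>. exp (s * inverse_subordinator D y \<omega>) \<partial>N))"
proof -
  note ser = inv_term_continuous inv_term_bound eml_bound_summable[OF \<alpha> order_refl t]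
  have w: "set_integrable lborel {0..t} (\<lambda>y. exp (- lam * y))"
    by (intro borel_integrable_atLeastAtMost' continuous_intros)
  have "(\<lambda>k. s ^ k * inv_term k t) sums (\<Sum>k. s ^ k * inv_term k t)"
    using t by (intro summable_sums series_summable[OF ser]) auto
  then have "(\<lambda>k. exp (- lam * t) * (s ^ k * inv_term k t) + lam * (s ^ k * (LBINT y:{0..t}. exp (- lam * y) * inv_term k y)))
      sums (exp (- lam * t) * (\<Sum>k. s ^ k * inv_term k t) + lam * (LBINT y:{0..t}. exp (- lam * y) * (\<Sum>k. s ^ k * inv_term k y)))"
    by (intro sums_add sums_mult series_integral[OF ser w])
  moreover have "exp (- lam * t) * (s ^ k * inv_term k t) + lam * (s ^ k * (LBINT y:{0..t}. exp (- lam * y) * inv_term k y)) =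
      s ^ k * eml_term \<alpha> lam k t" for k
    unfolding eml_term_inv_term[OF lam t] by (simp add: algebra_simps)
  ultimately have "(\<Sum>k. s ^ k * eml_term \<alpha> lam k t) = exp (- lam * t) * (\<Sum>k. s ^ k * inv_term k t) +
      lam * (LBINT y:{0..t}. exp (- lam * y) * (\<Sum>k. s ^ k * inv_term k y))"
    by (simp add: sums_iff)
  also have "(LBINT y:{0..t}. exp (- lam * y) * (\<Sum>k. s ^ k * inv_term k y)) =
      (LBINT y:{0..t}. exp (- lam * y) * (\<integral>\<omega>. exp (s * inverse_subordinator D y \<omega>) \<partial>N))"
    by (rule set_lebesgue_integral_cong) (auto simp: inverse_mgf)
  finally show ?thesis using t by (simp add: inverse_mgf)
qed

end

section \<open>Pairings of the two processes with exponentials and test functions\<close>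

context
  fixes \<alpha> lam :: real
  assumes \<alpha>: "0 < \<alpha>" "\<alpha> \<le> 1" and lam: "0 \<le> lam"
begin

lemma eml_term_abs_le: "0 \<le> y \<Longrightarrow> y \<le> t \<Longrightarrow> \<bar>eml_term \<alpha> lam k y\<bar> \<le> eml_bound \<alpha> t k"
  using eml_term_le[OF \<alpha>(1) lam] eml_term_nonneg[OF \<alpha>(1) lam] by (simp add: abs_of_nonneg)

lemma eml_iterm_abs_le: "0 \<le> y \<Longrightarrow> y \<le> t \<Longrightarrow> \<bar>eml_iterm \<alpha> lam k y\<bar> \<le> t * eml_bound \<alpha> t k"
  using eml_iterm_le[OF \<alpha>(1) lam] eml_iterm_nonneg[OF \<alpha>(1) lam] by (simp add: abs_of_nonneg)

lemma eml_ibound_summable: "0 \<le> t \<Longrightarrow> summable (\<lambda>k. \<bar>s\<bar> ^ k * (t * eml_bound \<alpha> t k))"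
  using summable_mult[OF eml_bound_summable[OF \<alpha>(1) lam, of t s], of t] by (simp add: mult_ac)

lemmas eml_series = eml_term_continuous[OF \<alpha>(1) lam] eml_term_abs_le eml_bound_summable[OF \<alpha>(1) lam]
lemmas eml_iseries = eml_iterm_continuous[OF \<alpha>(1) lam] eml_iterm_abs_le eml_ibound_summable

lemma EML_star_mgf:
  assumes X: "EML_star \<alpha> lam M X" and t: "0 \<le> t"
  shows "(\<integral>\<omega>. exp (s * X t \<omega>) \<partial>M) = (\<Sum>k. s ^ k * eml_term \<alpha> lam k t)"
proof -
  have "(\<integral>\<omega>. exp (s * X t \<omega>) \<partial>M) = 1 + (\<Sum>k. s ^ Suc k * eml_coeff \<alpha> lam (Suc k) t)"
    using X t by (simp add: EML_star_def)
  moreover have "summable (\<lambda>k. s ^ k * eml_term \<alpha> lam k t)"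
    by (rule series_summable[OF eml_series[where t = t]]) (use t in auto)
  from suminf_split_head[OF this] have "(\<Sum>k. s ^ Suc k * eml_coeff \<alpha> lam (Suc k) t) = (\<Sum>k. s ^ k * eml_term \<alpha> lam k t) - 1"
    by (simp add: eml_term_def)
  ultimately show ?thesis by simp
qed

lemma eml_iterm_0: "0 \<le> t \<Longrightarrow> eml_iterm \<alpha> lam 0 t = t"
  by (simp add: eml_iterm_def eml_term_def set_lebesgue_integral_def)

text \<open>The linear term of the definition is the term of index 0, as the coefficient 1 has time
  integral t. One power of s can then be factored out of the whole series.\<close>

lemma EML_mgf:
  assumes X: "EML \<alpha> lam b T M X" and t: "t \<in> {0..T}"
  shows "(\<integral>\<omega>. exp (s * X t \<omega>) \<partial>M) = 1 + a_coeff \<alpha> lam b T * s * (\<Sum>k. s ^ k * eml_iterm \<alpha> lam k t)"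
proof -
  let ?a = "a_coeff \<alpha> lam b T"
  have "(\<integral>\<omega>. exp (s * X t \<omega>) \<partial>M) = 1 + t * ?a * s +
      ?a * (\<Sum>k. s ^ (Suc k + 1) * (LBINT x:{0..t}. eml_coeff \<alpha> lam (Suc k) x))"
    using X t by (simp add: EML_def)
  also have "(\<Sum>k. s ^ (Suc k + 1) * (LBINT x:{0..t}. eml_coeff \<alpha> lam (Suc k) x)) =
      (\<Sum>k. s * (s ^ Suc k * eml_iterm \<alpha> lam (Suc k) t))"
    by (simp add: eml_iterm_def eml_term_def mult_ac)
  also have "\<dots> = s * ((\<Sum>k. s ^ k * eml_iterm \<alpha> lam k t) - t)"
  proof -
    have s: "summable (\<lambda>k. s ^ k * eml_iterm \<alpha> lam k t)"
      by (rule series_summable[OF eml_iseries[where t = t]]) (use t in auto)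
    have "(\<Sum>k. s ^ Suc k * eml_iterm \<alpha> lam (Suc k) t) = (\<Sum>k. s ^ k * eml_iterm \<alpha> lam k t) - t"
      using suminf_split_head[OF s] t by (simp add: eml_iterm_0)
    then show ?thesis
      using suminf_mult[of "\<lambda>k. s ^ Suc k * eml_iterm \<alpha> lam (Suc k) t" s] s summable_Suc_iff[of "\<lambda>k. s ^ k * eml_iterm \<alpha> lam k t"]
      by metis
  qed
  finally show ?thesis by (simp add: algebra_simps)
qed

lemma EML_star_bdd_functional:
  assumes X: "EML_star \<alpha> lam M X" and t: "0 \<le> t"
  shows "bdd_functional 1 (\<lambda>f. \<integral>\<omega>. f (X t \<omega>) \<partial>M)"
  using X t by (intro prob_space.bdd_functional_expectation) (auto simp: EML_star_def)

lemma EML_bdd_functional: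
  assumes X: "EML \<alpha> lam b T M X" and t: "t \<in> {0..T}"
  shows "bdd_functional 1 (\<lambda>f. \<integral>\<omega>. f (X t \<omega>) \<partial>M)"
  using X t by (intro prob_space.bdd_functional_expectation) (auto simp: EML_def)

text \<open>Only marginal laws are specified, so continuity in time cannot come from paths; it is
  inherited from the series of the moment generating function.\<close>

lemma EML_star_continuous:
  assumes X: "EML_star \<alpha> lam M X" and f: "f \<in> cont_lim"
  shows "continuous_on {0..t} (\<lambda>y. \<integral>\<omega>. f (X y \<omega>) \<partial>M)"
proof (cases "0 \<le> t")
  case True
  show ?thesis
  proof (rule bdd_functional_continuous_on[OF EML_star_bdd_functional[OF X] _ f])
    fix i
    have "continuous_on {0..t} (\<lambda>y. \<Sum>k. (- real i) ^ k * eml_term \<alpha> lam k y)"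
      by (rule series_continuous[OF eml_series[where t = t]]) (use True in auto)
    then show "continuous_on {0..t} (\<lambda>y. \<integral>\<omega>. expo i (X y \<omega>) \<partial>M)"
      by (rule continuous_on_eq) (simp add: expo_def EML_star_mgf[OF X, symmetric])
  qed simp
qed simp

lemma EML_continuous:
  assumes X: "EML \<alpha> lam b T M X" and f: "f \<in> cont_lim" and t: "t \<le> T"
  shows "continuous_on {0..t} (\<lambda>y. \<integral>\<omega>. f (X y \<omega>) \<partial>M)"
proof (cases "0 \<le> t")
  case True
  show ?thesis
  proof (rule bdd_functional_continuous_on[OF EML_bdd_functional[OF X] _ f])
    fix i
    have "continuous_on {0..t} (\<lambda>y. \<Sum>k. (- real i) ^ k * eml_iterm \<alpha> lam k y)"
      by (rule series_continuous[OF eml_iseries[where t = t]]) (use True in auto)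
    then have "continuous_on {0..t} (\<lambda>y. 1 + a_coeff \<alpha> lam b T * (- real i) * (\<Sum>k. (- real i) ^ k * eml_iterm \<alpha> lam k y))"
      by (intro continuous_intros)
    then show "continuous_on {0..t} (\<lambda>y. \<integral>\<omega>. expo i (X y \<omega>) \<partial>M)"
      by (rule continuous_on_eq) (use t in \<open>simp only: expo_def, subst EML_mgf[OF X], auto\<close>)
  qed (use t in auto)
qed simp

lemma bdd_functional_weighted_star:
  assumes X: "EML_star \<alpha> lam M X" and k: "set_integrable lborel {0..t} k"
  shows "bdd_functional (LBINT y:{0..t}. \<bar>k y\<bar>) (\<lambda>f. LBINT y:{0..t}. k y * (\<integral>\<omega>. f (X y \<omega>) \<partial>M))"
  by (rule bdd_functional_time_integral[OF EML_star_bdd_functional[OF X] EML_star_continuous[OF X expo_cont_lim] k]) simp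

lemma bdd_functional_weighted:
  assumes X: "EML \<alpha> lam b T M X" and t: "t \<le> T" and k: "set_integrable lborel {0..t} k"
  shows "bdd_functional (LBINT y:{0..t}. \<bar>k y\<bar>) (\<lambda>f. LBINT y:{0..t}. k y * (\<integral>\<omega>. f (X y \<omega>) \<partial>M))"
  by (rule bdd_functional_time_integral[OF EML_bdd_functional[OF X] EML_continuous[OF X expo_cont_lim t] k]) (use t in auto)

text \<open>The equation after an integral of order n - \<alpha> in time. On \<open>expo i\<close>
  it is \<open>series_shift\<close> at s = -i: multiplication by s corresponds to the derivative,
  and the term of index 0 yields \<open>rl_one\<close>.\<close>

lemma EML_star_identity:
  assumes X: "EML_star \<alpha> lam M X" and \<phi>: "test_fun \<phi>" and t: "0 < t"
    and \<beta>: "0 < \<beta>" "\<beta> + \<alpha> = n"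
  shows "(LBINT y:{0..t}. rl_weight lam \<beta> t y * (\<integral>\<omega>. \<phi> (X y \<omega>) \<partial>M)) =
    \<phi> 0 * rl_one lam \<beta> t + (LBINT y:{0..t}. rl_weight lam n t y * (\<integral>\<omega>. deriv \<phi> (X y \<omega>) \<partial>M))"
proof -
  have n: "0 < n" using \<alpha> \<beta> by simp
  have wb: "set_integrable lborel {0..t} (rl_weight lam \<beta> t)" and wn: "set_integrable lborel {0..t} (rl_weight lam n t)"
    using t \<beta> n by (auto intro!: rl_weight_integrable)
  let ?L = "\<lambda>f. (LBINT y:{0..t}. rl_weight lam \<beta> t y * (\<integral>\<omega>. f (X y \<omega>) \<partial>M)) + (- rl_one lam \<beta> t) * f 0"
  let ?L' = "\<lambda>f. (- 1) * (LBINT y:{0..t}. rl_weight lam n t y * (\<integral>\<omega>. f (X y \<omega>) \<partial>M))"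
  have "?L \<phi> + ?L' (deriv \<phi>) = 0"
  proof (rule bdd_functional_test_zero[OF _ _ _ \<phi>])
    show "bdd_functional ((LBINT y:{0..t}. \<bar>rl_weight lam \<beta> t y\<bar>) + \<bar>- rl_one lam \<beta> t\<bar> * 1) ?L"
      by (intro bdd_functional_add_scaled bdd_functional_weighted_star[OF X wb] bdd_functional_eval0)
    show "bdd_functional (\<bar>- 1\<bar> * (LBINT y:{0..t}. \<bar>rl_weight lam n t y\<bar>)) ?L'"
      by (intro bdd_functional_cmult bdd_functional_weighted_star[OF X wn])
    fix i
    let ?F = "\<lambda>y. \<Sum>k. (- real i) ^ k * eml_term \<alpha> lam k y"
    have E: "(LBINT y:{0..t}. w y * (\<integral>\<omega>. expo i (X y \<omega>) \<partial>M)) = (LBINT y:{0..t}. w y * ?F y)" for w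
      by (rule set_lebesgue_integral_cong) (auto simp: expo_def EML_star_mgf[OF X, symmetric])
    have "(LBINT y:{0..t}. rl_weight lam \<beta> t y * ?F y) =
      (LBINT y:{0..t}. rl_weight lam \<beta> t y * eml_term \<alpha> lam 0 y) + (- real i) * (LBINT y:{0..t}. rl_weight lam n t y * ?F y)"
      using t by (intro series_shift[OF eml_series[where t = t] wb wn] eml_term_shift[OF \<alpha>(1) lam \<beta>]) auto
    then show "?L (expo i) - real i * ?L' (expo i) = 0"
      unfolding E by (simp add: expo_def eml_term_def rl_one_def)
  qed
  then show ?thesis by (simp add: algebra_simps)
qed

text \<open>At s = -i the pairing with \<open>expo i\<close> is 1 + a_T s F, where F is the series
  of \<open>eml_iterm\<close>. The term of index 0 in F is t, whence \<open>rl_id\<close>; and a_T s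
  F is the pairing minus 1, whence the subtraction of \<open>deriv \<phi> 0\<close> in the last
  integral.\<close>

lemma EML_identity:
  assumes X: "EML \<alpha> lam b T M X" and \<phi>: "test_fun \<phi>" and t: "0 < t" "t \<le> T"
    and \<beta>: "0 < \<beta>" "\<beta> + \<alpha> = n"
  shows "(LBINT y:{0..t}. rl_weight lam \<beta> t y * (\<integral>\<omega>. \<phi> (X y \<omega>) \<partial>M)) =
    \<phi> 0 * rl_one lam \<beta> t + deriv \<phi> 0 * a_coeff \<alpha> lam b T * rl_id lam \<beta> t +
    (LBINT y:{0..t}. rl_weight lam n t y * ((\<integral>\<omega>. deriv \<phi> (X y \<omega>) \<partial>M) - deriv \<phi> 0))"
proof -
  let ?a = "a_coeff \<alpha> lam b T"
  have n: "0 < n" using \<alpha> \<beta> by simp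
  have wb: "set_integrable lborel {0..t} (rl_weight lam \<beta> t)" and wn: "set_integrable lborel {0..t} (rl_weight lam n t)"
    using t \<beta> n by (auto intro!: rl_weight_integrable)
  \<comment> \<open>The integral of the weight that multiplies the subtracted constant
    \<open>deriv \<phi> 0\<close>; in \<open>?L'\<close> it becomes the coefficient of an evaluation
    at 0.\<close>
  define J where "J = (LBINT y:{0..t}. rl_weight lam n t y)"
  let ?L = "\<lambda>f. (LBINT y:{0..t}. rl_weight lam \<beta> t y * (\<integral>\<omega>. f (X y \<omega>) \<partial>M)) + (- rl_one lam \<beta> t) * f 0"
  let ?L' = "\<lambda>f. (- 1) * (LBINT y:{0..t}. rl_weight lam n t y * (\<integral>\<omega>. f (X y \<omega>) \<partial>M)) + (J - ?a * rl_id lam \<beta> t) * f 0"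
  have "?L \<phi> + ?L' (deriv \<phi>) = 0"
  proof (rule bdd_functional_test_zero[OF _ _ _ \<phi>])
    show "bdd_functional ((LBINT y:{0..t}. \<bar>rl_weight lam \<beta> t y\<bar>) + \<bar>- rl_one lam \<beta> t\<bar> * 1) ?L"
      by (intro bdd_functional_add_scaled bdd_functional_weighted[OF X t(2) wb] bdd_functional_eval0)
    show "bdd_functional (\<bar>- 1\<bar> * (LBINT y:{0..t}. \<bar>rl_weight lam n t y\<bar>) + \<bar>J - ?a * rl_id lam \<beta> t\<bar> * 1) ?L'"
      by (intro bdd_functional_add_scaled bdd_functional_cmult bdd_functional_weighted[OF X t(2) wn] bdd_functional_eval0)
    fix i
    let ?s = "- real i"
    let ?F = "\<lambda>y. \<Sum>k. ?s ^ k * eml_iterm \<alpha> lam k y"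
    have cont: "continuous_on {0..t} ?F"
      by (rule series_continuous[OF eml_iseries[where t = t]]) (use t in auto)
    have E: "(LBINT y:{0..t}. w y * (\<integral>\<omega>. expo i (X y \<omega>) \<partial>M)) =
      (LBINT y:{0..t}. w y) + ?a * ?s * (LBINT y:{0..t}. w y * ?F y)"
      if w: "set_integrable lborel {0..t} w" for w
    proof -
      have "(LBINT y:{0..t}. w y * (\<integral>\<omega>. expo i (X y \<omega>) \<partial>M)) = (LBINT y:{0..t}. w y + ?a * ?s * (w y * ?F y))"
      proof (rule set_lebesgue_integral_cong)
        show "\<forall>y. y \<in> {0..t} \<longrightarrow> w y * (\<integral>\<omega>. expo i (X y \<omega>) \<partial>M) = w y + ?a * ?s * (w y * ?F y)"
        proof (intro allI impI)
          fix y assume "y \<in> {0..t}"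
          then have "(\<integral>\<omega>. exp (?s * X y \<omega>) \<partial>M) = 1 + ?a * ?s * ?F y" using t by (intro EML_mgf[OF X]) auto
          then show "w y * (\<integral>\<omega>. expo i (X y \<omega>) \<partial>M) = w y + ?a * ?s * (w y * ?F y)"
            unfolding expo_def by (simp only:) (simp add: algebra_simps)
        qed
      qed simp
      also have "\<dots> = (LBINT y:{0..t}. w y) + (LBINT y:{0..t}. ?a * ?s * (w y * ?F y))"
        by (intro set_integral_add(2) w set_integrable_mult_right impI set_integrable_mult_continuous cont)
      finally show ?thesis by (simp only: set_integral_mult_right)
    qed
    have "(LBINT y:{0..t}. rl_weight lam \<beta> t y * ?F y) =
      (LBINT y:{0..t}. rl_weight lam \<beta> t y * eml_iterm \<alpha> lam 0 y) + ?s * (LBINT y:{0..t}. rl_weight lam n t y * ?F y)"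
      using t by (intro series_shift[OF eml_iseries[where t = t] wb wn] eml_iterm_shift[OF \<alpha>(1) lam \<beta>]) auto
    also have "(LBINT y:{0..t}. rl_weight lam \<beta> t y * eml_iterm \<alpha> lam 0 y) = rl_id lam \<beta> t"
      unfolding rl_id_def by (rule set_lebesgue_integral_cong) (auto simp: eml_iterm_0)
    finally have F: "(LBINT y:{0..t}. rl_weight lam \<beta> t y * ?F y) =
      rl_id lam \<beta> t + ?s * (LBINT y:{0..t}. rl_weight lam n t y * ?F y)" .
    have e0: "expo i 0 = 1" by (simp add: expo_def)
    show "?L (expo i) - real i * ?L' (expo i) = 0"
      unfolding E[OF wb] E[OF wn] F e0 J_def[symmetric] rl_one_def[of lam \<beta> t, symmetric] by (simp add: algebra_simps)
  qed
  moreover have "(LBINT y:{0..t}. rl_weight lam n t y * ((\<integral>\<omega>. deriv \<phi> (X y \<omega>) \<partial>M) - deriv \<phi> 0)) =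
    (LBINT y:{0..t}. rl_weight lam n t y * (\<integral>\<omega>. deriv \<phi> (X y \<omega>) \<partial>M)) - deriv \<phi> 0 * J"
  proof -
    have "(LBINT y:{0..t}. rl_weight lam n t y * ((\<integral>\<omega>. deriv \<phi> (X y \<omega>) \<partial>M) - deriv \<phi> 0)) =
      (LBINT y:{0..t}. rl_weight lam n t y * (\<integral>\<omega>. deriv \<phi> (X y \<omega>) \<partial>M) - deriv \<phi> 0 * rl_weight lam n t y)"
      by (simp add: algebra_simps)
    also have "\<dots> = (LBINT y:{0..t}. rl_weight lam n t y * (\<integral>\<omega>. deriv \<phi> (X y \<omega>) \<partial>M)) -
      (LBINT y:{0..t}. deriv \<phi> 0 * rl_weight lam n t y)"
      by (intro set_integral_diff(2) wn set_integrable_mult_right impI set_integrable_mult_continuous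
        EML_continuous[OF X _ t(2)] test_fun_cont_lim test_fun_deriv \<phi>)
    finally show ?thesis by (simp add: J_def)
  qed
  ultimately show ?thesis by (simp add: algebra_simps)
qed

text \<open>As \<open>eml_iterm\<close> integrates \<open>eml_term\<close> in time, E exp(s X_t) is
  1 plus a_T s times the time integral of the starred moment generating function. The factor s is
  the derivative of the exponential.\<close>

lemma EML_of_EML_star:
  assumes X: "EML \<alpha> lam b T M X" and Xs: "EML_star \<alpha> lam Ms Xs" and \<phi>: "test_fun \<phi>" and t: "t \<in> {0..T}"
  shows "(\<integral>\<omega>. \<phi> (X t \<omega>) \<partial>M) =
    \<phi> 0 + a_coeff \<alpha> lam b T * (LBINT y:{0..t}. (\<integral>\<omega>. deriv \<phi> (Xs y \<omega>) \<partial>Ms))"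
proof -
  let ?a = "a_coeff \<alpha> lam b T"
  have one: "set_integrable lborel {0..t} (\<lambda>_. 1 :: real)"
    by (intro borel_integrable_atLeastAtMost' continuous_intros)
  let ?L = "\<lambda>f. (\<integral>\<omega>. f (X t \<omega>) \<partial>M) + (- 1) * f 0"
  let ?L' = "\<lambda>f. (- ?a) * (LBINT y:{0..t}. 1 * (\<integral>\<omega>. f (Xs y \<omega>) \<partial>Ms))"
  have "?L \<phi> + ?L' (deriv \<phi>) = 0"
  proof (rule bdd_functional_test_zero[OF _ _ _ \<phi>])
    show "bdd_functional (1 + \<bar>- 1\<bar> * 1) ?L" by (intro bdd_functional_add_scaled EML_bdd_functional[OF X t] bdd_functional_eval0)
    show "bdd_functional (\<bar>- ?a\<bar> * (LBINT y:{0..t}. \<bar>1\<bar>)) ?L'"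
      by (intro bdd_functional_cmult bdd_functional_weighted_star[OF Xs one])
    fix i
    let ?s = "- real i"
    have "(LBINT y:{0..t}. 1 * (\<integral>\<omega>. expo i (Xs y \<omega>) \<partial>Ms)) = (LBINT y:{0..t}. 1 * (\<Sum>k. ?s ^ k * eml_term \<alpha> lam k y))"
      by (rule set_lebesgue_integral_cong) (auto simp: expo_def EML_star_mgf[OF Xs, symmetric])
    also have "\<dots> = (\<Sum>k. ?s ^ k * eml_iterm \<alpha> lam k t)"
    proof -
      have "(\<lambda>k. ?s ^ k * (LBINT y:{0..t}. 1 * eml_term \<alpha> lam k y)) sums
        (LBINT y:{0..t}. 1 * (\<Sum>k. ?s ^ k * eml_term \<alpha> lam k y))"
        by (rule series_integral[OF eml_series[where t = t] one]) (use t in auto)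
      then show ?thesis by (simp add: sums_iff eml_iterm_def)
    qed
    finally have 1: "(LBINT y:{0..t}. 1 * (\<integral>\<omega>. expo i (Xs y \<omega>) \<partial>Ms)) = (\<Sum>k. ?s ^ k * eml_iterm \<alpha> lam k t)" .
    have 2: "(\<integral>\<omega>. expo i (X t \<omega>) \<partial>M) = 1 + ?a * ?s * (\<Sum>k. ?s ^ k * eml_iterm \<alpha> lam k t)"
      unfolding expo_def by (rule EML_mgf[OF X t])
    have e0: "expo i 0 = 1" by (simp add: expo_def)
    show "?L (expo i) - real i * ?L' (expo i) = 0" unfolding 1 2 e0 by simp
  qed
  then show ?thesis by simp
qed

end

theorem proposition3p6:
  fixes \<alpha> lam b T :: real
    and M :: "'a measure" and X :: "real \<Rightarrow> 'a \<Rightarrow> real"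
    and Ms :: "'b measure" and Xs :: "real \<Rightarrow> 'b \<Rightarrow> real"
    and N :: "'c measure" and D :: "real \<Rightarrow> 'c \<Rightarrow> real"
  assumes "0 \<le> lam" and "0 < \<alpha>" and "\<alpha> \<le> 1" and "0 < T" and "0 < b" and "b \<le> 1"
    and "EML \<alpha> lam b T M X"
    and "EML_star \<alpha> lam Ms Xs"
    and "stable_subordinator \<alpha> N D"
  shows
    "(tempered_differentiable {0<..} \<alpha> lam (\<lambda>_. 1) \<and>
      dist_tempered_differentiable {0<..} \<alpha> lam (gpdf Ms Xs) \<and>
      (\<forall>t>0. dist_eq
         (dist_tempered_deriv {0<..} \<alpha> lam (gpdf Ms Xs) t)
         (\<lambda>\<phi>. - weak_deriv (gpdf Ms Xs t) \<phi>
               + dirac \<phi> * tempered_deriv {0<..} \<alpha> lam (\<lambda>_. 1) t)))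
     \<and>
     (tempered_differentiable {0<..T} \<alpha> lam (\<lambda>_. 1) \<and>
      tempered_differentiable {0<..T} \<alpha> lam (\<lambda>t. t) \<and>
      dist_tempered_differentiable {0<..T} \<alpha> lam (gpdf M X) \<and>
      (\<forall>t\<in>{0<..T}. dist_eq
         (dist_tempered_deriv {0<..T} \<alpha> lam (gpdf M X) t)
         (\<lambda>\<phi>. - weak_deriv (gpdf M X t) \<phi>
               + (dirac \<phi> * tempered_deriv {0<..T} \<alpha> lam (\<lambda>_. 1) t
                  + weak_deriv dirac \<phi>
                  - weak_deriv dirac \<phi> * a_coeff \<alpha> lam b T
                      * tempered_deriv {0<..T} \<alpha> lam (\<lambda>t. t) t))))
     \<and>
     transposed_density (\<lambda>x t. t / (x * \<alpha>))
       (\<lambda>x. distr N borel (D x))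
       (\<lambda>t. distr N borel (inverse_subordinator D t))
     \<and>
     (\<forall>t\<ge>0.
        dist_integrable (\<lambda>y \<phi>. exp (- lam * y) * gpdf N (inverse_subordinator D) y \<phi>) t \<and>
        dist_eq (gpdf Ms Xs t)
          (\<lambda>\<phi>. exp (- lam * t) * gpdf N (inverse_subordinator D) t \<phi>
                + lam * dist_integral
                    (\<lambda>y \<phi>. exp (- lam * y) * gpdf N (inverse_subordinator D) y \<phi>) t \<phi>))
     \<and>
     (\<forall>g. stable_density N D g \<longrightarrow>
        (\<forall>t>0.
           distributed N lborel (inverse_subordinator D t)
             (\<lambda>x. ennreal (inverse_density \<alpha> g x t)) \<and>
           (\<forall>x>0. set_integrable lborel {0..t} (\<lambda>y. exp (- lam * y) * inverse_density \<alpha> g x y)) \<and>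
           distributed Ms lborel (Xs t)
             (\<lambda>x. ennreal (exp (- lam * t) * inverse_density \<alpha> g x t
                + lam * (LINT y:{0..t}|lborel. exp (- lam * y) * inverse_density \<alpha> g x y)))))
     \<and>
     (\<forall>t\<in>{0..T}.
        dist_integrable (\<lambda>y. weak_deriv (gpdf Ms Xs y)) t \<and>
        dist_eq (gpdf M X t)
          (\<lambda>\<phi>. - a_coeff \<alpha> lam b T * dist_integral (\<lambda>y. weak_deriv (gpdf Ms Xs y)) t \<phi>
                + dirac \<phi>))"
proof -
  note lam = assms(1) and \<alpha>01 = assms(2,3) and X = assms(7) and Xs = assms(8)
  interpret stable_process \<alpha> N D by (rule stable_process.intro[OF assms(2,9)])
  define n where "n = real (frac_order \<alpha>)"
  define \<beta> where "\<beta> = n - \<alpha>"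
  have \<beta>: "0 < \<beta>" "\<beta> + \<alpha> = n" using frac_order_cases(2)[OF \<alpha>01] by (auto simp: \<beta>_def n_def)
  have \<beta>n: "\<beta> = real (frac_order \<alpha>) - \<alpha>" by (simp add: \<beta>_def n_def)
  let ?H = "inverse_subordinator D"
  let ?a = "a_coeff \<alpha> lam b T"

  have S1: "time_range {0<..}" and S2: "time_range {0<..T}" using assms(4) by (auto simp: time_range_def)
  \<comment> \<open>The summand with factor 0 makes \<open>tempered_of_identity\<close> cover this
    equation too, whose source has no term in the derivative of t.\<close>
  have star: "tempered_differentiable {0<..} \<alpha> lam (\<lambda>t. gpdf Ms Xs t \<phi>)"
      "t \<in> {0<..} \<Longrightarrow> tempered_deriv {0<..} \<alpha> lam (\<lambda>t. gpdf Ms Xs t \<phi>) t =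
        \<phi> 0 * tempered_deriv {0<..} \<alpha> lam (\<lambda>_. 1) t + 0 * tempered_deriv {0<..} \<alpha> lam (\<lambda>t. t) t + gpdf Ms Xs t (deriv \<phi>)"
      "tempered_differentiable {0<..} \<alpha> lam (\<lambda>_. 1)"
    if \<phi>: "test_fun \<phi>" for \<phi> t
  proof -
    have "(LBINT y:{0..t}. rl_weight lam \<beta> t y * gpdf Ms Xs y \<phi>) =
      \<phi> 0 * rl_one lam \<beta> t + 0 * rl_id lam \<beta> t + (LBINT y:{0..t}. rl_weight lam (real (frac_order \<alpha>)) t y * gpdf Ms Xs y (deriv \<phi>))"
      if "t \<in> {0<..}" for t
      using EML_star_identity[OF \<alpha>01 lam Xs \<phi> _ \<beta>] that by (simp add: gpdf_def n_def)
    note * = tempered_of_identity[OF \<alpha>01 S1 _ _ \<beta>n this]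
    have c: "continuous_on {0..b} (\<lambda>t. gpdf Ms Xs t \<phi>)" "continuous_on {0..b} (\<lambda>t. gpdf Ms Xs t (deriv \<phi>))" for b
      unfolding gpdf_def by (intro EML_star_continuous[OF \<alpha>01 lam Xs] test_fun_cont_lim test_fun_deriv \<phi>)+
    show "tempered_differentiable {0<..} \<alpha> lam (\<lambda>t. gpdf Ms Xs t \<phi>)"
      "t \<in> {0<..} \<Longrightarrow> tempered_deriv {0<..} \<alpha> lam (\<lambda>t. gpdf Ms Xs t \<phi>) t =
        \<phi> 0 * tempered_deriv {0<..} \<alpha> lam (\<lambda>_. 1) t + 0 * tempered_deriv {0<..} \<alpha> lam (\<lambda>t. t) t + gpdf Ms Xs t (deriv \<phi>)"
      "tempered_differentiable {0<..} \<alpha> lam (\<lambda>_. 1)"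
      using * c by blast+
  qed
  \<comment> \<open>The derivative of the Dirac mass pairs to \<open>- deriv \<phi> 0\<close>, so
    the signs at \<open>deriv \<phi> 0\<close> are opposite to those at
    \<open>weak_deriv dirac\<close> in the equation.\<close>
  have eml: "tempered_differentiable {0<..T} \<alpha> lam (\<lambda>t. gpdf M X t \<phi>)"
      "t \<in> {0<..T} \<Longrightarrow> tempered_deriv {0<..T} \<alpha> lam (\<lambda>t. gpdf M X t \<phi>) t =
        \<phi> 0 * tempered_deriv {0<..T} \<alpha> lam (\<lambda>_. 1) t + (deriv \<phi> 0 * ?a) * tempered_deriv {0<..T} \<alpha> lam (\<lambda>t. t) t
        + (gpdf M X t (deriv \<phi>) - deriv \<phi> 0)"
      "tempered_differentiable {0<..T} \<alpha> lam (\<lambda>_. 1)" "tempered_differentiable {0<..T} \<alpha> lam (\<lambda>t. t)"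
    if \<phi>: "test_fun \<phi>" for \<phi> t
  proof -
    have "(LBINT y:{0..t}. rl_weight lam \<beta> t y * gpdf M X y \<phi>) =
      \<phi> 0 * rl_one lam \<beta> t + (deriv \<phi> 0 * ?a) * rl_id lam \<beta> t +
        (LBINT y:{0..t}. rl_weight lam (real (frac_order \<alpha>)) t y * (gpdf M X y (deriv \<phi>) - deriv \<phi> 0))"
      if "t \<in> {0<..T}" for t
      using EML_identity[OF \<alpha>01 lam X \<phi> _ _ \<beta>] that by (simp add: gpdf_def n_def)
    note * = tempered_of_identity[OF \<alpha>01 S2 _ _ \<beta>n this]
    have c: "continuous_on {0..b} (\<lambda>t. gpdf M X t \<phi>)" "continuous_on {0..b} (\<lambda>t. gpdf M X t (deriv \<phi>) - deriv \<phi> 0)"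
      if "b \<in> {0<..T}" for b
      using that unfolding gpdf_def
      by (auto intro!: continuous_intros EML_continuous[OF \<alpha>01 lam X] test_fun_cont_lim test_fun_deriv \<phi>)
    show "tempered_differentiable {0<..T} \<alpha> lam (\<lambda>t. gpdf M X t \<phi>)"
      "t \<in> {0<..T} \<Longrightarrow> tempered_deriv {0<..T} \<alpha> lam (\<lambda>t. gpdf M X t \<phi>) t =
        \<phi> 0 * tempered_deriv {0<..T} \<alpha> lam (\<lambda>_. 1) t + (deriv \<phi> 0 * ?a) * tempered_deriv {0<..T} \<alpha> lam (\<lambda>t. t) t
        + (gpdf M X t (deriv \<phi>) - deriv \<phi> 0)"
      "tempered_differentiable {0<..T} \<alpha> lam (\<lambda>_. 1)" "tempered_differentiable {0<..T} \<alpha> lam (\<lambda>t. t)"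
      using * c by blast+
  qed
  \<comment> \<open>The differentiability of 1 and t does not involve \<phi>, but was derived for a
    given test function; the zero function serves as one.\<close>
  have test0: "test_fun (\<lambda>_. 0)"
  proof -
    have "(deriv ^^ n) (\<lambda>_. 0 :: real) = (\<lambda>_. 0)" for n by (induction n) auto
    then show ?thesis by (simp add: test_fun_def)
  qed

  have Hb: "bdd_functional 1 (\<lambda>f. \<integral>\<omega>. f (?H y \<omega>) \<partial>N)" for y
    by (intro bdd_functional_expectation inverse_measurable inverse_nonneg)
  have Hc: "continuous_on {0..t} (\<lambda>y. \<integral>\<omega>. expo i (?H y \<omega>) \<partial>N)" for t i
    unfolding expo_def by (rule inverse_mgf_continuous)
  have expi: "set_integrable lborel {0..t} (\<lambda>y. exp (- lam * y))" for t
    by (intro borel_integrable_atLeastAtMost' continuous_intros)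
  have mix: "(\<integral>\<omega>. exp (s * Xs t \<omega>) \<partial>Ms) = exp (- lam * t) * (\<integral>\<omega>. exp (s * ?H t \<omega>) \<partial>N) +
      lam * (LBINT y:{0..t}. exp (- lam * y) * (\<integral>\<omega>. exp (s * ?H y \<omega>) \<partial>N))" if "0 \<le> t" for s t
    unfolding EML_star_mgf[OF \<alpha>01 lam Xs that] by (rule mixture_mgf[OF lam that])
  \<comment> \<open>Both sides are bounded functionals of \<open>f\<close>, so the mixture identity
    spreads from exponentials to all of \<open>cont_lim\<close>.\<close>
  have mixf: "(\<integral>\<omega>. f (Xs t \<omega>) \<partial>Ms) = exp (- lam * t) * (\<integral>\<omega>. f (?H t \<omega>) \<partial>N) +
      lam * (LBINT y:{0..t}. exp (- lam * y) * (\<integral>\<omega>. f (?H y \<omega>) \<partial>N))" if t: "0 \<le> t" and f: "f \<in> cont_lim" for f t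
    by (rule bdd_functional_cont_lim_eq[OF EML_star_bdd_functional[OF \<alpha>01 lam Xs t] bdd_functional_add_scaled[OF bdd_functional_cmult[OF Hb] bdd_functional_time_integral[OF Hb Hc expi]] _ f])
      (unfold expo_def, rule mix[OF t])

  show ?thesis
  proof (intro conjI allI impI ballI)
    show "tempered_differentiable {0<..} \<alpha> lam (\<lambda>_. 1)" by (rule star(3)[OF test0])
    show "dist_tempered_differentiable {0<..} \<alpha> lam (gpdf Ms Xs)"
      unfolding dist_tempered_differentiable_def using star(1) by blast
    show "dist_eq (dist_tempered_deriv {0<..} \<alpha> lam (gpdf Ms Xs) t)
         (\<lambda>\<phi>. - weak_deriv (gpdf Ms Xs t) \<phi> + dirac \<phi> * tempered_deriv {0<..} \<alpha> lam (\<lambda>_. 1) t)" if "0 < t" for t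
      using star(2) that by (simp add: dist_eq_def dist_tempered_deriv_def weak_deriv_def dirac_def)
    show "tempered_differentiable {0<..T} \<alpha> lam (\<lambda>_. 1)" by (rule eml(3)[OF test0])
    show "tempered_differentiable {0<..T} \<alpha> lam (\<lambda>t. t)" by (rule eml(4)[OF test0])
    show "dist_tempered_differentiable {0<..T} \<alpha> lam (gpdf M X)"
      unfolding dist_tempered_differentiable_def using eml(1) by blast
    show "dist_eq (dist_tempered_deriv {0<..T} \<alpha> lam (gpdf M X) t)
         (\<lambda>\<phi>. - weak_deriv (gpdf M X t) \<phi>
               + (dirac \<phi> * tempered_deriv {0<..T} \<alpha> lam (\<lambda>_. 1) t
                  + weak_deriv dirac \<phi>
                  - weak_deriv dirac \<phi> * a_coeff \<alpha> lam b T
                      * tempered_deriv {0<..T} \<alpha> lam (\<lambda>t. t) t))" if "t \<in> {0<..T}" for t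
      using eml(2) that by (simp add: dist_eq_def dist_tempered_deriv_def weak_deriv_def dirac_def)
    show "transposed_density (\<lambda>x t. t / (x * \<alpha>)) (\<lambda>x. distr N borel (D x))
       (\<lambda>t. distr N borel (?H t))" by (rule transposed_density_stable)
  next
    fix t :: real assume t: "0 \<le> t"
    show "dist_integrable (\<lambda>y \<phi>. exp (- lam * y) * gpdf N ?H y \<phi>) t"
      unfolding dist_integrable_def gpdf_def
      by (intro allI impI set_integrable_mult_continuous expi bdd_functional_continuous_on[OF Hb Hc] test_fun_cont_lim)
    show "dist_eq (gpdf Ms Xs t) (\<lambda>\<phi>. exp (- lam * t) * gpdf N ?H t \<phi>
                + lam * dist_integral (\<lambda>y \<phi>. exp (- lam * y) * gpdf N ?H y \<phi>) t \<phi>)"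
      unfolding dist_eq_def gpdf_def dist_integral_def by (intro allI impI mixf t test_fun_cont_lim)
  next
    fix g :: "real \<Rightarrow> real \<Rightarrow> real" and t :: real assume g: "stable_density N D g" and t: "0 < t"
    interpret stable_density_process \<alpha> N D g
      by (intro stable_density_process.intro stable_process_axioms stable_density_process_axioms.intro g)
    show "distributed N lborel (?H t) (\<lambda>x. ennreal (inverse_density \<alpha> g x t))" by (rule inverse_distributed[OF t])
    show "set_integrable lborel {0..t} (\<lambda>y. exp (- lam * y) * inverse_density \<alpha> g x y)" if "0 < x" for x
      using t by (intro inverse_density_integrable that lam) simp
    show "distributed Ms lborel (Xs t) (\<lambda>x. ennreal (exp (- lam * t) * inverse_density \<alpha> g x t
                + lam * (LBINT y:{0..t}. exp (- lam * y) * inverse_density \<alpha> g x y)))"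
    proof (rule mixture_distributed[OF lam t])
      show "prob_space Ms" "Xs t \<in> borel_measurable Ms" "AE \<omega> in Ms. 0 \<le> Xs t \<omega>"
        using Xs t by (auto simp: EML_star_def)
      show "set_integrable lborel {0..t} (\<lambda>y. exp (- lam * y) * (\<integral>\<omega>. exp (- real i * ?H y \<omega>) \<partial>N))" for i
        by (intro set_integrable_mult_continuous expi inverse_mgf_continuous)
      show "(\<integral>\<omega>. exp (- real i * Xs t \<omega>) \<partial>Ms) = exp (- lam * t) * (\<integral>\<omega>. exp (- real i * ?H t \<omega>) \<partial>N) +
        lam * (LBINT y:{0..t}. exp (- lam * y) * (\<integral>\<omega>. exp (- real i * ?H y \<omega>) \<partial>N))" for i
        using t by (intro mix) simp
    qed
  next
    fix t :: real assume t: "t \<in> {0..T}"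
    show "dist_integrable (\<lambda>y. weak_deriv (gpdf Ms Xs y)) t"
      unfolding dist_integrable_def weak_deriv_def gpdf_def
      by (intro allI impI borel_integrable_atLeastAtMost' continuous_intros EML_star_continuous[OF \<alpha>01 lam Xs] test_fun_cont_lim test_fun_deriv)
    show "dist_eq (gpdf M X t) (\<lambda>\<phi>. - ?a * dist_integral (\<lambda>y. weak_deriv (gpdf Ms Xs y)) t \<phi> + dirac \<phi>)"
      unfolding dist_eq_def
    proof (intro allI impI)
      fix \<phi> assume \<phi>: "test_fun \<phi>"
      have "dist_integral (\<lambda>y. weak_deriv (gpdf Ms Xs y)) t \<phi> = - (LBINT y:{0..t}. (\<integral>\<omega>. deriv \<phi> (Xs y \<omega>) \<partial>Ms))"
        by (simp add: dist_integral_def weak_deriv_def gpdf_def set_lebesgue_integral_def)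
      then show "gpdf M X t \<phi> = - ?a * dist_integral (\<lambda>y. weak_deriv (gpdf Ms Xs y)) t \<phi> + dirac \<phi>"
        using EML_of_EML_star[OF \<alpha>01 lam X Xs \<phi> t] by (simp add: gpdf_def dirac_def)
    qed
  qed
qed

end
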